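(* Let $K$ be an algebraically closed field of characteristic $0$ and let $G$ be a finite cyclic group of order $n$. Let $R_K(G)$ be the representation ring of $G$ over $K$, and for each proper subgroup $H < G$ let $\mathrm{Ind}_H^G(R_K(H))$ be the ideal of $R_K(G)$ that is the image of the induction map $\mathrm{Ind}_H^G : R_K(H) \to R_K(G)$. Then there is a ring isomorphism $$\frac{R_K(G)}{\sum_{H < G} \mathrm{Ind}_H^G(R_K(H))} \cong \frac{\mathbb{Z}[X]}{\langle \Phi_n(X)\rangle},$$ where the sum of ideals runs over all proper subgroups $H$ of $G$ and $\Phi_n$ denotes the $n$-th cyclotomic polynomial.
   Context: For an Abelian group $G$ and a field $K$, a $K$-representation of $G$ is a pair $(\rho,V)$ with $V$ a $K$-vector space and $\rho: G\to \mathrm{GL}(V)$ a homomorphism (equivalently, a $K[G]$-module $V$). The representation ring $R_K(G)$ is the Abelian group generated by isomorphism classes $[V]$ of finite dimensional $K$-representations of $G$, modulo the relations $[V_1]+[V_2]=[V_1\oplus V_2]$; its multiplication is the $\mathbb{Z}$-bilinear extension of $[V_1]\times[V_2]=[V_1\otimes_K V_2]$ (with $G$ acting diagonally), and its identity is the class of the trivial representation $K$. For a subgroup $H\le G$ and a representation $W$ of $H$, the induced representation is $\mathrm{Ind}_H^G(W) := W\otimes_{K[H]}K[G]$; this extends $\mathbb{Z}$-linearly to a homomorphism of Abelian groups $\mathrm{Ind}_H^G: R_K(H)\to R_K(G)$, whose image is an ideal of $R_K(G)$. If $G$ is trivial there are no proper subgroups and the sum of ideals is the zero ideal. *)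

theory Defs
  imports
    Complex_Main
    "HOL-Computational_Algebra.Polynomial"
    "HOL-Algebra.Free_Abelian_Groups"
    "HOL-Algebra.Elementary_Groups"
    "HOL-Algebra.Bij"
    "HOL-Algebra.QuotRing"
    "HOL-Algebra.Module"
begin

text \<open>The commutative ring of a whole type, as a ring record. It is used for the field
  \<open>'k\<close> and for the polynomial ring \<open>int poly\<close>.\<close>

definition type_ring :: "'a::comm_ring_1 ring" where
  "type_ring = \<lparr>carrier = UNIV, mult = (*), one = 1, zero = 0, add = (+)\<rparr>"


subsection \<open>Tensor products of modules over a commutative ring\<close>

text \<open>The map on cosets of \<open>N\<close> induced by a map \<open>f\<close> on representatives;
  \<open>G\<close> is the target group.\<close>

definition coset_lift ::
    "('b, 'm) monoid_scheme \<Rightarrow> 'b set \<Rightarrow> ('a \<Rightarrow> 'b) \<Rightarrow> 'a set \<Rightarrow> 'b set" where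
  "coset_lift G N f X = (\<Union>x\<in>X. N #>\<^bsub>G\<^esub> f x)"

definition tensor_relations ::
    "('r, 'a) ring_scheme \<Rightarrow> ('r, 'm, 'b) module_scheme \<Rightarrow> ('r, 'n, 'c) module_scheme
      \<Rightarrow> ('m \<times> 'n \<Rightarrow>\<^sub>0 int) set" where
  "tensor_relations R M N = generate (free_Abelian_group (carrier M \<times> carrier N))
     ({frag_of (x \<oplus>\<^bsub>M\<^esub> x', y) - frag_of (x, y) - frag_of (x', y) | x x' y.
         x \<in> carrier M \<and> x' \<in> carrier M \<and> y \<in> carrier N} \<union>
      {frag_of (x, y \<oplus>\<^bsub>N\<^esub> y') - frag_of (x, y) - frag_of (x, y') | x y y'.
         x \<in> carrier M \<and> y \<in> carrier N \<and> y' \<in> carrier N} \<union>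
      {frag_of (r \<odot>\<^bsub>M\<^esub> x, y) - frag_of (x, r \<odot>\<^bsub>N\<^esub> y) | r x y.
         r \<in> carrier R \<and> x \<in> carrier M \<and> y \<in> carrier N})"

text \<open>The endomorphism of the tensor product sending each \<open>x \<otimes> y\<close> to \<open>p \<otimes> q\<close>,
  where \<open>(p, q) = f (x, y)\<close>.\<close>

definition tensor_map ::
    "('r, 'a) ring_scheme \<Rightarrow> ('r, 'm, 'b) module_scheme \<Rightarrow> ('r, 'n, 'c) module_scheme
      \<Rightarrow> ('m \<times> 'n \<Rightarrow> 'm \<times> 'n) \<Rightarrow> ('m \<times> 'n \<Rightarrow>\<^sub>0 int) set \<Rightarrow> ('m \<times> 'n \<Rightarrow>\<^sub>0 int) set" where
  "tensor_map R M N f =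
     coset_lift (free_Abelian_group (carrier M \<times> carrier N)) (tensor_relations R M N)
       (frag_extend (\<lambda>p. frag_of (f p)))"

text \<open>The record type of modules extends that of rings; its fields \<open>mult\<close> and \<open>one\<close> carry no
  meaning for a module.\<close>

definition tensor_module ::
    "('r, 'a) ring_scheme \<Rightarrow> ('r, 'm, 'b) module_scheme \<Rightarrow> ('r, 'n, 'c) module_scheme
      \<Rightarrow> ('r, ('m \<times> 'n \<Rightarrow>\<^sub>0 int) set) module" where
  "tensor_module R M N =
     (let F = free_Abelian_group (carrier M \<times> carrier N); T = tensor_relations R M N
      in \<lparr>carrier = rcosets\<^bsub>F\<^esub> T, mult = undefined, one = undefined,
          zero = T, add = set_mult F,
          smult = (\<lambda>r. tensor_map R M N (\<lambda>(x, y). (r \<odot>\<^bsub>M\<^esub> x, y)))\<rparr>)"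


subsection \<open>Representations\<close>

text \<open>A pair \<open>(\<rho>, V)\<close>: a module record for \<open>V\<close> with the action \<open>\<rho>\<close> as an additional field.\<close>

record ('k, 'v, 'g) rep = "('k, 'v) module" +
  rep_act :: "'g \<Rightarrow> 'v \<Rightarrow> 'v"

definition linear_maps ::
    "('k::field, 'v, 'a) module_scheme \<Rightarrow> ('k, 'w, 'b) module_scheme \<Rightarrow> ('v \<Rightarrow> 'w) set" where
  "linear_maps V W = {f \<in> carrier V \<rightarrow> carrier W.
     (\<forall>x\<in>carrier V. \<forall>y\<in>carrier V. f (x \<oplus>\<^bsub>V\<^esub> y) = f x \<oplus>\<^bsub>W\<^esub> f y) \<and>
     (\<forall>c. \<forall>x\<in>carrier V. f (c \<odot>\<^bsub>V\<^esub> x) = c \<odot>\<^bsub>W\<^esub> f x)}"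

definition GL :: "('k::field, 'v, 'a) module_scheme \<Rightarrow> ('v \<Rightarrow> 'v) monoid" where
  "GL V = BijGroup (carrier V)\<lparr>carrier := Bij (carrier V) \<inter> linear_maps V V\<rparr>"

text \<open>Elements of \<open>Bij\<close> are extensional functions, so the values of the action outside \<open>V\<close>,
  which are irrelevant, are cut off.\<close>

definition is_rep ::
    "('g, 'b) monoid_scheme \<Rightarrow> ('k::field, 'v, 'g) rep \<Rightarrow> bool" where
  "is_rep G V \<longleftrightarrow> module type_ring V \<and>
     (\<lambda>g. restrict (rep_act V g) (carrier V)) \<in> hom G (GL V)"

definition fin_dim :: "('k::field, 'v, 'a) module_scheme \<Rightarrow> bool" where
  "fin_dim V \<longleftrightarrow> (\<exists>B. finite B \<and> B \<subseteq> carrier V \<and>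
     (\<forall>v\<in>carrier V. \<exists>c. v = (\<Oplus>\<^bsub>V\<^esub>b\<in>B. c b \<odot>\<^bsub>V\<^esub> b)))"

definition rep_iso ::
    "('g, 'b) monoid_scheme \<Rightarrow> ('k::field, 'v, 'g) rep \<Rightarrow> ('k, 'w, 'g) rep \<Rightarrow> bool" where
  "rep_iso G V W \<longleftrightarrow> (\<exists>f \<in> linear_maps V W. bij_betw f (carrier V) (carrier W) \<and>
     (\<forall>g\<in>carrier G. \<forall>x\<in>carrier V. f (rep_act V g x) = rep_act W g (f x)))"

definition trivial_rep :: "('k::field, 'k, 'g) rep" where
  "trivial_rep = \<lparr>carrier = UNIV, mult = undefined, one = undefined, zero = 0, add = (+),
     smult = (*), rep_act = (\<lambda>g x. x)\<rparr>"

definition direct_sum_rep ::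
    "('k::field, 'v, 'g) rep \<Rightarrow> ('k, 'w, 'g) rep \<Rightarrow> ('k, 'v \<times> 'w, 'g) rep" where
  "direct_sum_rep V W =
     \<lparr>carrier = carrier V \<times> carrier W, mult = undefined, one = undefined,
      zero = (\<zero>\<^bsub>V\<^esub>, \<zero>\<^bsub>W\<^esub>),
      add = (\<lambda>(v, w) (v', w'). (v \<oplus>\<^bsub>V\<^esub> v', w \<oplus>\<^bsub>W\<^esub> w')),
      smult = (\<lambda>c (v, w). (c \<odot>\<^bsub>V\<^esub> v, c \<odot>\<^bsub>W\<^esub> w)),
      rep_act = (\<lambda>g (v, w). (rep_act V g v, rep_act W g w))\<rparr>"

definition tensor_rep ::
    "('k::field, 'v, 'g) rep \<Rightarrow> ('k, 'w, 'g) rep \<Rightarrow> ('k, ('v \<times> 'w \<Rightarrow>\<^sub>0 int) set, 'g) rep" where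
  "tensor_rep V W = module.extend (tensor_module type_ring V W)
     (rep.fields (\<lambda>g. tensor_map type_ring V W
        (\<lambda>(v, w). (rep_act V g v, rep_act W g w))))"


subsection \<open>Group algebras and induced representations\<close>

definition group_algebra :: "('g, 'b) monoid_scheme \<Rightarrow> ('g \<Rightarrow>\<^sub>0 'k::field) ring" where
  "group_algebra G =
     \<lparr>carrier = {a. Poly_Mapping.keys a \<subseteq> carrier G},
      mult = (\<lambda>a b. \<Sum>g\<in>Poly_Mapping.keys a. \<Sum>h\<in>Poly_Mapping.keys b.
        Poly_Mapping.single (g \<otimes>\<^bsub>G\<^esub> h) (Poly_Mapping.lookup a g * Poly_Mapping.lookup b h)),
      one = Poly_Mapping.single \<one>\<^bsub>G\<^esub> 1, zero = 0, add = (+)\<rparr>"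

text \<open>A representation of \<open>H\<close>, regarded as a \<open>K[H]\<close>-module.\<close>

definition rep_module :: "('k::field, 'v, 'g) rep \<Rightarrow> ('g \<Rightarrow>\<^sub>0 'k, 'v) module" where
  "rep_module W =
     \<lparr>carrier = carrier W, mult = undefined, one = undefined,
      zero = \<zero>\<^bsub>W\<^esub>, add = add W,
      smult = (\<lambda>a w. \<Oplus>\<^bsub>W\<^esub>h\<in>Poly_Mapping.keys a.
        Poly_Mapping.lookup a h \<odot>\<^bsub>W\<^esub> rep_act W h w)\<rparr>"

text \<open>\<open>K[G]\<close> as a module over \<open>K[H]\<close>, for any subgroup \<open>H\<close> of \<open>G\<close>.\<close>

definition group_algebra_module ::
    "('g, 'b) monoid_scheme \<Rightarrow> ('g \<Rightarrow>\<^sub>0 'k::field, 'g \<Rightarrow>\<^sub>0 'k) module" where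
  "group_algebra_module G =
     ring.extend (group_algebra G) (module.fields (mult (group_algebra G)))"

text \<open>\<open>W \<otimes>\<^bsub>K[H]\<^esub> K[G]\<close> with \<open>G\<close> acting by multiplication on the factor \<open>K[G]\<close>. The group \<open>G\<close> is
  meant to be abelian, so that \<open>K[H]\<close> is commutative and left and right modules agree. The field
  \<open>K\<close> acts through its embedding into \<open>K[H]\<close>.\<close>

definition induced_rep ::
    "('g, 'b) monoid_scheme \<Rightarrow> 'g set \<Rightarrow> ('k::field, 'v, 'g) rep
      \<Rightarrow> ('k, ('v \<times> ('g \<Rightarrow>\<^sub>0 'k) \<Rightarrow>\<^sub>0 int) set, 'g) rep" where
  "induced_rep G H W =
     (let KH = group_algebra (G\<lparr>carrier := H\<rparr>); KG = group_algebra_module G;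
          T = tensor_module KH (rep_module W) KG
      in \<lparr>carrier = carrier T, mult = undefined, one = undefined,
          zero = \<zero>\<^bsub>T\<^esub>, add = add T,
          smult = (\<lambda>c X. Poly_Mapping.single \<one>\<^bsub>G\<^esub> c \<odot>\<^bsub>T\<^esub> X),
          rep_act = (\<lambda>g. tensor_map KH (rep_module W) KG
            (\<lambda>(w, a). (w, a \<otimes>\<^bsub>group_algebra G\<^esub> Poly_Mapping.single g 1)))\<rparr>)"


subsection \<open>The representation ring\<close>

text \<open>To have a set of isomorphism classes, the underlying sets of representatives are taken in
  the type \<open>nat \<Rightarrow> 'k\<close>, which contains a copy of \<open>K\<^sup>d\<close> for every \<open>d\<close>. The class of a
  finite-dimensional representation on an arbitrary type consists of all its isomorphic copies
  in this universe.\<close>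

type_synonym ('k, 'g) urep = "('k, nat \<Rightarrow> 'k, 'g) rep"

definition fd_reps :: "('g, 'b) monoid_scheme \<Rightarrow> ('k::field, 'g) urep set" where
  "fd_reps G = {V. is_rep G V \<and> fin_dim V}"

definition iso_class ::
    "('g, 'b) monoid_scheme \<Rightarrow> ('k::field, 'v, 'g) rep \<Rightarrow> ('k, 'g) urep set" where
  "iso_class G V = {U \<in> fd_reps G. rep_iso G U V}"

definition iso_classes :: "('g, 'b) monoid_scheme \<Rightarrow> ('k::field, 'g) urep set set" where
  "iso_classes G = iso_class G ` fd_reps G"

definition class_rep :: "('k::field, 'g) urep set \<Rightarrow> ('k, 'g) urep" where
  "class_rep c = (SOME V. V \<in> c)"

text \<open>The free abelian group on the isomorphism classes, with the \<open>\<int>\<close>-bilinear extension of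
  \<open>[V] \<times> [W] = [V \<otimes> W]\<close>.\<close>

definition free_rep_ring ::
    "('g, 'b) monoid_scheme \<Rightarrow> (('k::field, 'g) urep set \<Rightarrow>\<^sub>0 int) ring" where
  "free_rep_ring G =
     \<lparr>carrier = carrier (free_Abelian_group (iso_classes G)),
      mult = (\<lambda>a b. frag_extend (\<lambda>c. frag_extend (\<lambda>d.
        frag_of (iso_class G (tensor_rep (class_rep c) (class_rep d)))) b) a),
      one = frag_of (iso_class G trivial_rep), zero = 0, add = (+)\<rparr>"

definition rep_relations ::
    "('g, 'b) monoid_scheme \<Rightarrow> (('k::field, 'g) urep set \<Rightarrow>\<^sub>0 int) set" where
  "rep_relations G = generate (add_monoid (free_rep_ring G))
     {frag_of (iso_class G V) + frag_of (iso_class G W) - frag_of (iso_class G (direct_sum_rep V W))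
       | V W. V \<in> fd_reps G \<and> W \<in> fd_reps G}"

definition rep_ring ::
    "'k::field itself \<Rightarrow> ('g, 'b) monoid_scheme \<Rightarrow> (('k, 'g) urep set \<Rightarrow>\<^sub>0 int) set ring" where
  "rep_ring K G = free_rep_ring G Quot rep_relations G"

definition induction ::
    "'k::field itself \<Rightarrow> ('g, 'b) monoid_scheme \<Rightarrow> 'g set
      \<Rightarrow> (('k, 'g) urep set \<Rightarrow>\<^sub>0 int) set \<Rightarrow> (('k, 'g) urep set \<Rightarrow>\<^sub>0 int) set" where
  "induction K G H =
     coset_lift (add_monoid (free_rep_ring G)) (rep_relations G)
       (frag_extend (\<lambda>c. frag_of (iso_class G (induced_rep G H (class_rep c)))))"

definition induction_image ::
    "'k::field itself \<Rightarrow> ('g, 'b) monoid_scheme \<Rightarrow> 'g set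
      \<Rightarrow> (('k, 'g) urep set \<Rightarrow>\<^sub>0 int) set set" where
  "induction_image K G H = induction K G H ` carrier (rep_ring K (G\<lparr>carrier := H\<rparr>))"

definition proper_subgroups :: "('g, 'b) monoid_scheme \<Rightarrow> 'g set set" where
  "proper_subgroups G = {H. subgroup H G \<and> H \<noteq> carrier G}"

text \<open>Over an empty index set this sum is the zero ideal.\<close>

definition sum_ideals ::
    "('a, 'b) ring_scheme \<Rightarrow> 'i set \<Rightarrow> ('i \<Rightarrow> 'a set) \<Rightarrow> 'a set" where
  "sum_ideals R A I = {\<Oplus>\<^bsub>R\<^esub>i\<in>A. x i | x. \<forall>i\<in>A. x i \<in> I i}"


subsection \<open>Cyclotomic polynomials\<close>

definition primitive_roots_unity :: "nat \<Rightarrow> complex set" where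
  "primitive_roots_unity n = {z. z ^ n = 1 \<and> (\<forall>m. 0 < m \<and> m < n \<longrightarrow> z ^ m \<noteq> 1)}"

definition cyclotomic :: "nat \<Rightarrow> int poly" where
  "cyclotomic n =
     (THE p. map_poly of_int p = (\<Prod>z\<in>primitive_roots_unity n. [:- z, 1:]))"

end

theory Submission
  imports Defs
    "HOL-Computational_Algebra.Primes"
    "HOL-Library.Function_Algebras"
    "HOL-Algebra.Multiplicative_Group"
begin

text \<open>Fix a generator \<open>g\<close> of \<open>G\<close> and a primitive \<open>n\<close>-th root of unity \<open>\<zeta>\<close> in \<open>K\<close>. Every
  representation is a sum of lines on which \<open>g\<close> acts by powers \<open>\<zeta>\<^sup>k\<close>, so it is determined by its
  weight polynomial \<open>\<Sum>\<^sub>k dim V\<^sub>k X\<^sup>k\<close>. Direct sums and tensor products become sums and products modulo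
  \<open>X\<^sup>n - 1\<close>, whence \<open>R\<^sub>K(G) = \<int>[X]/(X\<^sup>n - 1)\<close>. Inducing from the subgroup of order \<open>m\<close>
  multiplies the weight polynomial by \<open>(X\<^sup>n - 1)/(X\<^sup>m - 1)\<close>. It remains to see that these
  quotients, for \<open>m\<close> a proper divisor of \<open>n\<close>, generate the ideal \<open>(\<Phi>\<^sub>n)\<close> modulo \<open>X\<^sup>n - 1\<close>. The point is
  that \<open>\<Phi>\<^sub>a\<close> and \<open>\<Phi>\<^sub>b\<close> are comaximal in \<open>\<int>[X]\<close> when neither of \<open>a\<close>, \<open>b\<close> divides the other.\<close>

text \<open>The obstacle is that everything must hold over the integers. For a prime p the
  cyclotomic polynomials of index m and mp always have a common root modulo p, so coprimality over
  the rationals says nothing about the ideal in Z[X]. The elimination is therefore arranged so that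
  only factors with incomparable indices are ever combined, and the subgroups of prime index suffice
  for it.

  On the side of representations, a tensor product is a quotient of a huge free abelian group, with
  no basis given. Explicit coordinates with an explicit section supply one. The same setting serves
  the product over K and the induced representation, because the Fourier transform makes K[G]
  diagonal as well.

  Polynomials of degree below n represent the classes modulo X^n - 1. On these representatives
  addition is literal, but multiplication holds only up to multiples of X^n - 1. Well-definedness of
  products and the ideal of relations are therefore read off from polynomials, and the map becomes a
  ring homomorphism only after the final projection modulo the cyclotomic polynomial.\<close>

hide_const (open) up_ring.monom up_ring.coeff

abbreviation keys where "keys \<equiv> Poly_Mapping.keys"
abbreviation lookup where "lookup \<equiv> Poly_Mapping.lookup"
abbreviation single where "single \<equiv> Poly_Mapping.single"

subsection \<open>Cyclotomic polynomials over the integers\<close>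

definition unity_poly :: "nat \<Rightarrow> 'a::comm_ring_1 poly" where
  "unity_poly n = monom 1 n - 1"

lemma unity_poly_0 [simp]: "unity_poly 0 = 0"
  by (simp add: unity_poly_def)

lemma poly_unity_poly [simp]: "poly (unity_poly n) x = x ^ n - 1"
  by (simp add: unity_poly_def poly_monom)

lemma degree_unity_poly: "n > 0 \<Longrightarrow> degree (unity_poly n :: 'a::comm_ring_1 poly) = n"
  unfolding unity_poly_def
  by (rule order.antisym)
    (auto intro!: degree_le le_degree simp: coeff_diff coeff_1 split: if_splits)

lemma coeff_unity_poly_self: "n > 0 \<Longrightarrow> coeff (unity_poly n :: 'a::comm_ring_1 poly) n = 1"
  by (simp add: unity_poly_def)

lemma lead_coeff_unity_poly: "n > 0 \<Longrightarrow> lead_coeff (unity_poly n :: 'a::comm_ring_1 poly) = 1"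
  by (simp add: degree_unity_poly coeff_unity_poly_self)

lemma unity_poly_nz: "n > 0 \<Longrightarrow> (unity_poly n :: 'a::comm_ring_1 poly) \<noteq> 0"
  by (metis coeff_0 coeff_unity_poly_self zero_neq_one)

section \<open>Passing from integer polynomials to other coefficient rings\<close>

abbreviation int_poly :: "int poly \<Rightarrow> 'a::ring_1 poly" where
  "int_poly \<equiv> map_poly of_int"

lemma int_poly_add [simp]: "int_poly (p + q) = int_poly p + int_poly q"
  by (rule poly_eqI) (simp add: coeff_map_poly)

lemma int_poly_diff [simp]: "int_poly (p - q) = int_poly p - int_poly q"
  by (rule poly_eqI) (simp add: coeff_map_poly)

lemma int_poly_mult [simp]: "int_poly (p * q) = (int_poly p * int_poly q :: 'a::comm_ring_1 poly)"
  by (rule poly_eqI) (simp add: coeff_map_poly coeff_mult)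

lemma int_poly_1 [simp]: "int_poly 1 = 1"
  by (rule poly_eqI) (simp add: coeff_map_poly)

lemma int_poly_prod [simp]: "int_poly (prod f A) = (\<Prod>x\<in>A. int_poly (f x) :: 'a::comm_ring_1 poly)"
  by (induction A rule: infinite_finite_induct) auto

lemma int_poly_unity_poly [simp]: "int_poly (unity_poly n) = (unity_poly n :: 'a::comm_ring_1 poly)"
  by (rule poly_eqI) (simp add: coeff_map_poly unity_poly_def)

lemma int_poly_inject: "int_poly p = (int_poly q :: 'a::ring_char_0 poly) \<longleftrightarrow> p = q"
  by (auto simp: poly_eq_iff coeff_map_poly)

lemma degree_int_poly [simp]: "degree (int_poly p :: 'a::ring_char_0 poly) = degree p"
  by (rule degree_map_poly) simp

text \<open>Pseudo-division scales the dividend by a power of the leading coefficient of the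
  divisor. For a monic divisor this is honest division with remainder, available over the
  integers.\<close>

lemma monic_divE:
  fixes b :: "'a::comm_ring_1 poly"
  assumes "lead_coeff b = 1"
  obtains q r where "a = b * q + r" "r = 0 \<or> degree r < degree b"
proof -
  obtain q r where qr: "pseudo_divmod a b = (q, r)" by fastforce
  have "b \<noteq> 0" using assms by auto
  show thesis
    using pseudo_divmod[OF \<open>b \<noteq> 0\<close> qr] assms by (intro that[of q r]) auto
qed

lemma prod_linear_factors_monic:
  fixes p :: "'a::idom poly"
  assumes "lead_coeff p = 1" "finite A" "card A = degree p" "\<And>z. z \<in> A \<Longrightarrow> poly p z = 0"
  shows "p = (\<Prod>z\<in>A. [:-z, 1:])"
proof (rule poly_eqI_degree_lead_coeff[of _ "degree p" _ A])
  have d: "degree (\<Prod>z\<in>A. [:-z, 1:]) = degree p"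
    using assms by (subst degree_prod_sum_eq) auto
  then show "degree (\<Prod>z\<in>A. [:-z, 1:]) \<le> degree p" by simp
  have "lead_coeff (\<Prod>z\<in>A. [:-z, 1:]) = 1"
    by (simp add: lead_coeff_prod)
  with d assms(1) show "coeff p (degree p) = coeff (\<Prod>z\<in>A. [:-z, 1:]) (degree p)"
    by simp
qed (use assms in \<open>auto simp: poly_prod\<close>)

lemma unity_poly_complex: "n > 0 \<Longrightarrow> unity_poly n = (\<Prod>z\<in>{z::complex. z ^ n = 1}. [:-z, 1:])"
  by (rule prod_linear_factors_monic)
    (auto simp: coeff_unity_poly_self degree_unity_poly card_roots_unity_eq finite_roots_unity)

lemma root_unity_order:
  fixes z :: "'a::field"
  assumes "n > 0" "z ^ n = 1"
  obtains d where "d > 0" "z ^ d = 1" "\<And>m. 0 < m \<Longrightarrow> m < d \<Longrightarrow> z ^ m \<noteq> 1"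
    "\<And>m. z ^ m = 1 \<longleftrightarrow> d dvd m"
proof -
  define d where "d = (LEAST d. d > 0 \<and> z ^ d = 1)"
  have d: "d > 0 \<and> z ^ d = 1"
    unfolding d_def by (rule LeastI[of _ n]) (use assms in auto)
  have least: "z ^ m \<noteq> 1" if "0 < m" "m < d" for m
    using not_less_Least[of m "\<lambda>d. d > 0 \<and> z ^ d = 1"] that unfolding d_def by auto
  have "z ^ m = z ^ (m mod d)" for m
  proof -
    have "z ^ m = z ^ (d * (m div d) + m mod d)" by simp
    also have "\<dots> = z ^ (m mod d)" using d by (simp only: power_add power_mult) simp
    finally show ?thesis .
  qed
  then have "z ^ m = 1 \<longleftrightarrow> d dvd m" for m
    using least[of "m mod d"] d by (metis dvd_eq_mod_eq_0 mod_less_divisor not_gr_zero power_0)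
  with that d least show thesis by blast
qed

lemma root_unity_partition:
  assumes "n > 0"
  shows "{z::complex. z ^ n = 1} = (\<Union>d\<in>{d. d dvd n}. primitive_roots_unity d)"
proof (intro equalityI subsetI)
  fix z :: complex assume "z \<in> {z. z ^ n = 1}"
  then show "z \<in> (\<Union>d\<in>{d. d dvd n}. primitive_roots_unity d)"
  proof -
    have zn: "z ^ n = 1" using \<open>z \<in> {z. z ^ n = 1}\<close> by simp
    obtain d where d: "d > 0" "z ^ d = 1" "\<And>m. 0 < m \<Longrightarrow> m < d \<Longrightarrow> z ^ m \<noteq> 1"
      "\<And>m. z ^ m = 1 \<longleftrightarrow> d dvd m"
      using root_unity_order[OF assms zn] by blast
    then have "z \<in> primitive_roots_unity d" by (simp add: primitive_roots_unity_def)
    moreover have "d dvd n" using d(4) zn by blast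
    ultimately show ?thesis by blast
  qed
next
  fix z assume "z \<in> (\<Union>d\<in>{d. d dvd n}. primitive_roots_unity d)"
  then show "z \<in> {z. z ^ n = 1}"
    by (auto simp: primitive_roots_unity_def power_mult)
qed

lemma primitive_roots_unity_disjoint:
  assumes "d > 0" "e > 0" "d \<noteq> e"
  shows "primitive_roots_unity d \<inter> primitive_roots_unity e = {}"
  using assms nat_neq_iff[of d e] by (auto simp: primitive_roots_unity_def)

lemma finite_primitive_roots_unity: "d > 0 \<Longrightarrow> finite (primitive_roots_unity d)"
  by (rule finite_subset[OF _ finite_roots_unity[of d, where 'a=complex]])
    (auto simp: primitive_roots_unity_def)

lemma primitive_roots_unity_nonempty:
  assumes "n > 0" shows "primitive_roots_unity n \<noteq> {}"
proof -
  have inj: "inj_on (\<lambda>k. cis (2 * pi * real k / real n)) {0..<n}"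
    using bij_betw_roots_unity[OF assms] by (simp add: bij_betw_def lessThan_atLeast0)
  have "cis (2 * pi / real n) ^ m \<noteq> 1" if "0 < m" "m < n" for m
  proof -
    have "cis (2 * pi / real n) ^ m = cis (2 * pi * real m / real n)"
      by (simp add: DeMoivre mult.commute mult.left_commute)
    also have "\<dots> \<noteq> cis (2 * pi * real 0 / real n)"
      using inj_onD[OF inj, of m 0] that by fastforce
    finally show ?thesis by simp
  qed
  moreover have "cis (2 * pi / real n) ^ n = 1"
    using assms by (simp add: DeMoivre)
  ultimately have "cis (2 * pi / real n) \<in> primitive_roots_unity n"
    by (auto simp: primitive_roots_unity_def)
  then show ?thesis by blast
qed

definition cyclotomic_complex :: "nat \<Rightarrow> complex poly" where
  "cyclotomic_complex n = (\<Prod>z\<in>primitive_roots_unity n. [:-z, 1:])"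

lemma unity_poly_prod_complex:
  assumes "n > 0"
  shows "unity_poly n = (\<Prod>d\<in>{d. d dvd n}. cyclotomic_complex d)"
  unfolding unity_poly_complex[OF assms] root_unity_partition[OF assms] cyclotomic_complex_def
proof (intro prod.UNION_disjoint ballI impI)
  show "finite {d. d dvd n}" using assms by (simp add: finite_divisors_nat)
next
  fix i assume "i \<in> {d. d dvd n}"
  then show "finite (primitive_roots_unity i)"
    using assms by (intro finite_primitive_roots_unity) (auto intro: dvd_pos_nat)
next
  fix i j assume "i \<in> {d. d dvd n}" "j \<in> {d. d dvd n}" "i \<noteq> j"
  then show "primitive_roots_unity i \<inter> primitive_roots_unity j = {}"
    using assms by (intro primitive_roots_unity_disjoint) (auto intro: dvd_pos_nat)
qed

text \<open>By induction the product \<open>Q\<close> of the factors of smaller index has integer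
  coefficients and is monic, so X^n - 1 can be divided by it over the integers. Over the complex
  numbers the division is exact, with the cyclotomic polynomial as quotient, and a degree comparison
  shows that the integer quotient is the same.\<close>

lemma cyclotomic_complex_integral:
  "n > 0 \<Longrightarrow> \<exists>p. int_poly p = cyclotomic_complex n"
proof (induction n rule: less_induct)
  case (less n)
  let ?D = "{d. d dvd n} - {n}"
  have fin: "finite {d. d dvd n}" using less.prems by (simp add: finite_divisors_nat)
  have "\<exists>p. int_poly p = cyclotomic_complex d" if "d \<in> ?D" for d
  proof -
    have "d > 0" "d < n"
      using that less.prems dvd_imp_le[of d n] dvd_pos_nat[of n d] by auto
    then show ?thesis using less.IH by blast
  qed
  then obtain f where f: "\<And>d. d \<in> ?D \<Longrightarrow> int_poly (f d) = cyclotomic_complex d" by metis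
  define Q where "Q = (\<Prod>d\<in>?D. f d)"
  have Q: "int_poly Q = (\<Prod>d\<in>?D. cyclotomic_complex d)" by (simp add: Q_def f)
  have x: "unity_poly n = cyclotomic_complex n * int_poly Q"
    unfolding unity_poly_prod_complex[OF less.prems] Q
    using fin by (subst prod.remove[of _ n]) auto
  have "lead_coeff (int_poly Q :: complex poly) = 1"
    unfolding Q by (simp add: lead_coeff_prod cyclotomic_complex_def)
  then have lQ: "lead_coeff Q = 1"
    by (simp add: coeff_map_poly)
  obtain q r where qr: "unity_poly n = Q * q + r" "r = 0 \<or> degree r < degree Q"
    using monic_divE[OF lQ] by blast
  have "int_poly (unity_poly n) = (int_poly Q * int_poly q + int_poly r :: complex poly)"
    unfolding qr(1) by simp
  then have e: "int_poly r = (cyclotomic_complex n - int_poly q) * int_poly Q"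
    using x by (simp add: algebra_simps)
  have "cyclotomic_complex n = int_poly q"
  proof (rule ccontr)
    assume "cyclotomic_complex n \<noteq> int_poly q"
    moreover have "int_poly Q \<noteq> (0 :: complex poly)" using lQ by (metis int_poly_inject map_poly_0 leading_coeff_0_iff zero_neq_one)
    ultimately have "degree (int_poly r :: complex poly) \<ge> degree Q" "int_poly r \<noteq> (0::complex poly)"
      unfolding e by (auto simp: degree_mult_eq)
    with qr(2) show False by auto
  qed
  then show ?case by metis
qed

text \<open>This justifies the definite description in \<open>cyclotomic\<close>: integrality gives
  existence, and injectivity of the passage from integer to complex coefficients gives
  uniqueness.\<close>

lemma int_poly_cyclotomic: "n > 0 \<Longrightarrow> int_poly (cyclotomic n) = cyclotomic_complex n"
proof -
  assume "n > 0"
  then obtain p where p: "int_poly p = cyclotomic_complex n" using cyclotomic_complex_integral by blast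
  show ?thesis
    unfolding cyclotomic_def cyclotomic_complex_def[symmetric]
    using p by (rule theI) (metis p int_poly_inject)
qed

lemma unity_poly_prod_cyclotomic: "n > 0 \<Longrightarrow> unity_poly n = (\<Prod>d\<in>{d. d dvd n}. cyclotomic d)"
proof -
  assume n: "n > 0"
  have "int_poly (\<Prod>d\<in>{d. d dvd n}. cyclotomic d) = (unity_poly n :: complex poly)"
    using n by (simp add: unity_poly_prod_complex int_poly_cyclotomic dvd_pos_nat)
  then show ?thesis
    by (metis int_poly_inject int_poly_unity_poly)
qed

text \<open>Nonconstancy, seen from a primitive complex root, is what later gives a root in the
  algebraically closed field K.\<close>

lemma degree_cyclotomic_pos: "n > 0 \<Longrightarrow> degree (cyclotomic n) > 0"
proof -
  assume n: "n > 0"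
  have "degree (cyclotomic n) = degree (cyclotomic_complex n)"
    using int_poly_cyclotomic[OF n] by (metis degree_int_poly)
  also have "\<dots> = card (primitive_roots_unity n)"
    unfolding cyclotomic_complex_def by (subst degree_prod_sum_eq) auto
  finally show ?thesis
    using n primitive_roots_unity_nonempty finite_primitive_roots_unity by (simp add: card_gt_0_iff)
qed

lemma unity_poly_dvd_split:
  assumes "m dvd n" "n > 0"
  shows "unity_poly n = unity_poly m * (\<Prod>d\<in>{d. d dvd n \<and> \<not> d dvd m}. cyclotomic d)"
proof -
  have m: "m > 0" using assms by (simp add: dvd_pos_nat)
  have fin: "finite {d. d dvd n}" using assms by (simp add: finite_divisors_nat)
  have D: "{d. d dvd n} = {d. d dvd m} \<union> {d. d dvd n \<and> \<not> d dvd m}"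
    using assms(1) dvd_trans by blast
  have "(\<Prod>d\<in>{d. d dvd n}. cyclotomic d)
      = (\<Prod>d\<in>{d. d dvd m}. cyclotomic d) * (\<Prod>d\<in>{d. d dvd n \<and> \<not> d dvd m}. cyclotomic d)"
    by (subst D, rule prod.union_disjoint) (use fin D in \<open>auto intro: finite_subset\<close>)
  then show ?thesis
    by (simp add: unity_poly_prod_cyclotomic[OF assms(2)] unity_poly_prod_cyclotomic[OF m])
qed

lemma unity_poly_mult_geometric: "unity_poly (m * d) = (unity_poly m * (\<Sum>i<d. monom 1 (m * i)) :: 'a::comm_ring_1 poly)"
proof (induction d)
  case (Suc d)
  have "unity_poly (m * Suc d) = unity_poly (m * d) + monom 1 (m * d) * (unity_poly m :: 'a poly)"
    by (simp add: unity_poly_def algebra_simps mult_monom)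
  then show ?case using Suc by (simp add: algebra_simps)
qed simp

text \<open>Both sides are the quotient of X^n - 1 by X^m - 1, and X^m - 1 can be cancelled. The
  left side is the factor produced by induction, the right side shows which cyclotomic polynomials
  divide it.\<close>

lemma geometric_eq_prod_cyclotomic:
  assumes "n = m * d" "n > 0"
  shows "(\<Sum>i<d. monom 1 (m * i)) = (\<Prod>d\<in>{d. d dvd n \<and> \<not> d dvd m}. cyclotomic d)"
proof -
  have "m > 0" using assms by simp
  have "unity_poly m * (\<Sum>i<d. monom 1 (m * i)) = unity_poly m * (\<Prod>d\<in>{d. d dvd n \<and> \<not> d dvd m}. cyclotomic d)"
    using unity_poly_mult_geometric[of m d, where 'a=int] unity_poly_dvd_split[of m n] assms by simp
  then show ?thesis using unity_poly_nz[OF \<open>m > 0\<close>, where 'a=int] by simp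
qed

text \<open>The two principal ideals together are the whole ring. In Z[X] this is stronger than
  having no common factor: 2 and X are coprime but not comaximal.\<close>

definition comaximal :: "'a::comm_ring_1 \<Rightarrow> 'a \<Rightarrow> bool" where
  "comaximal a b \<longleftrightarrow> (\<exists>u v. u * a + v * b = 1)"

lemma comaximal_sym: "comaximal a b \<Longrightarrow> comaximal b a"
  unfolding comaximal_def by (metis add.commute)

lemma comaximal_mult: "comaximal a b \<Longrightarrow> comaximal a c \<Longrightarrow> comaximal a (b * c)"
proof -
  assume "comaximal a b" "comaximal a c"
  then obtain u v u' v' where uv: "u * a + v * b = 1" "u' * a + v' * c = 1"
    unfolding comaximal_def by blast
  have "(u * u' * a + u * v' * c + v * b * u') * a + (v * v') * (b * c)
      = (u * a + v * b) * (u' * a + v' * c)"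
    by (simp only: algebra_simps)
  then have "(u * u' * a + u * v' * c + v * b * u') * a + (v * v') * (b * c) = 1"
    unfolding uv by simp
  then show ?thesis unfolding comaximal_def by blast
qed

lemma comaximal_1: "comaximal a 1"
proof -
  have "0 * a + 1 * 1 = 1" by simp
  then show ?thesis unfolding comaximal_def by blast
qed

lemma comaximal_prod: "(\<And>x. x \<in> B \<Longrightarrow> comaximal a (f x)) \<Longrightarrow> comaximal a (prod f B)"
proof (induction B rule: infinite_finite_induct)
  case (insert x B)
  then show ?case by (simp add: comaximal_mult)
qed (simp_all add: comaximal_1)

lemma comaximal_prod_prod:
  "(\<And>x y. x \<in> A \<Longrightarrow> y \<in> B \<Longrightarrow> comaximal (f x) (f y)) \<Longrightarrow> comaximal (prod f A) (prod f B)"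
  by (meson comaximal_prod comaximal_sym)

lemma comaximal_dvd: "comaximal a b \<Longrightarrow> a' dvd a \<Longrightarrow> b' dvd b \<Longrightarrow> comaximal a' b'"
proof -
  assume "comaximal a b" "a' dvd a" "b' dvd b"
  then obtain u v s t where "u * a + v * b = 1" "a = a' * s" "b = b' * t"
    unfolding comaximal_def dvd_def by blast
  then have "(u * s) * a' + (v * t) * b' = 1" by (simp only: ac_simps)
  then show ?thesis unfolding comaximal_def by blast
qed

text \<open>Euclid's algorithm by subtraction, carried out on the exponents: X^b - 1 equals X^(b-a)
  (X^a - 1) plus X^(b-a) - 1. No division of coefficients occurs, so the identity holds over every
  commutative ring.\<close>

lemma unity_poly_gcd: "\<exists>u v. unity_poly (gcd a b) = u * unity_poly a + v * (unity_poly b :: 'a::comm_ring_1 poly)"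
proof (induction "a + b" arbitrary: a b rule: less_induct)
  case less
  have step: "\<exists>u v. unity_poly (gcd a b) = u * unity_poly a + v * (unity_poly b :: 'a poly)"
    if ab: "0 < a" "a \<le> b" and ex: "\<exists>u v. unity_poly (gcd a (b - a)) = u * unity_poly a + v * (unity_poly (b - a) :: 'a poly)" for a b
  proof -
    obtain u v where uv: "unity_poly (gcd a (b - a)) = u * unity_poly a + v * (unity_poly (b - a) :: 'a poly)"
      using ex by blast
    have "unity_poly b = unity_poly (b - a) + monom 1 (b - a) * (unity_poly a :: 'a poly)"
      using ab by (simp add: unity_poly_def algebra_simps mult_monom)
    then have e: "unity_poly (b - a) = unity_poly b - monom 1 (b - a) * (unity_poly a :: 'a poly)" by simp
    have "gcd a (b - a) = gcd a b" using ab(2) by (metis gcd.commute gcd_diff1_nat)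
    then have "unity_poly (gcd a b) = (u - v * monom 1 (b - a)) * unity_poly a + v * unity_poly b"
      using uv unfolding e by (simp add: algebra_simps)
    then show ?thesis by blast
  qed
  consider "a = 0" | "b = 0" | "0 < a" "a \<le> b" | "0 < b" "b \<le> a" by linarith
  then show ?case
  proof cases
    case 1
    then have "unity_poly (gcd a b) = 0 * unity_poly a + 1 * (unity_poly b :: 'a poly)" by simp
    then show ?thesis by blast
  next
    case 2
    then have "unity_poly (gcd a b) = 1 * unity_poly a + 0 * (unity_poly b :: 'a poly)" by simp
    then show ?thesis by blast
  next
    case 3 then show ?thesis by (intro step[OF _ _ less]) simp_all
  next
    case 4
    then have "\<exists>u v. unity_poly (gcd b a) = u * unity_poly b + v * (unity_poly a :: 'a poly)"
      by (intro step[OF _ _ less]) simp_all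
    then obtain u v where "unity_poly (gcd b a) = u * unity_poly b + v * (unity_poly a :: 'a poly)" by blast
    then have "unity_poly (gcd a b) = v * unity_poly a + u * (unity_poly b :: 'a poly)"
      by (simp only: gcd.commute[of a b] add.commute)
    then show ?thesis by blast
  qed
qed

text \<open>With c the gcd of a and b, the identity of \<open>unity_poly_gcd\<close> can be divided
  by X^c - 1 and becomes a Bezout identity for the quotients \<open>f a\<close> and
  \<open>f b\<close>. Incomparability of a and b means that neither divides c, so their cyclotomic
  polynomials are still factors of these quotients.\<close>

lemma comaximal_cyclotomic:
  assumes "a > 0" "b > 0" "\<not> a dvd b" "\<not> b dvd a"
  shows "comaximal (cyclotomic a) (cyclotomic b)"
proof -
  define c where "c = gcd a b"
  define f where "f n = (\<Prod>d\<in>{d. d dvd n \<and> \<not> d dvd c}. cyclotomic d)" for n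
  have c: "c dvd a" "c dvd b" "c > 0" using assms by (auto simp: c_def)
  have ab: "unity_poly a = unity_poly c * f a" "unity_poly b = unity_poly c * f b"
    unfolding f_def using c assms by (intro unity_poly_dvd_split; simp)+
  obtain u v where "unity_poly c = u * unity_poly a + v * (unity_poly b :: int poly)"
    unfolding c_def using unity_poly_gcd by blast
  then have "unity_poly c * 1 = u * (unity_poly c * f a) + v * (unity_poly c * f b)"
    unfolding ab[symmetric] by (simp only: mult_1_right)
  also have "\<dots> = unity_poly c * (u * f a + v * f b)"
    by (simp only: algebra_simps)
  finally have "unity_poly c * 1 = unity_poly c * (u * f a + v * f b)" .
  then have "u * f a + v * f b = 1"
    using unity_poly_nz[OF c(3), where 'a=int] by (metis mult_cancel_left)
  then have "comaximal (f a) (f b)"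
    unfolding comaximal_def by blast
  moreover have "cyclotomic a dvd f a" "cyclotomic b dvd f b"
    unfolding f_def using assms by (auto intro!: dvd_prodI simp: c_def finite_divisors_nat)
  ultimately show ?thesis by (rule comaximal_dvd)
qed

text \<open>Adding the prime \<open>q\<close> to the set of excluded divisors turns \<open>D\<close> into \<open>D'\<close> with \<open>D = D' A\<close> and
  \<open>f\<^sub>q = D' B\<close>, where no index of a factor of \<open>A\<close> is comparable under divisibility to one of
  \<open>B\<close>, so that \<open>A\<close> and \<open>B\<close> are comaximal already over \<open>\<int>\<close>.\<close>

lemma cyclotomic_in_ideal:
  assumes n: "n > 0"
    and add: "\<And>a b. a \<in> J \<Longrightarrow> b \<in> J \<Longrightarrow> a + b \<in> J"
    and mult: "\<And>a b. b \<in> J \<Longrightarrow> a * b \<in> J"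
    and unity_poly: "unity_poly n \<in> J"
    and f: "\<And>p. prime p \<Longrightarrow> p dvd n \<Longrightarrow> (\<Sum>i<p. monom 1 (n div p * i)) \<in> J"
  shows "cyclotomic n \<in> J"
proof -
  \<comment> \<open>The two ends of the induction: \<open>D {}\<close> consists of all divisors of
    n, with product X^n - 1, while for the set of all primes dividing n only n itself is left, since
    a proper divisor d of n divides \<open>n div p\<close> for any prime p dividing
    \<open>n div d\<close>.\<close>
  define D where "D T = {d. d dvd n \<and> (\<forall>p\<in>T. \<not> d dvd n div p)}" for T
  have finD: "finite {d. d dvd n \<and> P d}" for P using n by (simp add: finite_divisors_nat)
  have "prod cyclotomic (D T) \<in> J" if "finite T" "T \<subseteq> {p. prime p \<and> p dvd n}" for T
    using that
  proof (induction T rule: finite_induct)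
    case empty
    then show ?case using unity_poly by (simp add: D_def unity_poly_prod_cyclotomic[OF n])
  next
    case (insert q T)
    define D' A B where "D' = prod cyclotomic (D (insert q T))"
      and "A = prod cyclotomic {d. d dvd n \<and> d dvd n div q \<and> (\<forall>p\<in>T. \<not> d dvd n div p)}"
      and "B = prod cyclotomic {d. d dvd n \<and> \<not> d dvd n div q \<and> (\<exists>p\<in>T. d dvd n div p)}"
    have q: "prime q" "q dvd n" using insert by auto
    have "D T = D (insert q T) \<union> {d. d dvd n \<and> d dvd n div q \<and> (\<forall>p\<in>T. \<not> d dvd n div p)}"
      by (auto simp: D_def)
    then have 1: "prod cyclotomic (D T) = D' * A"
      unfolding D'_def A_def
      by (simp only:, intro prod.union_disjoint) (auto simp: D_def finD)
    have "(\<Sum>i<q. monom 1 (n div q * i)) = prod cyclotomic {d. d dvd n \<and> \<not> d dvd n div q}"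
      using q n by (intro geometric_eq_prod_cyclotomic) auto
    moreover have "{d. d dvd n \<and> \<not> d dvd n div q} =
       D (insert q T) \<union> {d. d dvd n \<and> \<not> d dvd n div q \<and> (\<exists>p\<in>T. d dvd n div p)}"
      by (auto simp: D_def)
    ultimately have 2: "(\<Sum>i<q. monom 1 (n div q * i)) = D' * B"
      unfolding D'_def B_def
      by (simp only:, intro prod.union_disjoint) (auto simp: D_def finD)
    have "comaximal A B"
      unfolding A_def B_def
    proof (rule comaximal_prod_prod, rule comaximal_cyclotomic, goal_cases)
      case (1 a b) then show ?case using n by (auto intro: dvd_pos_nat)
    next
      case (2 a b) then show ?case using n by (auto intro: dvd_pos_nat)
    next
      case (3 a b) then show ?case by (auto intro: dvd_trans)
    next
      case (4 a b) then show ?case by (auto intro: dvd_trans)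
    qed
    then obtain u v where "u * A + v * B = 1" unfolding comaximal_def by blast
    then have "D' = D' * (u * A + v * B)" by simp
    also have "\<dots> = u * (D' * A) + v * (D' * B)" by (simp only: algebra_simps)
    finally have "D' = u * (D' * A) + v * (D' * B)" .
    moreover have "D' * A \<in> J" using insert 1 by simp
    moreover have "D' * B \<in> J" using f[OF q] 2 by simp
    ultimately show ?case unfolding D'_def[symmetric] by (metis add mult)
  qed
  moreover have "finite {p. prime p \<and> p dvd n}" using finD[of prime] by (simp add: conj_commute)
  ultimately have "prod cyclotomic (D {p. prime p \<and> p dvd n}) \<in> J" by blast
  moreover have "D {p. prime p \<and> p dvd n} = {n}"
  proof (intro equalityI subsetI)
    fix d assume d: "d \<in> D {p. prime p \<and> p dvd n}"
    then obtain k where k: "n = d * k" by (auto simp: D_def)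
    have "k = 1"
    proof (rule ccontr)
      assume "k \<noteq> 1"
      then obtain p where p: "prime p" "p dvd k" using prime_factor_nat by blast
      then obtain l where "k = p * l" by blast
      then have "d dvd n div p" using k p by (simp add: prime_gt_0_nat)
      then show False using d p k by (auto simp: D_def)
    qed
    then show "d \<in> {n}" using k by simp
  next
    fix d assume "d \<in> {n}"
    then show "d \<in> D {p. prime p \<and> p dvd n}"
    proof -
      have "\<not> n dvd n div p" if "prime p" "p dvd n" for p
      proof
        assume "n dvd n div p"
        moreover have "0 < n div p" "n div p < n"
          using that n prime_gt_1_nat[of p] by (auto simp: div_greater_zero_iff dvd_imp_le)
        ultimately show False by (auto dest: dvd_imp_le)
      qed
      then show ?thesis using \<open>d \<in> {n}\<close> by (simp add: D_def)
    qed
  qed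
  ultimately show ?thesis by simp
qed

lemma cyclotomic_dvd_geometric:
  assumes "n = m * d" "n > 0" "m < n"
  shows "cyclotomic n dvd (\<Sum>i<d. monom 1 (m * i))"
  unfolding geometric_eq_prod_cyclotomic[OF assms(1,2)]
  using assms by (intro dvd_prodI) (auto simp: finite_divisors_nat dest: dvd_imp_le)

lemma cyclotomic_dvd_unity_poly: "n > 0 \<Longrightarrow> cyclotomic n dvd unity_poly n"
  by (subst unity_poly_prod_cyclotomic) (auto intro!: dvd_prodI simp: finite_divisors_nat)

text \<open>A root z in K of the n-th cyclotomic polynomial has order exactly n. If its order d were
  smaller, z would be a root of X^d - 1 and of the cofactor (X^n - 1)/(X^d - 1), hence a double root
  of X^n - 1. But in characteristic 0 the derivative n X^(n-1) can vanish only at 0.\<close>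

lemma primitive_root_exists:
  assumes n: "n > 0"
  obtains z :: "'k::{alg_closed_field, field_char_0}" where "\<And>m. z ^ m = 1 \<longleftrightarrow> n dvd m"
proof -
  have "degree (int_poly (cyclotomic n) :: 'k poly) > 0"
    using degree_cyclotomic_pos[OF n] by simp
  then obtain z :: 'k where z: "poly (int_poly (cyclotomic n)) z = 0"
    using alg_closed_imp_poly_has_root by blast
  have "cyclotomic n dvd unity_poly n" by (rule cyclotomic_dvd_unity_poly[OF n])
  then obtain r where r: "unity_poly n = cyclotomic n * r" by blast
  have "poly (int_poly (unity_poly n)) z = 0" unfolding r by (simp only: int_poly_mult poly_mult z mult_zero_left)
  then have zn: "z ^ n = 1" by simp
  obtain d where d: "d > 0" "z ^ d = 1" "\<And>m. z ^ m = 1 \<longleftrightarrow> d dvd m"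
    using root_unity_order[OF n zn] by metis
  have "d = n"
  proof (rule ccontr)
    assume "d \<noteq> n"
    have "d dvd n" using d zn by blast
    with \<open>d \<noteq> n\<close> n have "d < n" by (meson dvd_imp_le nat_less_le)
    then obtain s where s: "(\<Prod>d\<in>{d'. d' dvd n \<and> \<not> d' dvd d}. cyclotomic d) = cyclotomic n * s"
      using cyclotomic_dvd_geometric[of n d "n div d"] geometric_eq_prod_cyclotomic[of n d "n div d"]
        \<open>d dvd n\<close> n by (auto simp: dvd_def)
    have x: "unity_poly n = int_poly (unity_poly d) * (int_poly (cyclotomic n) * int_poly s :: 'k poly)"
      using unity_poly_dvd_split[OF \<open>d dvd n\<close> n] s by (metis int_poly_mult int_poly_unity_poly)
    have "pderiv (unity_poly n :: 'k poly) = monom (of_nat n) (n - 1)"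
      by (simp add: unity_poly_def pderiv_diff pderiv_monom)
    moreover have "poly (pderiv (unity_poly n)) z = 0"
      unfolding x by (simp add: pderiv_mult z d(2))
    ultimately have "of_nat n * z ^ (n - 1) = 0" by (simp add: poly_monom)
    then have "z = 0" using n by (simp split: if_splits)
    with zn n show False by (simp add: power_0_left)
  qed
  with d(3) show thesis by (intro that) auto
qed

subsection \<open>Coordinates on tensor products\<close>

text \<open>The additive extension of \<open>\<phi>\<close> to the free abelian group. The target is
  an arbitrary commutative ring because it is used both for coordinates in K and for weight
  polynomials in Z[X].\<close>

definition int_lin :: "('a \<Rightarrow> 'r::comm_ring_1) \<Rightarrow> ('a \<Rightarrow>\<^sub>0 int) \<Rightarrow> 'r" where
  "int_lin \<phi> x = (\<Sum>p\<in>keys x. of_int (lookup x p) * \<phi> p)"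

lemma int_lin_superset:
  assumes "finite S" "keys x \<subseteq> S"
  shows "int_lin \<phi> x = (\<Sum>p\<in>S. of_int (lookup x p) * \<phi> p)"
  unfolding int_lin_def using assms
  by (intro sum.mono_neutral_left) (auto simp: in_keys_iff)

lemma int_lin_0 [simp]: "int_lin \<phi> 0 = 0"
  by (simp add: int_lin_def)

lemma int_lin_of [simp]: "int_lin \<phi> (frag_of p) = \<phi> p"
  by (simp add: int_lin_def)

lemma int_lin_add: "int_lin \<phi> (x + y) = int_lin \<phi> x + int_lin \<phi> y"
proof -
  let ?S = "keys x \<union> keys y"
  have "int_lin \<phi> (x + y) = (\<Sum>p\<in>?S. of_int (lookup (x + y) p) * \<phi> p)"
    by (intro int_lin_superset keys_add) simp
  also have "\<dots> = (\<Sum>p\<in>?S. of_int (lookup x p) * \<phi> p)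
      + (\<Sum>p\<in>?S. of_int (lookup y p) * \<phi> p)"
    by (simp add: lookup_add algebra_simps sum.distrib)
  also have "\<dots> = int_lin \<phi> x + int_lin \<phi> y"
    by (simp add: int_lin_superset[of ?S x] int_lin_superset[of ?S y])
  finally show ?thesis .
qed

lemma int_lin_minus: "int_lin \<phi> (- x) = - int_lin \<phi> x"
  using int_lin_add[of \<phi> x "- x"] by (simp add: eq_neg_iff_add_eq_0 add.commute)

lemma int_lin_diff: "int_lin \<phi> (x - y) = int_lin \<phi> x - int_lin \<phi> y"
  using int_lin_add[of \<phi> x "- y"] by (simp add: int_lin_minus)

lemma int_lin_cmul: "int_lin \<phi> (frag_cmul c x) = of_int c * int_lin \<phi> x"
proof -
  have "int_lin \<phi> (frag_cmul c x) =
      (\<Sum>p\<in>keys x. of_int (lookup (frag_cmul c x) p) * \<phi> p)"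
    by (intro int_lin_superset keys_cmul) simp
  then show ?thesis
    by (simp add: int_lin_def sum_distrib_left mult.assoc)
qed

lemma int_lin_sum: "int_lin \<phi> (\<Sum>i\<in>A. f i) = (\<Sum>i\<in>A. int_lin \<phi> (f i))"
  by (induction A rule: infinite_finite_induct) (simp_all add: int_lin_add)

lemma int_lin_cong:
  "(\<And>p. p \<in> keys x \<Longrightarrow> \<phi> p = \<psi> p) \<Longrightarrow> int_lin \<phi> x = int_lin \<psi> x"
  by (simp add: int_lin_def)

lemma int_lin_frag_extend: "int_lin \<phi> (frag_extend f x) = int_lin (\<lambda>p. int_lin \<phi> (f p)) x"
  by (simp add: frag_extend_def int_lin_sum int_lin_cmul int_lin_def[of _ x])

lemma int_lin_mult: "int_lin (\<lambda>p. c * \<phi> p) x = c * int_lin \<phi> x"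
  by (simp add: int_lin_def sum_distrib_left mult.left_commute)

text \<open>Phrased with the type class operations, so that the relations of tensor products and
  those of the representation ring are treated alike although they live in different group
  records.\<close>

definition add_subgroup :: "'a::ab_group_add set \<Rightarrow> bool" where
  "add_subgroup T \<longleftrightarrow> 0 \<in> T \<and> (\<forall>a\<in>T. \<forall>b\<in>T. a - b \<in> T)"

lemma add_subgroup_0: "add_subgroup T \<Longrightarrow> 0 \<in> T"
  and add_subgroup_diff: "add_subgroup T \<Longrightarrow> a \<in> T \<Longrightarrow> b \<in> T \<Longrightarrow> a - b \<in> T"
  by (auto simp: add_subgroup_def)

lemma add_subgroup_minus: "add_subgroup T \<Longrightarrow> a \<in> T \<Longrightarrow> - a \<in> T"
  using add_subgroup_diff[of T 0 a] add_subgroup_0[of T] by simp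

lemma add_subgroup_add: "add_subgroup T \<Longrightarrow> a \<in> T \<Longrightarrow> b \<in> T \<Longrightarrow> a + b \<in> T"
  using add_subgroup_diff[of T a "- b"] add_subgroup_minus[of T b] by simp

lemma add_subgroup_sum: "add_subgroup T \<Longrightarrow> (\<And>i. i \<in> A \<Longrightarrow> f i \<in> T) \<Longrightarrow> sum f A \<in> T"
  by (induction A rule: infinite_finite_induct) (auto intro: add_subgroup_add add_subgroup_0)

lemma add_subgroup_minus_iff: "add_subgroup T \<Longrightarrow> - a \<in> T \<longleftrightarrow> a \<in> T"
  using add_subgroup_minus by force

lemma add_subgroup_trans: "add_subgroup T \<Longrightarrow> a - b \<in> T \<Longrightarrow> b - c \<in> T \<Longrightarrow> a - c \<in> T"
  using add_subgroup_add[of T "a - b" "b - c"] by simp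

lemma add_subgroup_sym: "add_subgroup T \<Longrightarrow> a - b \<in> T \<Longrightarrow> b - a \<in> T"
  using add_subgroup_minus[of T "a - b"] by simp

lemma keys_diff_subset:
  "keys a \<subseteq> S \<Longrightarrow> keys b \<subseteq> S \<Longrightarrow> keys (a - b) \<subseteq> S"
  using keys_diff[of a b] by blast

definition add_coset :: "'a::ab_group_add set \<Rightarrow> 'a \<Rightarrow> 'a set" where
  "add_coset T a = {x. x - a \<in> T}"

lemma r_coset_add_coset:
  fixes T :: "'a::ab_group_add set"
  assumes "mult G = (+)"
  shows "T #>\<^bsub>G\<^esub> a = add_coset T a"
  unfolding r_coset_def add_coset_def assms
proof (intro equalityI subsetI)
  fix x assume "x \<in> {x. x - a \<in> T}"
  then have "x - a \<in> T" "x = (x - a) + a" by simp_all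
  then show "x \<in> (\<Union>h\<in>T. {h + a})" by blast
qed auto

lemma mult_free: "mult (free_Abelian_group S) = (+)"
  by (simp add: free_Abelian_group_def)

lemma r_coset_free: "T #>\<^bsub>free_Abelian_group S\<^esub> a = add_coset T a"
  by (rule r_coset_add_coset[OF mult_free])

lemma mem_add_coset_self: "add_subgroup T \<Longrightarrow> a \<in> add_coset T a"
  by (simp add: add_coset_def add_subgroup_0)

lemma add_coset_eq_iff: "add_subgroup T \<Longrightarrow> add_coset T a = add_coset T b \<longleftrightarrow> a - b \<in> T"
proof
  assume "add_subgroup T" "add_coset T a = add_coset T b"
  then show "a - b \<in> T" using mem_add_coset_self[of T a] by (simp add: add_coset_def)
next
  assume T: "add_subgroup T" "a - b \<in> T"
  then show "add_coset T a = add_coset T b"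
    using add_subgroup_trans[OF T(1) _ T(2)] add_subgroup_trans[OF T(1) _ add_subgroup_sym[OF T]]
    by (auto simp: add_coset_def)
qed

lemma add_coset_0: "add_coset T 0 = T"
  by (simp add: add_coset_def)

lemma set_mult_add_coset:
  assumes "mult G = (+)" "add_subgroup T"
  shows "add_coset T a <#>\<^bsub>G\<^esub> add_coset T b = add_coset T (a + b)"
  unfolding set_mult_def assms(1)
proof (intro equalityI subsetI)
  fix z assume "z \<in> (\<Union>h\<in>add_coset T a. \<Union>k\<in>add_coset T b. {h + k})"
  then obtain h k where "h - a \<in> T" "k - b \<in> T" "z = h + k" by (auto simp: add_coset_def)
  then show "z \<in> add_coset T (a + b)"
    using add_subgroup_add[OF assms(2), of "h - a" "k - b"] by (simp add: add_coset_def algebra_simps)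
next
  fix z assume "z \<in> add_coset T (a + b)"
  then have "z - b \<in> add_coset T a" "b \<in> add_coset T b" "z = (z - b) + b"
    by (simp_all add: add_coset_def algebra_simps add_subgroup_0 assms)
  then show "z \<in> (\<Union>h\<in>add_coset T a. \<Union>k\<in>add_coset T b. {h + k})" by blast
qed

text \<open>The values of \<open>f\<close> on one coset of \<open>T\<close> differ by elements of
  \<open>T'\<close>, so the union that defines \<open>coset_lift\<close> ranges over copies of a
  single coset.\<close>

lemma coset_lift_add_coset:
  assumes "mult G = (+)" "add_subgroup T" "add_subgroup T'" "\<And>a b. f (a + b) = f a + f b"
    and "\<And>t. t \<in> T \<Longrightarrow> f t \<in> T'"
  shows "coset_lift G T' f (add_coset T x) = add_coset T' (f x)"
proof -
  have "add_coset T' (f y) = add_coset T' (f x)" if "y \<in> add_coset T x" for y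
  proof -
    have "f y = f (y - x) + f x" using assms(4)[of "y - x" x] by simp
    then have "f y - f x = f (y - x)" by simp
    also have "\<dots> \<in> T'" using that assms(5) by (simp add: add_coset_def)
    finally show ?thesis using assms(3) add_coset_eq_iff by blast
  qed
  moreover have "x \<in> add_coset T x" using assms(2) by (rule mem_add_coset_self)
  ultimately show ?thesis
    unfolding coset_lift_def r_coset_add_coset[OF assms(1)] by blast
qed

lemma add_subgroup_subgroup:
  assumes "subgroup T (free_Abelian_group S)"
  shows "add_subgroup T"
proof -
  have sub: "T \<subseteq> carrier (free_Abelian_group S)" using assms by (rule subgroup.subset)
  show ?thesis
    unfolding add_subgroup_def
  proof (intro conjI ballI)
    show "0 \<in> T" using subgroup.one_closed[OF assms] by simp
    fix a b assume "a \<in> T" "b \<in> T"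
    moreover from this have "- b \<in> T"
      using subgroup.m_inv_closed[OF assms, of b] sub by (auto simp: subset_iff)
    ultimately show "a - b \<in> T"
      using subgroup.m_closed[OF assms, of a "- b"] by simp
  qed
qed

lemma generate_free_Abelian:
  assumes "A \<subseteq> carrier (free_Abelian_group S)"
  shows "add_subgroup (generate (free_Abelian_group S) A)"
    "generate (free_Abelian_group S) A \<subseteq> carrier (free_Abelian_group S)"
  using group.generate_is_subgroup[OF group_free_Abelian_group assms]
  by (auto intro: add_subgroup_subgroup dest: subgroup.subset)

lemma int_lin_generate_0:
  assumes "A \<subseteq> carrier (free_Abelian_group S)" "\<And>a. a \<in> A \<Longrightarrow> int_lin \<phi> a = 0"
    and "x \<in> generate (free_Abelian_group S) A"
  shows "int_lin \<phi> x = 0"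
  using assms(3)
proof (induction rule: generate.induct)
  case (inv h)
  then show ?case using assms by (auto simp: int_lin_minus subset_iff)
qed (use assms in \<open>auto simp: int_lin_add\<close>)

text \<open>The coordinate space K^I, realised inside the functions on the whole index type so that
  equality of vectors is equality of functions.\<close>

definition supp_on :: "'i set \<Rightarrow> ('i \<Rightarrow> 'k::zero) set" where
  "supp_on I = {h. \<forall>i. i \<notin> I \<longrightarrow> h i = 0}"

text \<open>These closure conditions place the generators of \<open>tensor_relations\<close> in the
  free abelian group, so that what they generate is a subgroup and its cosets behave.\<close>

locale tensor_closed =
  fixes R :: "('r, 'a) ring_scheme" and M :: "('r, 'm, 'b) module_scheme"
    and N :: "('r, 'n, 'c) module_scheme"
  assumes M_add: "x \<in> carrier M \<Longrightarrow> x' \<in> carrier M \<Longrightarrow> x \<oplus>\<^bsub>M\<^esub> x' \<in> carrier M"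
    and N_add: "y \<in> carrier N \<Longrightarrow> y' \<in> carrier N \<Longrightarrow> y \<oplus>\<^bsub>N\<^esub> y' \<in> carrier N"
    and M_smult: "r \<in> carrier R \<Longrightarrow> x \<in> carrier M \<Longrightarrow> r \<odot>\<^bsub>M\<^esub> x \<in> carrier M"
    and N_smult: "r \<in> carrier R \<Longrightarrow> y \<in> carrier N \<Longrightarrow> r \<odot>\<^bsub>N\<^esub> y \<in> carrier N"
begin

abbreviation T where "T \<equiv> tensor_relations R M N"

lemma T_gens:
  "{frag_of (x \<oplus>\<^bsub>M\<^esub> x', y) - frag_of (x, y) - frag_of (x', y) | x x' y.
       x \<in> carrier M \<and> x' \<in> carrier M \<and> y \<in> carrier N} \<union>
   {frag_of (x, y \<oplus>\<^bsub>N\<^esub> y') - frag_of (x, y) - frag_of (x, y') | x y y'.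
       x \<in> carrier M \<and> y \<in> carrier N \<and> y' \<in> carrier N} \<union>
   {frag_of (r \<odot>\<^bsub>M\<^esub> x, y) - frag_of (x, r \<odot>\<^bsub>N\<^esub> y) | r x y.
       r \<in> carrier R \<and> x \<in> carrier M \<and> y \<in> carrier N}
   \<subseteq> carrier (free_Abelian_group (carrier M \<times> carrier N))"
proof -
  have frag: "keys (frag_of p) \<subseteq> S \<longleftrightarrow> p \<in> S" for p :: "'m \<times> 'n" and S
    by simp
  have "keys (frag_of (x \<oplus>\<^bsub>M\<^esub> x', y) - frag_of (x, y) - frag_of (x', y)) \<subseteq> carrier M \<times> carrier N"
    if "x \<in> carrier M" "x' \<in> carrier M" "y \<in> carrier N" for x x' y
    using that by (intro keys_diff_subset) (simp_all only: frag mem_Times_iff fst_conv snd_conv M_add simp_thms)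
  moreover have "keys (frag_of (x, y \<oplus>\<^bsub>N\<^esub> y') - frag_of (x, y) - frag_of (x, y')) \<subseteq> carrier M \<times> carrier N"
    if "x \<in> carrier M" "y' \<in> carrier N" "y \<in> carrier N" for x y' y
    using that by (intro keys_diff_subset) (simp_all only: frag mem_Times_iff fst_conv snd_conv N_add simp_thms)
  moreover have "keys (frag_of (r \<odot>\<^bsub>M\<^esub> x, y) - frag_of (x, r \<odot>\<^bsub>N\<^esub> y)) \<subseteq> carrier M \<times> carrier N"
    if "r \<in> carrier R" "x \<in> carrier M" "y \<in> carrier N" for r x y
    using that by (intro keys_diff_subset) (simp_all only: frag mem_Times_iff fst_conv snd_conv M_smult N_smult simp_thms)
  ultimately show ?thesis
    unfolding free_Abelian_group_def partial_object.simps by blast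
qed

lemma add_subgroup_T: "add_subgroup T"
  unfolding tensor_relations_def by (rule generate_free_Abelian(1)[OF T_gens])

lemma T_carrier: "t \<in> T \<Longrightarrow> keys t \<subseteq> carrier M \<times> carrier N"
  using subsetD[OF generate_free_Abelian(2)[OF T_gens]]
  unfolding tensor_relations_def carrier_free_Abelian_group_iff .

lemma rel_add1: "x \<in> carrier M \<Longrightarrow> x' \<in> carrier M \<Longrightarrow> y \<in> carrier N \<Longrightarrow>
    frag_of (x \<oplus>\<^bsub>M\<^esub> x', y) - frag_of (x, y) - frag_of (x', y) \<in> T"
  unfolding tensor_relations_def by (rule generate.incl) blast

lemma rel_add2: "x \<in> carrier M \<Longrightarrow> y \<in> carrier N \<Longrightarrow> y' \<in> carrier N \<Longrightarrow>
    frag_of (x, y \<oplus>\<^bsub>N\<^esub> y') - frag_of (x, y) - frag_of (x, y') \<in> T"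
  unfolding tensor_relations_def by (rule generate.incl) blast

lemma rel_bal: "r \<in> carrier R \<Longrightarrow> x \<in> carrier M \<Longrightarrow> y \<in> carrier N \<Longrightarrow>
    frag_of (r \<odot>\<^bsub>M\<^esub> x, y) - frag_of (x, r \<odot>\<^bsub>N\<^esub> y) \<in> T"
  unfolding tensor_relations_def by (rule generate.incl) blast

end

text \<open>Here \<open>\<phi> p\<close> are the coordinates of the pure tensor \<open>p\<close>, and \<open>\<sigma>\<close> is a section of the coordinate
  map. That \<open>\<sigma>\<close> inverts the coordinates modulo the relations on pure tensors is what makes them
  injective on the whole tensor product.\<close>

locale tensor_coords = tensor_closed R M N
  for R :: "('r, 'a) ring_scheme" and M :: "('r, 'm, 'b) module_scheme"
    and N :: "('r, 'n, 'c) module_scheme" +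
  fixes \<phi> :: "'m \<times> 'n \<Rightarrow> 'i \<Rightarrow> 'k::comm_ring_1" and I :: "'i set"
    and \<sigma> :: "('i \<Rightarrow> 'k) \<Rightarrow> ('m \<times> 'n \<Rightarrow>\<^sub>0 int)"
  assumes \<phi>_add1: "x \<in> carrier M \<Longrightarrow> x' \<in> carrier M \<Longrightarrow> y \<in> carrier N \<Longrightarrow>
      \<phi> (x \<oplus>\<^bsub>M\<^esub> x', y) i = \<phi> (x, y) i + \<phi> (x', y) i"
    and \<phi>_add2: "x \<in> carrier M \<Longrightarrow> y \<in> carrier N \<Longrightarrow> y' \<in> carrier N \<Longrightarrow>
      \<phi> (x, y \<oplus>\<^bsub>N\<^esub> y') i = \<phi> (x, y) i + \<phi> (x, y') i"
    and \<phi>_bal: "r \<in> carrier R \<Longrightarrow> x \<in> carrier M \<Longrightarrow> y \<in> carrier N \<Longrightarrow>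
      \<phi> (r \<odot>\<^bsub>M\<^esub> x, y) i = \<phi> (x, r \<odot>\<^bsub>N\<^esub> y) i"
    and \<phi>_supp: "p \<in> carrier M \<times> carrier N \<Longrightarrow> \<phi> p \<in> supp_on I"
    and \<sigma>_keys: "h \<in> supp_on I \<Longrightarrow> keys (\<sigma> h) \<subseteq> carrier M \<times> carrier N"
    and \<sigma>_add: "h \<in> supp_on I \<Longrightarrow> h' \<in> supp_on I \<Longrightarrow>
      \<sigma> (\<lambda>i. h i + h' i) - \<sigma> h - \<sigma> h' \<in> tensor_relations R M N"
    and \<sigma>_\<phi>: "p \<in> carrier M \<times> carrier N \<Longrightarrow> \<sigma> (\<phi> p) - frag_of p \<in> tensor_relations R M N"
    and \<phi>_\<sigma>: "h \<in> supp_on I \<Longrightarrow> int_lin (\<lambda>p. \<phi> p i) (\<sigma> h) = h i"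
begin

definition \<Phi> :: "('m \<times> 'n \<Rightarrow>\<^sub>0 int) \<Rightarrow> 'i \<Rightarrow> 'k" where
  "\<Phi> x = (\<lambda>i. int_lin (\<lambda>p. \<phi> p i) x)"

text \<open>Coordinates of a coset, read off an arbitrary representative;
  \<open>\<Lambda>_add_coset\<close> shows that the choice is harmless because \<open>\<Phi>\<close>
  vanishes on the relations.\<close>

definition \<Lambda> :: "('m \<times> 'n \<Rightarrow>\<^sub>0 int) set \<Rightarrow> 'i \<Rightarrow> 'k" where
  "\<Lambda> X = \<Phi> (SOME x. x \<in> X)"

lemma \<Phi>_T: "t \<in> T \<Longrightarrow> \<Phi> t = (\<lambda>i. 0)"
  unfolding \<Phi>_def tensor_relations_def
  by (intro ext, erule int_lin_generate_0[OF T_gens, rotated])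
    (auto simp: int_lin_diff \<phi>_add1 \<phi>_add2 \<phi>_bal)

lemma \<Phi>_diff: "\<Phi> (x - y) i = \<Phi> x i - \<Phi> y i"
  by (simp add: \<Phi>_def int_lin_diff)

lemma \<Phi>_diff_fun: "\<Phi> (x - y) = (\<lambda>i. \<Phi> x i - \<Phi> y i)"
  by (rule ext) (rule \<Phi>_diff)

lemma \<Phi>_supp: "keys x \<subseteq> carrier M \<times> carrier N \<Longrightarrow> \<Phi> x \<in> supp_on I"
  unfolding \<Phi>_def supp_on_def int_lin_def
  using \<phi>_supp by (auto simp: supp_on_def subset_iff intro!: sum.neutral)

lemma zero_supp: "(\<lambda>i. 0) \<in> supp_on I"
  by (simp add: supp_on_def)

lemma \<sigma>_0: "\<sigma> (\<lambda>i. 0) \<in> T"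
  using \<sigma>_add[OF zero_supp zero_supp] add_subgroup_minus_iff[OF add_subgroup_T, of "\<sigma> (\<lambda>i. 0)"] by simp

lemma \<sigma>_diff:
  assumes "h \<in> supp_on I" "h' \<in> supp_on I"
  shows "\<sigma> (\<lambda>i. h i - h' i) - (\<sigma> h - \<sigma> h') \<in> T"
proof -
  have "(\<lambda>i. h i - h' i) \<in> supp_on I" using assms by (simp add: supp_on_def)
  from \<sigma>_add[OF this assms(2)] have "\<sigma> h - \<sigma> (\<lambda>i. h i - h' i) - \<sigma> h' \<in> T" by simp
  from add_subgroup_minus[OF add_subgroup_T this] show ?thesis by (simp add: algebra_simps)
qed

lemma \<sigma>_\<Phi>:
  "keys x \<subseteq> carrier M \<times> carrier N \<Longrightarrow> \<sigma> (\<Phi> x) - x \<in> T"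
\<comment> \<open>The difference case of \<open>frag_induction\<close> says nothing about the
  supports of the two terms, so the support condition is made part of the induction
  predicate.\<close>
proof (rule conjunct2[of "keys x \<subseteq> carrier M \<times> carrier N"], induction x rule: frag_induction)
  case zero
  then show ?case using \<sigma>_0 by (simp add: \<Phi>_def)
next
  case (one p)
  then show ?case using \<sigma>_\<phi>[of p] by (simp add: \<Phi>_def)
next
  case (diff a b)
  then have "\<sigma> (\<Phi> (a - b)) - (\<sigma> (\<Phi> a) - \<sigma> (\<Phi> b)) \<in> T"
    using \<sigma>_diff[OF \<Phi>_supp \<Phi>_supp] by (simp add: \<Phi>_diff_fun)
  moreover have "(\<sigma> (\<Phi> a) - a) - (\<sigma> (\<Phi> b) - b) \<in> T"
    using add_subgroup_diff[OF add_subgroup_T, of "\<sigma> (\<Phi> a) - a" "\<sigma> (\<Phi> b) - b"] diff by blast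
  ultimately have "\<sigma> (\<Phi> (a - b)) - (\<sigma> (\<Phi> a) - \<sigma> (\<Phi> b)) + ((\<sigma> (\<Phi> a) - a) - (\<sigma> (\<Phi> b) - b)) \<in> T"
    by (rule add_subgroup_add[OF add_subgroup_T])
  moreover have "keys (a - b) \<subseteq> carrier M \<times> carrier N"
    using diff keys_diff[of a b] by auto
  ultimately show ?case by (simp add: algebra_simps)
qed

lemma \<Phi>_eq_0_iff:
  assumes "keys x \<subseteq> carrier M \<times> carrier N"
  shows "x \<in> T \<longleftrightarrow> \<Phi> x = (\<lambda>i. 0)"
proof
  assume "\<Phi> x = (\<lambda>i. 0)"
  with \<sigma>_\<Phi>[OF assms] have "\<sigma> (\<lambda>i. 0) - x \<in> T" by simp
  then show "x \<in> T" using add_subgroup_diff[OF add_subgroup_T \<sigma>_0] by fastforce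
qed (rule \<Phi>_T)

lemma carrier_tensor:
  "carrier (tensor_module R M N) = add_coset T ` {x. keys x \<subseteq> carrier M \<times> carrier N}"
  by (auto simp: tensor_module_def Let_def RCOSETS_def r_coset_free)

lemma add_tensor: "add_coset T x \<oplus>\<^bsub>tensor_module R M N\<^esub> add_coset T y = add_coset T (x + y)"
  by (simp add: tensor_module_def Let_def set_mult_add_coset add_subgroup_T mult_free)

lemma \<Lambda>_add_coset: "\<Lambda> (add_coset T x) = \<Phi> x"
proof -
  have "(SOME y. y \<in> add_coset T x) \<in> add_coset T x"
    using mem_add_coset_self[OF add_subgroup_T] by (rule someI)
  then have "\<Phi> ((SOME y. y \<in> add_coset T x) - x) = (\<lambda>i. 0)"
    by (intro \<Phi>_T) (simp add: add_coset_def)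
  then show ?thesis
    unfolding \<Lambda>_def by (auto simp: \<Phi>_diff_fun fun_eq_iff)
qed

lemma \<Lambda>_bij: "bij_betw \<Lambda> (carrier (tensor_module R M N)) (supp_on I)"
proof (rule bij_betw_imageI)
  show "inj_on \<Lambda> (carrier (tensor_module R M N))"
  proof (rule inj_onI)
    fix X Y assume "X \<in> carrier (tensor_module R M N)" "Y \<in> carrier (tensor_module R M N)"
      and eq: "\<Lambda> X = \<Lambda> Y"
    then obtain x y where xy: "X = add_coset T x" "Y = add_coset T y"
      "keys x \<subseteq> carrier M \<times> carrier N" "keys y \<subseteq> carrier M \<times> carrier N"
      unfolding carrier_tensor by blast
    then have "\<Phi> (x - y) = (\<lambda>i. 0)" using eq by (simp add: \<Lambda>_add_coset \<Phi>_diff_fun fun_eq_iff)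
    moreover have "keys (x - y) \<subseteq> carrier M \<times> carrier N"
      using xy keys_diff[of x y] by auto
    ultimately have "x - y \<in> T" using \<Phi>_eq_0_iff by blast
    then show "X = Y" using xy add_coset_eq_iff[OF add_subgroup_T] by blast
  qed
  show "\<Lambda> ` carrier (tensor_module R M N) = supp_on I"
  proof (intro equalityI subsetI)
    fix h assume "h \<in> \<Lambda> ` carrier (tensor_module R M N)"
    then show "h \<in> supp_on I" by (auto simp: carrier_tensor \<Lambda>_add_coset \<Phi>_supp)
  next
    fix h :: "'i \<Rightarrow> 'k" assume h: "h \<in> supp_on I"
    then have "\<Lambda> (add_coset T (\<sigma> h)) = h" by (simp add: \<Lambda>_add_coset \<Phi>_def \<phi>_\<sigma>)
    then show "h \<in> \<Lambda> ` carrier (tensor_module R M N)"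
      unfolding carrier_tensor using \<sigma>_keys[OF h] by (metis imageI mem_Collect_eq)
  qed
qed

lemma add_closed:
  assumes "X \<in> carrier (tensor_module R M N)" "Y \<in> carrier (tensor_module R M N)"
  shows "X \<oplus>\<^bsub>tensor_module R M N\<^esub> Y \<in> carrier (tensor_module R M N)"
proof -
  obtain x y where "X = add_coset T x" "Y = add_coset T y"
    "keys x \<subseteq> carrier M \<times> carrier N" "keys y \<subseteq> carrier M \<times> carrier N"
    using assms unfolding carrier_tensor by blast
  then show ?thesis using keys_add[of x y] by (auto simp: add_tensor carrier_tensor)
qed

lemma \<Lambda>_add:
  assumes "X \<in> carrier (tensor_module R M N)" "Y \<in> carrier (tensor_module R M N)"
  shows "\<Lambda> (X \<oplus>\<^bsub>tensor_module R M N\<^esub> Y) = (\<lambda>i. \<Lambda> X i + \<Lambda> Y i)"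
  using assms by (auto simp: carrier_tensor add_tensor \<Lambda>_add_coset \<Phi>_def int_lin_add)

text \<open>That the map respects the relations is not checked on generators: the relations are the
  kernel of \<open>\<Phi>\<close>, and in coordinates the map is multiplication by the scalars
  \<open>d i\<close>. Both the scalar multiplication and the group action on a tensor product are
  obtained from this.\<close>

lemma \<Lambda>_tensor_map:
  assumes X: "X \<in> carrier (tensor_module R M N)"
    and f: "\<And>p. p \<in> carrier M \<times> carrier N \<Longrightarrow> f p \<in> carrier M \<times> carrier N"
    and d: "\<And>p i. p \<in> carrier M \<times> carrier N \<Longrightarrow> \<phi> (f p) i = d i * \<phi> p i"
  shows "\<Lambda> (tensor_map R M N f X) = (\<lambda>i. d i * \<Lambda> X i)"
    and "tensor_map R M N f X \<in> carrier (tensor_module R M N)"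
proof -
  let ?F = "frag_extend (\<lambda>p. frag_of (f p))"
  obtain x where x: "X = add_coset T x" "keys x \<subseteq> carrier M \<times> carrier N"
    using X by (auto simp: carrier_tensor)
  have keys: "keys (?F y) \<subseteq> carrier M \<times> carrier N"
    if "keys y \<subseteq> carrier M \<times> carrier N" for y
    using that f keys_frag_extend[of "\<lambda>p. frag_of (f p)" y] by (fastforce)
  have \<Phi>F: "\<Phi> (?F y) = (\<lambda>i. d i * \<Phi> y i)" if "keys y \<subseteq> carrier M \<times> carrier N" for y
    unfolding \<Phi>_def int_lin_frag_extend int_lin_mult[symmetric]
    using that d by (intro ext int_lin_cong) auto
  have "?F t \<in> T" if "t \<in> T" for t
    using \<Phi>F[OF T_carrier[OF that]] \<Phi>_T[OF that] keys[OF T_carrier[OF that]] \<Phi>_eq_0_iff by simp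
  then have e: "tensor_map R M N f X = add_coset T (?F x)"
    unfolding tensor_map_def x(1)
    by (intro coset_lift_add_coset add_subgroup_T mult_free) (simp_all add: frag_extend_add)
  show "\<Lambda> (tensor_map R M N f X) = (\<lambda>i. d i * \<Lambda> X i)"
    unfolding e unfolding x(1) \<Lambda>_add_coset by (rule \<Phi>F[OF x(2)])
  show "tensor_map R M N f X \<in> carrier (tensor_module R M N)"
    unfolding e carrier_tensor using keys[OF x(2)] by blast
qed

end

subsection \<open>Linear algebra and diagonal model representations\<close>

lemma type_ring_simps [simp]:
  "carrier type_ring = UNIV" "mult type_ring = (*)" "one type_ring = 1"
  "zero type_ring = 0" "add type_ring = (+)"
  by (simp_all add: type_ring_def)

lemma cring_type_ring: "cring (type_ring :: 'a::comm_ring_1 ring)"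
proof (rule cringI)
  show "abelian_group (type_ring :: 'a ring)"
  proof (rule abelian_groupI)
    fix x :: 'a
    show "\<exists>y\<in>carrier type_ring. y \<oplus>\<^bsub>type_ring\<^esub> x = \<zero>\<^bsub>type_ring\<^esub>"
      by (intro bexI[of _ "- x"]) simp_all
  qed (simp_all add: algebra_simps)
  show "Group.comm_monoid (type_ring :: 'a ring)"
    by (rule comm_monoidI) (simp_all add: algebra_simps)
qed (simp add: algebra_simps)

section \<open>Spans and bases of finitely spanned vector spaces\<close>

locale kspace = module type_ring V for V :: "('k::field, 'v, 'a) module_scheme" (structure)
begin

lemma smult_in [simp]: "x \<in> carrier V \<Longrightarrow> c \<odot> x \<in> carrier V"
  using smult_closed by simp

lemma smult_add_left: "x \<in> carrier V \<Longrightarrow> (c + d) \<odot> x = c \<odot> x \<oplus> d \<odot> x"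
  using smult_l_distr[of c d x] by simp

lemma smult_add_right:
  "x \<in> carrier V \<Longrightarrow> y \<in> carrier V \<Longrightarrow> c \<odot> (x \<oplus> y) = c \<odot> x \<oplus> c \<odot> y"
  using smult_r_distr[of c x y] by simp

lemma smult_smult: "x \<in> carrier V \<Longrightarrow> c \<odot> (d \<odot> x) = (c * d) \<odot> x"
  using smult_assoc1[of c d x] by simp

lemma smult_1 [simp]: "x \<in> carrier V \<Longrightarrow> 1 \<odot> x = x"
  using smult_one by simp

lemma smult_0_left [simp]: "x \<in> carrier V \<Longrightarrow> 0 \<odot> x = \<zero>"
  using smult_l_null by simp

lemma smult_0_right [simp]: "c \<odot> \<zero> = \<zero>"
  using smult_r_null by simp

lemma smult_finsum:
  "finite A \<Longrightarrow> f \<in> A \<rightarrow> carrier V \<Longrightarrow>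
    c \<odot> (\<Oplus>i\<in>A. f i) = (\<Oplus>i\<in>A. c \<odot> f i)"
  using finsum_smult_ldistr[of A c f] by simp

lemma finsum_smult_sum:
  assumes "x \<in> carrier V"
  shows "(\<Oplus>i\<in>A. c i \<odot> x) = (\<Sum>i\<in>A. c i) \<odot> x"
  using assms by (induction A rule: infinite_finite_induct) (simp_all add: smult_add_left Pi_def)

lemma finsum_swap:
  assumes "finite A" "finite B" "\<And>i j. i \<in> A \<Longrightarrow> j \<in> B \<Longrightarrow> f i j \<in> carrier V"
  shows "(\<Oplus>i\<in>A. \<Oplus>j\<in>B. f i j) = (\<Oplus>j\<in>B. \<Oplus>i\<in>A. f i j)"
  using assms(1,3)
proof (induction A rule: finite_induct)
  case empty
  then show ?case by simp
next
  case (insert a A)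
  have "(\<Oplus>i\<in>insert a A. \<Oplus>j\<in>B. f i j)
      = (\<Oplus>j\<in>B. f a j) \<oplus> (\<Oplus>j\<in>B. \<Oplus>i\<in>A. f i j)"
    using insert by (subst finsum_insert) (auto intro!: finsum_closed)
  also have "\<dots> = (\<Oplus>j\<in>B. f a j \<oplus> (\<Oplus>i\<in>A. f i j))"
    using insert by (intro finsum_addf[symmetric]) (auto intro!: finsum_closed)
  also have "\<dots> = (\<Oplus>j\<in>B. \<Oplus>i\<in>insert a A. f i j)"
    using insert by (intro finsum_cong') (auto intro!: finsum_closed)
  finally show ?case .
qed

definition lincomb :: "('v \<Rightarrow> 'k) \<Rightarrow> 'v set \<Rightarrow> 'v" where
  "lincomb c S = (\<Oplus>b\<in>S. c b \<odot> b)"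

lemma lincomb_closed [simp]: "S \<subseteq> carrier V \<Longrightarrow> lincomb c S \<in> carrier V"
  unfolding lincomb_def by (intro finsum_closed) auto

lemma lincomb_add: "S \<subseteq> carrier V \<Longrightarrow> lincomb (\<lambda>b. c b + d b) S = lincomb c S \<oplus> lincomb d S"
proof -
  assume S: "S \<subseteq> carrier V"
  then have "lincomb (\<lambda>b. c b + d b) S = (\<Oplus>b\<in>S. c b \<odot> b \<oplus> d b \<odot> b)"
    unfolding lincomb_def by (intro finsum_cong') (auto simp: smult_add_left)
  also have "\<dots> = lincomb c S \<oplus> lincomb d S"
    unfolding lincomb_def using S by (intro finsum_addf) auto
  finally show ?thesis .
qed

lemma lincomb_smult:
  assumes "finite S" "S \<subseteq> carrier V"
  shows "lincomb (\<lambda>b. a * c b) S = a \<odot> lincomb c S"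
  unfolding lincomb_def using assms
  by (subst smult_finsum) (auto intro!: finsum_cong' simp: smult_smult subset_iff)

lemma lincomb_cong: "S \<subseteq> carrier V \<Longrightarrow> (\<And>b. b \<in> S \<Longrightarrow> c b = d b) \<Longrightarrow> lincomb c S = lincomb d S"
  unfolding lincomb_def by (intro finsum_cong') (auto simp: subset_iff)

lemma lincomb_remove:
  assumes "finite S" "S \<subseteq> carrier V" "b \<in> S"
  shows "lincomb c S = c b \<odot> b \<oplus> lincomb c (S - {b})"
proof -
  have "lincomb c (insert b (S - {b})) = c b \<odot> b \<oplus> lincomb c (S - {b})"
    unfolding lincomb_def using assms by (intro finsum_insert) auto
  then show ?thesis using assms by (simp add: insert_absorb)
qed

lemma lincomb_0: "S \<subseteq> carrier V \<Longrightarrow> (\<And>b. b \<in> S \<Longrightarrow> c b = 0) \<Longrightarrow> lincomb c S = \<zero>"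
  unfolding lincomb_def by (intro add.finprod_one_eqI[simplified finsum_def[symmetric]]) (auto simp: subset_iff)

lemma lincomb_single:
  assumes "finite S" "S \<subseteq> carrier V" "b \<in> S"
  shows "lincomb (\<lambda>x. if x = b then a else 0) S = a \<odot> b"
proof -
  have "lincomb (\<lambda>x. if x = b then a else 0) (S - {b}) = \<zero>"
    using assms by (intro lincomb_0) auto
  moreover have "b \<in> carrier V" using assms by blast
  ultimately show ?thesis by (simp add: lincomb_remove[OF assms])
qed

definition lspan :: "'v set \<Rightarrow> 'v set" where
  "lspan S = range (\<lambda>c. lincomb c S)"

lemma lspan_carrier: "S \<subseteq> carrier V \<Longrightarrow> lspan S \<subseteq> carrier V"
  by (auto simp: lspan_def)

lemma lspan_add: "S \<subseteq> carrier V \<Longrightarrow> x \<in> lspan S \<Longrightarrow> y \<in> lspan S \<Longrightarrow> x \<oplus> y \<in> lspan S"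
  by (auto simp: lspan_def lincomb_add[symmetric])

lemma lspan_smult: "finite S \<Longrightarrow> S \<subseteq> carrier V \<Longrightarrow> x \<in> lspan S \<Longrightarrow> a \<odot> x \<in> lspan S"
  by (auto simp: lspan_def lincomb_smult[symmetric])

lemma lspan_zero: "S \<subseteq> carrier V \<Longrightarrow> \<zero> \<in> lspan S"
  unfolding lspan_def using lincomb_0[of S "\<lambda>_. 0"] by (metis rangeI)

lemma lspan_finsum:
  assumes "S \<subseteq> carrier V" "\<And>i. i \<in> A \<Longrightarrow> f i \<in> lspan S"
  shows "(\<Oplus>i\<in>A. f i) \<in> lspan S"
  using assms(2)
proof (induction A rule: infinite_finite_induct)
  case (insert x F)
  then have "f \<in> insert x F \<rightarrow> carrier V" using lspan_carrier[OF assms(1)] by blast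
  with insert show ?case using assms(1) by (simp add: lspan_add)
qed (simp_all add: lspan_zero assms(1))

lemma lspan_self: "finite S \<Longrightarrow> S \<subseteq> carrier V \<Longrightarrow> b \<in> S \<Longrightarrow> b \<in> lspan S"
  using lincomb_single[of S b 1] unfolding lspan_def by (metis rangeI smult_1 subset_iff)

lemma lspan_trans:
  assumes "finite S'" "S' \<subseteq> carrier V" "S \<subseteq> lspan S'"
  shows "lspan S \<subseteq> lspan S'"
proof
  fix x assume "x \<in> lspan S"
  then obtain c where "x = lincomb c S" by (auto simp: lspan_def)
  then show "x \<in> lspan S'"
    unfolding lincomb_def using assms by (auto intro!: lspan_finsum lspan_smult)
qed

text \<open>A spanning subset of least cardinality is independent: a relation with
  \<open>c b\<close> nonzero would express b by the other vectors, and b could be dropped. That the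
  basis lies inside the given set matters later, when that set consists of eigenvectors.\<close>

lemma basis_exists:
  assumes "finite S0" "S0 \<subseteq> carrier V" "carrier V \<subseteq> lspan S0"
  obtains S where "S \<subseteq> S0" "finite S" "lspan S = carrier V"
    "\<And>c b. lincomb c S = \<zero> \<Longrightarrow> b \<in> S \<Longrightarrow> c b = 0"
proof -
  define P where "P S \<longleftrightarrow> S \<subseteq> S0 \<and> carrier V \<subseteq> lspan S" for S
  define S where "S = arg_min card P"
  have "P S0" using assms by (simp add: P_def)
  then have S: "P S" and min: "\<And>S'. P S' \<Longrightarrow> card S \<le> card S'"
    unfolding S_def by (auto intro: arg_min_natI arg_min_nat_le)
  have fin: "finite S" "S \<subseteq> carrier V" using S assms by (auto simp: P_def intro: finite_subset)
  have "c b = 0" if c: "lincomb c S = \<zero>" and b: "b \<in> S" for c b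
  proof (rule ccontr)
    assume nz: "c b \<noteq> 0"
    let ?S = "S - {b}"
    have bV: "b \<in> carrier V" and SV: "?S \<subseteq> carrier V" "finite ?S" using fin b by auto
    let ?y = "lincomb (\<lambda>x. inverse (c b) * c x) ?S"
    have "\<zero> = inverse (c b) \<odot> (c b \<odot> b \<oplus> lincomb c ?S)"
      using c lincomb_remove[OF fin b, of c] by simp
    also have "\<dots> = b \<oplus> ?y"
      using nz bV SV by (simp add: smult_add_right smult_smult lincomb_smult)
    finally have "b \<oplus> ?y = \<zero>" by simp
    moreover have "(-1) \<odot> ?y \<oplus> ?y = \<zero>"
    proof -
      have "(-1 + 1) \<odot> ?y = (-1) \<odot> ?y \<oplus> 1 \<odot> ?y"
        using SV by (intro smult_add_left) simp
      then show ?thesis using SV by simp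
    qed
    ultimately have "b = (-1) \<odot> ?y"
      using bV SV by (metis add.right_cancel lincomb_closed smult_in)
    also have "\<dots> \<in> lspan ?S"
      using SV by (intro lspan_smult) (auto simp: lspan_def)
    finally have "S \<subseteq> lspan ?S" using lspan_self[OF SV(2,1)] by blast
    then have "lspan S \<subseteq> lspan ?S" using SV by (intro lspan_trans)
    then have "P ?S" using S by (auto simp: P_def)
    then have "card S \<le> card ?S" by (rule min)
    with b fin(1) show False by (metis card_Diff1_less leD)
  qed
  moreover have "lspan S = carrier V" using S lspan_carrier[OF fin(2)] by (auto simp: P_def)
  ultimately show thesis using that S fin unfolding P_def by blast
qed

end

text \<open>The images of the unit vectors of \<open>A\<close> are independent and lie in the span
  of the unit vectors of \<open>B\<close>. Linearity is asked only on \<open>supp_on A\<close>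
  because \<open>F\<close> will be an isomorphism of representations restricted to one
  eigenspace.\<close>

lemma card_le_of_injective_linear:
  fixes F :: "('i \<Rightarrow> 'k::field) \<Rightarrow> 'j \<Rightarrow> 'k"
  assumes fin: "finite A" "finite B"
    and maps: "\<And>f. f \<in> supp_on A \<Longrightarrow> F f \<in> supp_on B"
    and add: "\<And>f h. f \<in> supp_on A \<Longrightarrow> h \<in> supp_on A \<Longrightarrow> F (\<lambda>i. f i + h i) = (\<lambda>j. F f j + F h j)"
    and smult: "\<And>c f. f \<in> supp_on A \<Longrightarrow> F (\<lambda>i. c * f i) = (\<lambda>j. c * F f j)"
    and inj: "inj_on F (supp_on A)"
  shows "card A \<le> card B"
proof -
  interpret VS: vector_space "\<lambda>c (f :: 'j \<Rightarrow> 'k) j. c * f j"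
    by unfold_locales (auto simp: fun_eq_iff algebra_simps)
  define \<delta> :: "'i \<Rightarrow> 'i \<Rightarrow> 'k" where "\<delta> a i = (if i = a then 1 else 0)" for a i
  define \<epsilon> :: "'j \<Rightarrow> 'j \<Rightarrow> 'k" where "\<epsilon> b j = (if j = b then 1 else 0)" for b j
  have sum_apply: "(\<Sum>x\<in>X. f x) j = (\<Sum>x\<in>X. f x j)" for X and f :: "'x \<Rightarrow> 'y \<Rightarrow> 'k" and j
    by (induction X rule: infinite_finite_induct) auto
  have \<delta>_supp: "\<delta> a \<in> supp_on A" if "a \<in> A" for a using that by (auto simp: supp_on_def \<delta>_def)
  have Fsum: "(\<lambda>i. \<Sum>a\<in>X. c a * \<delta> a i) \<in> supp_on A
      \<and> F (\<lambda>i. \<Sum>a\<in>X. c a * \<delta> a i) = (\<lambda>j. \<Sum>a\<in>X. c a * F (\<delta> a) j)"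
    if "finite X" "X \<subseteq> A" for X c using that
  proof (induction X rule: finite_induct)
    case empty
    have z: "(\<lambda>i. 0) \<in> supp_on A" by (simp add: supp_on_def)
    then show ?case using smult[OF z, of 0] by simp
  next
    case (insert a X)
    then have "\<delta> a \<in> supp_on A" by (auto intro: \<delta>_supp)
    moreover from this have "(\<lambda>i. c a * \<delta> a i) \<in> supp_on A" by (simp add: supp_on_def)
    ultimately show ?case using insert by (auto simp: add smult supp_on_def)
  qed
  have inj\<delta>: "inj_on (\<lambda>a. F (\<delta> a)) A"
  proof (rule inj_onI)
    fix a b assume "a \<in> A" "b \<in> A" "F (\<delta> a) = F (\<delta> b)"
    then have "\<delta> a = \<delta> b" using inj \<delta>_supp by (auto dest: inj_onD)
    then have "\<delta> a a = \<delta> b a" by simp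
    then show "a = b" by (simp add: \<delta>_def split: if_splits)
  qed
  have "VS.independent ((\<lambda>a. F (\<delta> a)) ` A)"
  proof (rule VS.independent_if_scalars_zero)
    fix c x assume s: "(\<Sum>x\<in>(\<lambda>a. F (\<delta> a)) ` A. (\<lambda>j. c x * x j)) = 0"
      and x: "x \<in> (\<lambda>a. F (\<delta> a)) ` A"
    from s have s': "(\<Sum>a\<in>A. (\<lambda>j. c (F (\<delta> a)) * F (\<delta> a) j)) = 0"
      by (subst (asm) sum.reindex[OF inj\<delta>]) (simp add: o_def)
    have "(\<Sum>a\<in>A. c (F (\<delta> a)) * F (\<delta> a) j) = 0" for j
      using fun_cong[OF s', of j] by (simp add: sum_apply)
    then have "F (\<lambda>i. \<Sum>a\<in>A. c (F (\<delta> a)) * \<delta> a i) = F (\<lambda>i. \<Sum>a\<in>A. 0 * \<delta> a i)"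
      using Fsum[OF fin(1) order_refl, of "\<lambda>a. c (F (\<delta> a))"] Fsum[OF fin(1) order_refl, of "\<lambda>a. 0"]
      by simp
    then have e: "(\<lambda>i. \<Sum>a\<in>A. c (F (\<delta> a)) * \<delta> a i) = (\<lambda>i. \<Sum>a\<in>A. 0 * \<delta> a i)"
      using Fsum[OF fin(1) order_refl, of "\<lambda>a. c (F (\<delta> a))"] Fsum[OF fin(1) order_refl, of "\<lambda>a. 0"]
      by (intro inj_onD[OF inj]) blast+
    obtain a where a: "a \<in> A" "x = F (\<delta> a)" using x by blast
    have "(\<Sum>b\<in>A. c (F (\<delta> b)) * \<delta> b a) = 0" using fun_cong[OF e, of a] by simp
    then show "c x = 0"
      using a fin by (simp add: \<delta>_def if_distrib[of "\<lambda>x. _ * x"] cong: if_cong)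
  qed (use fin in simp)
  moreover have "(\<lambda>a. F (\<delta> a)) ` A \<subseteq> VS.span (\<epsilon> ` B)"
  proof
    fix x assume "x \<in> (\<lambda>a. F (\<delta> a)) ` A"
    then have x: "x \<in> supp_on B" using maps \<delta>_supp by auto
    have "x = (\<Sum>b\<in>B. (\<lambda>j. x b * \<epsilon> b j))"
    proof
      fix j
      have "(\<Sum>b\<in>B. x b * \<epsilon> b j) = (if j \<in> B then x j else 0)"
        unfolding \<epsilon>_def using fin(2) by (simp add: if_distrib[of "\<lambda>x. _ * x"] cong: if_cong)
      also have "\<dots> = x j" using x by (simp add: supp_on_def)
      finally show "x j = (\<Sum>b\<in>B. (\<lambda>j. x b * \<epsilon> b j)) j" by (simp add: sum_apply)
    qed
    moreover have "(\<Sum>b\<in>B. (\<lambda>j. x b * \<epsilon> b j)) \<in> VS.span (\<epsilon> ` B)"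
      by (intro VS.span_sum VS.span_scale VS.span_base) auto
    ultimately show "x \<in> VS.span (\<epsilon> ` B)" by simp
  qed
  ultimately have "card ((\<lambda>a. F (\<delta> a)) ` A) \<le> card (\<epsilon> ` B)"
    using VS.independent_span_bound[of "\<epsilon> ` B"] fin by blast
  also have "\<dots> \<le> card B" using fin by (rule_tac card_image_le) simp
  finally show ?thesis by (simp add: card_image[OF inj\<delta>])
qed

text \<open>The closure needed to invert an isomorphism in \<open>rep_iso_sym\<close>. Tensor
  products and induced representations are only shown to satisfy this, because
  \<open>iso_class\<close> compares them with members of the universe through \<open>rep_iso\<close>
  alone.\<close>

definition rep_closed :: "('g, 'b) monoid_scheme \<Rightarrow> ('k::field, 'v, 'g) rep \<Rightarrow> bool" where
  "rep_closed G V \<longleftrightarrow> (\<forall>x\<in>carrier V. \<forall>y\<in>carrier V. x \<oplus>\<^bsub>V\<^esub> y \<in> carrier V) \<and>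
     (\<forall>c. \<forall>x\<in>carrier V. c \<odot>\<^bsub>V\<^esub> x \<in> carrier V) \<and>
     (\<forall>g\<in>carrier G. \<forall>x\<in>carrier V. rep_act V g x \<in> carrier V)"

definition rep_map ::
    "('g, 'b) monoid_scheme \<Rightarrow> ('k::field, 'v, 'g) rep \<Rightarrow> ('k, 'w, 'g) rep \<Rightarrow> ('v \<Rightarrow> 'w) \<Rightarrow> bool" where
  "rep_map G V W f \<longleftrightarrow> f \<in> linear_maps V W \<and> bij_betw f (carrier V) (carrier W) \<and>
     (\<forall>g\<in>carrier G. \<forall>x\<in>carrier V. f (rep_act V g x) = rep_act W g (f x))"

lemma rep_iso_iff: "rep_iso G V W \<longleftrightarrow> (\<exists>f. rep_map G V W f)"
  by (auto simp: rep_iso_def rep_map_def)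

lemma rep_mapD:
  assumes "rep_map G V W f"
  shows "bij_betw f (carrier V) (carrier W)"
    and "x \<in> carrier V \<Longrightarrow> f x \<in> carrier W"
    and "x \<in> carrier V \<Longrightarrow> y \<in> carrier V \<Longrightarrow> f (x \<oplus>\<^bsub>V\<^esub> y) = f x \<oplus>\<^bsub>W\<^esub> f y"
    and "x \<in> carrier V \<Longrightarrow> f (c \<odot>\<^bsub>V\<^esub> x) = c \<odot>\<^bsub>W\<^esub> f x"
    and "g \<in> carrier G \<Longrightarrow> x \<in> carrier V \<Longrightarrow> f (rep_act V g x) = rep_act W g (f x)"
  using assms by (auto simp: rep_map_def linear_maps_def)

lemma rep_isoI:
  assumes "bij_betw f (carrier V) (carrier W)"
    and "\<And>x y. x \<in> carrier V \<Longrightarrow> y \<in> carrier V \<Longrightarrow> f (x \<oplus>\<^bsub>V\<^esub> y) = f x \<oplus>\<^bsub>W\<^esub> f y"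
    and "\<And>c x. x \<in> carrier V \<Longrightarrow> f (c \<odot>\<^bsub>V\<^esub> x) = c \<odot>\<^bsub>W\<^esub> f x"
    and "\<And>g x. g \<in> carrier G \<Longrightarrow> x \<in> carrier V \<Longrightarrow> f (rep_act V g x) = rep_act W g (f x)"
  shows "rep_iso G V W"
proof -
  have "f \<in> linear_maps V W"
    using assms(1-3) by (auto simp: linear_maps_def bij_betw_def)
  then show ?thesis unfolding rep_iso_def using assms by blast
qed

lemma rep_iso_refl: "rep_iso G V V"
  by (rule rep_isoI[of "\<lambda>x. x"]) (auto simp: bij_betw_def)

lemma rep_iso_trans:
  assumes "rep_iso G U V" "rep_iso G V W"
  shows "rep_iso G U W"
proof -
  obtain f h where "rep_map G U V f" "rep_map G V W h" using assms unfolding rep_iso_iff by blast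
  note f = rep_mapD[OF this(1)] and h = rep_mapD[OF this(2)]
  show ?thesis
    by (rule rep_isoI[of "h \<circ> f"]) (use f h in \<open>auto intro: bij_betw_trans\<close>)
qed

lemma rep_iso_sym:
  assumes "rep_iso G V W" "rep_closed G V"
  shows "rep_iso G W V"
proof -
  obtain f where "rep_map G V W f" using assms(1) unfolding rep_iso_iff by blast
  note f = rep_mapD[OF this]
  let ?h = "inv_into (carrier V) f"
  have hV: "?h y \<in> carrier V" and fh: "f (?h y) = y" if "y \<in> carrier W" for y
    using that f(1) by (auto simp: bij_betw_def inv_into_into f_inv_into_f)
  have hf: "?h y = x" if "x \<in> carrier V" "y = f x" for x y
    using that f(1) by (auto simp: bij_betw_def)
  have cl: "x \<oplus>\<^bsub>V\<^esub> y \<in> carrier V" if "x \<in> carrier V" "y \<in> carrier V" for x y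
    using that assms(2) by (auto simp: rep_closed_def)
  have cl2: "c \<odot>\<^bsub>V\<^esub> x \<in> carrier V" if "x \<in> carrier V" for x c
    using that assms(2) by (auto simp: rep_closed_def)
  have cl': "rep_act V g x \<in> carrier V" if "x \<in> carrier V" "g \<in> carrier G" for x g
    using that assms(2) by (auto simp: rep_closed_def)
  show ?thesis
  proof (rule rep_isoI[of ?h])
    show "bij_betw ?h (carrier W) (carrier V)" by (rule bij_betw_inv_into[OF f(1)])
  next
    fix x y assume xy: "x \<in> carrier W" "y \<in> carrier W"
    show "?h (x \<oplus>\<^bsub>W\<^esub> y) = ?h x \<oplus>\<^bsub>V\<^esub> ?h y"
      by (rule hf) (simp_all add: xy hV fh cl f)
  next
    fix c x assume x: "x \<in> carrier W"
    show "?h (c \<odot>\<^bsub>W\<^esub> x) = c \<odot>\<^bsub>V\<^esub> ?h x"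
      by (rule hf) (simp_all add: x hV fh cl2 f)
  next
    fix g x assume gx: "g \<in> carrier G" "x \<in> carrier W"
    show "?h (rep_act W g x) = rep_act V g (?h x)"
      by (rule hf) (simp_all add: gx hV fh cl' f)
  qed
qed

text \<open>A sum of lines indexed by I, on each of which G acts through the function
  \<open>\<chi> i\<close>. For index sets of natural numbers it lies in the universe of
  \<open>urep\<close>, so every diagonalisable representation has a copy there.\<close>

definition model :: "'i set \<Rightarrow> ('i \<Rightarrow> 'g \<Rightarrow> 'k::field) \<Rightarrow> ('k, 'i \<Rightarrow> 'k, 'g) rep" where
  "model I \<chi> = \<lparr>carrier = supp_on I, mult = undefined, one = undefined, zero = (\<lambda>_. 0),
     add = (\<lambda>f h i. f i + h i), smult = (\<lambda>c f i. c * f i), rep_act = (\<lambda>g f i. \<chi> i g * f i)\<rparr>"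

lemma model_simps [simp]:
  "carrier (model I \<chi>) = supp_on I" "zero (model I \<chi>) = (\<lambda>_. 0)"
  "add (model I \<chi>) = (\<lambda>f h i. f i + h i)" "smult (model I \<chi>) = (\<lambda>c f i. c * f i)"
  "rep_act (model I \<chi>) = (\<lambda>g f i. \<chi> i g * f i)"
  by (simp_all add: model_def)

lemma rep_closed_model: "rep_closed G (model I \<chi>)"
  by (simp add: rep_closed_def supp_on_def)

lemma model_iso_reindex:
  assumes \<pi>: "bij_betw \<pi> J I" and \<chi>: "\<And>j g. j \<in> J \<Longrightarrow> g \<in> carrier G \<Longrightarrow> \<psi> j g = \<chi> (\<pi> j) g"
  shows "rep_iso G (model I \<chi>) (model J \<psi>)"
proof (rule rep_isoI[of "\<lambda>f j. if j \<in> J then f (\<pi> j) else 0"])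
  let ?F = "\<lambda>f j. if j \<in> J then f (\<pi> j) else 0"
  let ?\<rho> = "inv_into J \<pi>"
  have \<rho>: "?\<rho> i \<in> J" "\<pi> (?\<rho> i) = i" if "i \<in> I" for i
    using that \<pi> by (auto simp: bij_betw_def inv_into_into f_inv_into_f)
  have \<pi>': "\<pi> j \<in> I" "?\<rho> (\<pi> j) = j" if "j \<in> J" for j
    using that \<pi> by (auto simp: bij_betw_def)
  show "bij_betw ?F (carrier (model I \<chi>)) (carrier (model J \<psi>))"
    by (rule bij_betw_byWitness[of _ "\<lambda>h i. if i \<in> I then h (?\<rho> i) else 0"])
      (auto simp: supp_on_def fun_eq_iff \<rho> \<pi>')
qed (auto simp: fun_eq_iff \<chi>)

lemma is_repD:
  assumes "is_rep G V"
  shows "kspace V"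
    and "g \<in> carrier G \<Longrightarrow> x \<in> carrier V \<Longrightarrow> rep_act V g x \<in> carrier V"
    and "g \<in> carrier G \<Longrightarrow> x \<in> carrier V \<Longrightarrow> y \<in> carrier V \<Longrightarrow>
      rep_act V g (x \<oplus>\<^bsub>V\<^esub> y) = rep_act V g x \<oplus>\<^bsub>V\<^esub> rep_act V g y"
    and "g \<in> carrier G \<Longrightarrow> x \<in> carrier V \<Longrightarrow> rep_act V g (c \<odot>\<^bsub>V\<^esub> x) = c \<odot>\<^bsub>V\<^esub> rep_act V g x"
    and "g \<in> carrier G \<Longrightarrow> h \<in> carrier G \<Longrightarrow> x \<in> carrier V \<Longrightarrow>
      rep_act V (g \<otimes>\<^bsub>G\<^esub> h) x = rep_act V g (rep_act V h x)"
proof -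
  show k: "kspace V" using assms by (simp add: is_rep_def kspace_def)
  interpret kspace V by (rule k)
  let ?r = "\<lambda>g. restrict (rep_act V g) (carrier V)"
  have GL: "?r g \<in> Bij (carrier V) \<inter> linear_maps V V" if "g \<in> carrier G" for g
    using assms that by (auto simp: is_rep_def hom_def GL_def)
  show cl: "rep_act V g x \<in> carrier V" if "g \<in> carrier G" "x \<in> carrier V" for g x
    using GL[OF that(1)] that(2) by (auto simp: linear_maps_def Pi_def)
  show "rep_act V g (x \<oplus>\<^bsub>V\<^esub> y) = rep_act V g x \<oplus>\<^bsub>V\<^esub> rep_act V g y"
    if "g \<in> carrier G" "x \<in> carrier V" "y \<in> carrier V" for g x y
    using GL[OF that(1)] that(2,3) by (auto simp: linear_maps_def)
  show "rep_act V g (c \<odot>\<^bsub>V\<^esub> x) = c \<odot>\<^bsub>V\<^esub> rep_act V g x" if "g \<in> carrier G" "x \<in> carrier V" for g x c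
    using GL[OF that(1)] that(2) by (auto simp: linear_maps_def)
  show "rep_act V (g \<otimes>\<^bsub>G\<^esub> h) x = rep_act V g (rep_act V h x)"
    if "g \<in> carrier G" "h \<in> carrier G" "x \<in> carrier V" for g h x
  proof -
    have "?r (g \<otimes>\<^bsub>G\<^esub> h) = ?r g \<otimes>\<^bsub>GL V\<^esub> ?r h"
      using assms that by (auto simp: is_rep_def hom_def)
    also have "\<dots> = compose (carrier V) (?r g) (?r h)"
      using GL[OF that(1)] GL[OF that(2)] by (simp add: GL_def BijGroup_def)
    finally have "?r (g \<otimes>\<^bsub>G\<^esub> h) x = compose (carrier V) (?r g) (?r h) x" by simp
    then show ?thesis using that cl by (simp add: compose_def)
  qed
qed

text \<open>A member of \<open>hom\<close> is only multiplicative, so the action of the identity is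
  at first just idempotent. Being also injective, it fixes every vector.\<close>

lemma rep_act_one:
  assumes "is_rep G V" "group G" "x \<in> carrier V"
  shows "rep_act V \<one>\<^bsub>G\<^esub> x = x"
proof -
  interpret group G by fact
  have one: "\<one>\<^bsub>G\<^esub> \<in> carrier G" by simp
  have "restrict (rep_act V \<one>\<^bsub>G\<^esub>) (carrier V) \<in> Bij (carrier V)"
    using assms(1) one by (auto simp: is_rep_def hom_def GL_def)
  then have "bij_betw (rep_act V \<one>\<^bsub>G\<^esub>) (carrier V) (carrier V)"
    by (simp add: Bij_def bij_betw_restrict_eq)
  then have inj: "inj_on (rep_act V \<one>\<^bsub>G\<^esub>) (carrier V)" by (simp add: bij_betw_def)
  have "rep_act V \<one>\<^bsub>G\<^esub> (rep_act V \<one>\<^bsub>G\<^esub> x) = rep_act V \<one>\<^bsub>G\<^esub> x"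
    using is_repD(5)[OF assms(1) one one assms(3)] by simp
  then show ?thesis
    using inj_onD[OF inj] is_repD(2)[OF assms(1) one assms(3)] assms(3) by blast
qed

lemma rep_closed_rep: "is_rep G V \<Longrightarrow> rep_closed G V"
proof -
  assume r: "is_rep G V"
  interpret kspace V by (rule is_repD(1)[OF r])
  show ?thesis unfolding rep_closed_def using is_repD(2)[OF r] by auto
qed

lemma kspace_model: "kspace (model I \<chi>)"
  unfolding kspace_def
proof (rule moduleI)
  show "abelian_group (model I \<chi>)"
  proof (rule abelian_groupI)
    fix f assume "f \<in> carrier (model I \<chi>)"
    then show "\<exists>y\<in>carrier (model I \<chi>). y \<oplus>\<^bsub>model I \<chi>\<^esub> f = \<zero>\<^bsub>model I \<chi>\<^esub>"
      by (intro bexI[of _ "\<lambda>i. - f i"]) (auto simp: supp_on_def)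
  qed (auto simp: supp_on_def algebra_simps)
qed (auto simp: supp_on_def algebra_simps cring_type_ring)

lemma model_fd:
  fixes \<chi> :: "'i \<Rightarrow> 'g \<Rightarrow> 'k::field" and G :: "('g, 'b) monoid_scheme"
  assumes "finite I" "group G"
    and mult: "\<And>i g h. i \<in> I \<Longrightarrow> g \<in> carrier G \<Longrightarrow> h \<in> carrier G \<Longrightarrow> \<chi> i (g \<otimes>\<^bsub>G\<^esub> h) = \<chi> i g * \<chi> i h"
    and nz: "\<And>i g. i \<in> I \<Longrightarrow> g \<in> carrier G \<Longrightarrow> \<chi> i g \<noteq> 0"
  shows "is_rep G (model I \<chi>)" "fin_dim (model I \<chi>)"
proof -
  interpret group G by fact
  interpret kspace "model I \<chi>" by (rule kspace_model)
  let ?M = "model I \<chi>"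
  let ?r = "\<lambda>g. restrict (rep_act ?M g) (carrier ?M)"
  have r_lin: "?r g \<in> linear_maps ?M ?M" for g
    by (auto simp: linear_maps_def supp_on_def algebra_simps)
  have r_bij: "?r g \<in> Bij (carrier ?M)" if "g \<in> carrier G" for g
  proof -
    have "bij_betw (rep_act ?M g) (carrier ?M) (carrier ?M)"
      by (rule bij_betw_byWitness[of _ "\<lambda>f i. if i \<in> I then f i / \<chi> i g else 0"])
        (use nz that in \<open>auto simp: supp_on_def fun_eq_iff\<close>)
    then show ?thesis by (simp add: Bij_def bij_betw_restrict_eq)
  qed
  have "?r (g \<otimes>\<^bsub>G\<^esub> h) = compose (carrier ?M) (?r g) (?r h)" if "g \<in> carrier G" "h \<in> carrier G" for g h
  proof
    fix f
    show "?r (g \<otimes>\<^bsub>G\<^esub> h) f = compose (carrier ?M) (?r g) (?r h) f"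
    proof (cases "f \<in> supp_on I")
      case True
      then have "(\<lambda>i. \<chi> i h * f i) \<in> supp_on I" by (simp add: supp_on_def)
      moreover have "\<chi> i (g \<otimes>\<^bsub>G\<^esub> h) * f i = \<chi> i g * (\<chi> i h * f i)" for i
        using True mult[OF _ that, of i] by (cases "i \<in> I") (auto simp: supp_on_def)
      ultimately show ?thesis using True by (simp add: compose_def fun_eq_iff)
    qed (simp add: compose_def)
  qed
  then show "is_rep G ?M"
    unfolding is_rep_def hom_def GL_def
    using kspace_model[of I \<chi>] r_lin r_bij by (auto simp: kspace_def BijGroup_def)
  define \<delta> :: "'i \<Rightarrow> 'i \<Rightarrow> 'k" where "\<delta> a i = (if i = a then 1 else 0)" for a i
  have inj\<delta>: "inj_on \<delta> I"
    by (rule inj_onI) (metis \<delta>_def zero_neq_one)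
  have \<delta>_carrier: "\<delta> ` I \<subseteq> carrier ?M" by (auto simp: supp_on_def \<delta>_def)
  have fs: "(\<Oplus>\<^bsub>?M\<^esub>b\<in>X. f b) = (\<lambda>i. \<Sum>b\<in>X. f b i)" if "finite X" "f \<in> X \<rightarrow> carrier ?M" for X and f :: "'c \<Rightarrow> _"
    using that by (induction X rule: finite_induct) auto
  show "fin_dim ?M"
    unfolding fin_dim_def
  proof (intro exI[of _ "\<delta> ` I"] conjI ballI)
    fix v assume v: "v \<in> carrier ?M"
    let ?c = "\<lambda>b. v (inv_into I \<delta> b)"
    have "(\<Oplus>\<^bsub>?M\<^esub>b\<in>\<delta> ` I. ?c b \<odot>\<^bsub>?M\<^esub> b) = (\<lambda>i. \<Sum>b\<in>\<delta> ` I. (?c b \<odot>\<^bsub>?M\<^esub> b) i)"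
      using assms(1) \<delta>_carrier smult_in by (intro fs) auto
    also have "\<dots> = (\<lambda>i. \<Sum>a\<in>I. v a * \<delta> a i)"
      by (simp add: sum.reindex[OF inj\<delta>] inj\<delta>)
    also have "\<dots> = v"
    proof
      fix i
      have "(\<Sum>a\<in>I. v a * \<delta> a i) = (if i \<in> I then v i else 0)"
        unfolding \<delta>_def using assms(1) by (simp add: if_distrib[of "\<lambda>x. _ * x"] cong: if_cong)
      then show "(\<Sum>a\<in>I. v a * \<delta> a i) = v i" using v by (simp add: supp_on_def)
    qed
    finally show "\<exists>c. v = (\<Oplus>\<^bsub>?M\<^esub>b\<in>\<delta> ` I. c b \<odot>\<^bsub>?M\<^esub> b)" by metis
  qed (use assms(1) \<delta>_carrier in auto)
qed

subsection \<open>Weights of representations of a cyclic group\<close>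

definition weight_poly :: "'i set \<Rightarrow> ('i \<Rightarrow> nat) \<Rightarrow> int poly" where
  "weight_poly I e = (\<Sum>i\<in>I. monom 1 (e i))"

lemma coeff_weight_poly: "finite I \<Longrightarrow> coeff (weight_poly I e) k = int (card {i \<in> I. e i = k})"
  by (simp add: weight_poly_def coeff_sum sum.If_cases Int_def conj_commute)

text \<open>The coefficients count the fibres of the exponent maps. Fibres over the same exponent
  are thus equinumerous, and \<open>\<pi>\<close> glues bijections between them.\<close>

lemma weight_poly_eq_bij:
  assumes "finite I" "finite J" "weight_poly I e = weight_poly J e'"
  obtains \<pi> where "bij_betw \<pi> J I" "\<And>j. j \<in> J \<Longrightarrow> e (\<pi> j) = e' j"
proof -
  have "card {i \<in> I. e i = k} = card {j \<in> J. e' j = k}" for k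
    using assms coeff_weight_poly[of I e k] coeff_weight_poly[of J e' k] by simp
  then have "\<exists>h. bij_betw h {j \<in> J. e' j = k} {i \<in> I. e i = k}" for k
    using assms(1,2) by (intro finite_same_card_bij) auto
  then obtain h where h: "\<And>k. bij_betw (h k) {j \<in> J. e' j = k} {i \<in> I. e i = k}" by metis
  define \<pi> where "\<pi> j = h (e' j) j" for j
  have 1: "\<pi> j \<in> I \<and> e (\<pi> j) = e' j" if "j \<in> J" for j
    using bij_betwE[OF h[of "e' j"]] that by (auto simp: \<pi>_def)
  have "inj_on \<pi> J"
  proof (rule inj_onI)
    fix a b assume ab: "a \<in> J" "b \<in> J" "\<pi> a = \<pi> b"
    then have "e' a = e' b" using 1 by metis
    then show "a = b"
      using bij_betw_imp_inj_on[OF h[of "e' b"]] ab by (auto simp: \<pi>_def dest: inj_onD)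
  qed
  moreover have "\<pi> ` J = I"
  proof (intro equalityI subsetI)
    fix i assume i: "i \<in> I"
    then have "i \<in> h (e i) ` {j \<in> J. e' j = e i}"
      using bij_betw_imp_surj_on[OF h[of "e i"]] by auto
    then obtain j where "j \<in> J" "e' j = e i" "i = h (e i) j" by blast
    then have "i = \<pi> j" by (simp add: \<pi>_def)
    with \<open>j \<in> J\<close> show "i \<in> \<pi> ` J" by blast
  qed (use 1 in auto)
  ultimately show thesis using that 1 unfolding bij_betw_def by blast
qed

lemma weight_poly_reindex: "bij_betw \<pi> J I \<Longrightarrow> weight_poly J (\<lambda>j. e (\<pi> j)) = weight_poly I e"
  unfolding weight_poly_def by (rule sum.reindex_bij_betw)

lemma weight_poly_Plus: "finite I \<Longrightarrow> finite J \<Longrightarrow> weight_poly (I <+> J) (case_sum e e') = weight_poly I e + weight_poly J e'"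
  by (simp add: weight_poly_def sum.Plus)

text \<open>Algebraic closedness has been spent on the root \<open>\<zeta>\<close> of exact order n;
  what remains is a field of characteristic 0 containing it. In this form the locale applies again
  to a subgroup of index d, with the generator \<open>g [^] d\<close> and the root
  \<open>\<zeta> ^ d\<close>.\<close>

locale cyclic_rooted = group G for G :: "('g, 'b) monoid_scheme" (structure) +
  fixes g :: 'g and n :: nat and \<zeta> :: "'k::field_char_0"
  assumes g_in [simp]: "g \<in> carrier G" and n_pos: "n > 0"
    and carrier_eq: "carrier G = (\<lambda>a. g [^] a) ` {..<n}"
    and pow_eq_iff: "g [^] (a::nat) = g [^] (b::nat) \<longleftrightarrow> a mod n = b mod n"
    and zeta: "\<zeta> ^ m = 1 \<longleftrightarrow> n dvd m"
begin

lemma finite_G: "finite (carrier G)"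
  by (simp add: carrier_eq)

lemma zeta_nz [simp]: "\<zeta> \<noteq> 0"
  using zeta[of n] n_pos by (auto simp: power_0_left)

lemma zeta_mod: "\<zeta> ^ (a mod n) = \<zeta> ^ a"
proof -
  have "\<zeta> ^ a = \<zeta> ^ (n * (a div n) + a mod n)" by simp
  also have "\<dots> = \<zeta> ^ (a mod n)"
    using zeta[of n] by (simp only: power_add power_mult) simp
  finally show ?thesis by simp
qed

lemma zeta_eq_iff: "\<zeta> ^ a = \<zeta> ^ b \<longleftrightarrow> a mod n = b mod n"
proof
  have aux: "r = s" if "r \<le> s" "s < n" "\<zeta> ^ r = \<zeta> ^ s" for r s
  proof -
    have "\<zeta> ^ r * \<zeta> ^ (s - r) = \<zeta> ^ s"
      using that(1) by (simp flip: power_add)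
    then have "\<zeta> ^ r * \<zeta> ^ (s - r) = \<zeta> ^ r * 1" using that(3) by simp
    then have "\<zeta> ^ (s - r) = 1" by simp
    then have "n dvd s - r" by (simp add: zeta)
    then show ?thesis using that by (auto dest!: dvd_imp_le)
  qed
  assume "\<zeta> ^ a = \<zeta> ^ b"
  then have "\<zeta> ^ (a mod n) = \<zeta> ^ (b mod n)" by (simp add: zeta_mod)
  then show "a mod n = b mod n"
    using aux[of "a mod n" "b mod n"] aux[of "b mod n" "a mod n"] n_pos
    by (metis le_cases mod_less_divisor)
qed (metis zeta_mod)

definition dlog :: "'g \<Rightarrow> nat" where
  "dlog x = (SOME a. a < n \<and> g [^] a = x)"

lemma dlog: assumes "x \<in> carrier G" shows "dlog x < n" "g [^] dlog x = x"
proof -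
  have "\<exists>a. a < n \<and> g [^] a = x" using assms by (auto simp: carrier_eq)
  then have "dlog x < n \<and> g [^] dlog x = x" unfolding dlog_def by (rule someI_ex)
  then show "dlog x < n" "g [^] dlog x = x" by auto
qed

text \<open>The character of G with value \<open>\<zeta> ^ k\<close> at the generator g.\<close>

definition chr :: "nat \<Rightarrow> 'g \<Rightarrow> 'k" where
  "chr k x = \<zeta> ^ (k * dlog x)"

lemma chr_pow: "chr k (g [^] (a::nat)) = \<zeta> ^ (k * a)"
proof -
  have x: "g [^] a \<in> carrier G" by simp
  have "dlog (g [^] a) mod n = a mod n" using dlog(2)[OF x] pow_eq_iff by blast
  then have "k * dlog (g [^] a) mod n = k * a mod n" by (metis mod_mult_right_eq)
  then show ?thesis by (simp add: chr_def zeta_eq_iff)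
qed

lemma chr_nz [simp]: "chr k x \<noteq> 0"
  by (simp add: chr_def)

lemma chr_mult:
  assumes "x \<in> carrier G" "y \<in> carrier G"
  shows "chr k (x \<otimes> y) = chr k x * chr k y"
proof -
  have "x \<otimes> y = g [^] (dlog x + dlog y)"
    using dlog(2)[OF assms(1)] dlog(2)[OF assms(2)] nat_pow_mult[of g "dlog x" "dlog y"] by simp
  then have "chr k (x \<otimes> y) = \<zeta> ^ (k * (dlog x + dlog y))" by (simp only: chr_pow)
  then show ?thesis by (simp add: chr_def distrib_left power_add)
qed

lemma chr_add: "chr ((k + l) mod n) x = chr k x * chr l x"
proof -
  have "(k + l) mod n * dlog x mod n = (k + l) * dlog x mod n" by (metis mod_mult_left_eq)
  then have "chr ((k + l) mod n) x = \<zeta> ^ ((k + l) * dlog x)"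
    unfolding chr_def by (simp only: zeta_eq_iff)
  then show ?thesis by (simp add: chr_def distrib_right power_add)
qed

lemma chr_one: "chr k \<one> = 1"
  using chr_pow[of k 0] by simp

lemma chr_0: "chr 0 x = 1"
  by (simp add: chr_def)

section \<open>Orthogonality of characters, summing over the group and over the exponents\<close>

lemma sum_root: 
  assumes "w ^ n = 1"
  shows "(\<Sum>a<n. w ^ a) = (if w = 1 then of_nat n else (0::'k))"
  using assms sum_gp_strict[of w n] by (simp add: lessThan_atLeast0)

lemma sum_G: "(\<Sum>x\<in>carrier G. f x) = (\<Sum>a<n. f (g [^] (a::nat)))"
  unfolding carrier_eq
  by (subst sum.reindex) (auto intro!: inj_onI simp: pow_eq_iff)

lemma orth1:
  assumes "k < n" "k' < n"
  shows "(\<Sum>x\<in>carrier G. chr k x * inverse (chr k' x)) = (if k = k' then of_nat n else 0)"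
proof -
  let ?w = "\<zeta> ^ k * inverse (\<zeta> ^ k')"
  have "(\<Sum>x\<in>carrier G. chr k x * inverse (chr k' x)) = (\<Sum>a<n. ?w ^ a)"
    unfolding sum_G by (simp add: chr_pow power_mult_distrib power_mult power_inverse)
  also have "\<dots> = (if ?w = 1 then of_nat n else 0)"
  proof (rule sum_root)
    have "(\<zeta> ^ k) ^ n = 1" "(\<zeta> ^ k') ^ n = 1"
      using zeta[of "k * n"] zeta[of "k' * n"] by (simp_all add: power_mult)
    then show "?w ^ n = 1" by (simp add: power_mult_distrib power_inverse)
  qed
  also have "?w = 1 \<longleftrightarrow> \<zeta> ^ k = \<zeta> ^ k'"
    by (metis divide_eq_1_iff divide_inverse power_not_zero zeta_nz)
  also have "\<dots> \<longleftrightarrow> k = k'" using assms by (simp add: zeta_eq_iff)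
  finally show ?thesis .
qed

lemma orth2:
  assumes "x \<in> carrier G" "y \<in> carrier G"
  shows "(\<Sum>k<n. chr k x * inverse (chr k y)) = (if x = y then of_nat n else 0)"
proof -
  let ?w = "\<zeta> ^ dlog x * inverse (\<zeta> ^ dlog y)"
  have "(\<Sum>k<n. chr k x * inverse (chr k y)) = (\<Sum>k<n. ?w ^ k)"
    by (simp add: chr_def power_mult_distrib power_mult power_inverse mult.commute[of _ "dlog _"])
  also have "\<dots> = (if ?w = 1 then of_nat n else 0)"
  proof (rule sum_root)
    have "(\<zeta> ^ dlog x) ^ n = 1" "(\<zeta> ^ dlog y) ^ n = 1"
      using zeta[of "dlog x * n"] zeta[of "dlog y * n"] by (simp_all add: power_mult)
    then show "?w ^ n = 1" by (simp add: power_mult_distrib power_inverse)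
  qed
  also have "?w = 1 \<longleftrightarrow> \<zeta> ^ dlog x = \<zeta> ^ dlog y"
    by (metis divide_eq_1_iff divide_inverse power_not_zero zeta_nz)
  also have "\<dots> \<longleftrightarrow> x = y"
    using assms dlog[of x] dlog[of y] by (metis zeta_eq_iff mod_less)
  finally show ?thesis .
qed

abbreviation wmodel :: "'i set \<Rightarrow> ('i \<Rightarrow> nat) \<Rightarrow> ('k, 'i \<Rightarrow> 'k, 'g) rep" where
  "wmodel I e \<equiv> model I (\<lambda>i. chr (e i))"

text \<open>Exponents are reduced below n, which makes the weight polynomial depend on V alone. The
  index type is left open so that sums, products and the index pairs of induced representations can
  serve directly.\<close>

definition weights :: "('k, 'v, 'g) rep \<Rightarrow> 'i set \<Rightarrow> ('i \<Rightarrow> nat) \<Rightarrow> bool" where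
  "weights V I e \<longleftrightarrow> rep_closed G V \<and> finite I \<and> (\<forall>i\<in>I. e i < n) \<and> rep_iso G V (wmodel I e)"

lemma wmodel_fd:
  assumes "finite I"
  shows "is_rep G (wmodel I e)" "fin_dim (wmodel I e)"
  by (rule model_fd[OF assms is_group]; simp add: chr_mult)+

lemma weights_wmodel: "finite I \<Longrightarrow> (\<And>i. i \<in> I \<Longrightarrow> e i < n) \<Longrightarrow> weights (wmodel I e) I e"
  by (simp add: weights_def rep_closed_model rep_iso_refl)

text \<open>An isomorphism commutes with g, so it maps the eigenspace of g for
  \<open>\<zeta> ^ k\<close> injectively into the corresponding eigenspace. In a diagonal model with
  exponents below n this eigenspace consists of the functions supported on the indices of exponent
  k.\<close>

lemma wmodel_card_le:
  fixes I :: "'i set" and J :: "'j set"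
  assumes fin: "finite I" "finite J" and e: "\<And>i. i \<in> I \<Longrightarrow> e i < n" "\<And>j. j \<in> J \<Longrightarrow> e' j < n"
    and iso: "rep_iso G (wmodel I e) (wmodel J e')"
  shows "card {i \<in> I. e i = k} \<le> card {j \<in> J. e' j = k}"
proof -
  let ?A = "{i \<in> I. e i = k}" and ?B = "{j \<in> J. e' j = k}"
  obtain F where "rep_map G (wmodel I e) (wmodel J e') F" using iso unfolding rep_iso_iff by blast
  note F = rep_mapD[OF this, unfolded model_simps]
  have sub: "f \<in> supp_on I" if "f \<in> supp_on ?A" for f :: "'i \<Rightarrow> 'k"
    using that by (auto simp: supp_on_def)
  show ?thesis
  proof (rule card_le_of_injective_linear[of _ _ F])
    fix f :: "'i \<Rightarrow> 'k" assume f: "f \<in> supp_on ?A"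
    have chr_g: "chr l g = \<zeta> ^ l" for l using chr_pow[of l 1] by simp
    have "(\<lambda>i. chr (e i) g * f i) = (\<lambda>i. \<zeta> ^ k * f i)"
      using f by (auto simp: supp_on_def chr_g fun_eq_iff)
    then have eq: "(\<lambda>j. chr (e' j) g * F f j) = (\<lambda>j. \<zeta> ^ k * F f j)"
      using F(4,5) sub[OF f] by (metis g_in)
    show "F f \<in> supp_on ?B"
      unfolding supp_on_def
    proof (intro CollectI allI impI)
      fix j assume j: "j \<notin> ?B"
      show "F f j = 0"
      proof (cases "j \<in> J")
        case True
        then have "e' j \<noteq> k" using j by simp
        show ?thesis
        proof (cases "k < n")
          case True
          with \<open>j \<in> J\<close> \<open>e' j \<noteq> k\<close> e have "\<zeta> ^ e' j \<noteq> \<zeta> ^ k" by (simp add: zeta_eq_iff)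
          then show ?thesis using fun_cong[OF eq, of j] by (simp add: chr_g)
        next
          case False
          then have "?A = {}" using e by fastforce
          then have "f = (\<lambda>i. 0 * f i)" using f by (auto simp: supp_on_def)
          then have "F f = (\<lambda>j. 0 * F f j)" using F(4)[OF sub[OF f], of 0] by simp
          then show ?thesis by (metis mult_zero_left)
        qed
      next
        case False
        then show ?thesis using F(2)[OF sub[OF f]] by (simp add: supp_on_def)
      qed
    qed
  next
    show "inj_on F (supp_on ?A)"
      using F(1) sub by (auto simp: bij_betw_def intro: inj_on_subset)
  qed (use fin F sub in auto)
qed

lemma weights_unique:
  assumes "weights V I e" "weights V J e'"
  shows "weight_poly I e = weight_poly J e'"
proof -
  have "rep_iso G (wmodel I e) (wmodel J e')" "rep_iso G (wmodel J e') (wmodel I e)"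
    using assms rep_iso_sym rep_iso_trans unfolding weights_def by metis+
  then have "card {i \<in> I. e i = k} = card {j \<in> J. e' j = k}" for k
    using assms unfolding weights_def by (intro order.antisym wmodel_card_le) auto
  then show ?thesis using assms by (auto simp: poly_eq_iff coeff_weight_poly weights_def)
qed

lemma weights_cong: "rep_iso G V W \<Longrightarrow> rep_closed G V \<Longrightarrow> weights W I e \<Longrightarrow> weights V I e"
  unfolding weights_def using rep_iso_trans by blast

lemma weights_iso:
  assumes "weights V I e" "weights W J e'" "weight_poly I e = weight_poly J e'"
  shows "rep_iso G V W"
proof -
  have "finite I" "finite J" using assms by (auto simp: weights_def)
  then obtain \<pi> where \<pi>: "bij_betw \<pi> J I" "\<And>j. j \<in> J \<Longrightarrow> e (\<pi> j) = e' j"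
    using weight_poly_eq_bij[OF _ _ assms(3)] by blast
  have 1: "rep_iso G V (wmodel I e)" using assms by (simp add: weights_def)
  have 2: "rep_iso G (wmodel I e) (wmodel J e')"
    by (rule model_iso_reindex[OF \<pi>(1)]) (simp add: \<pi>(2))
  have 3: "rep_iso G (wmodel J e') W"
    by (rule rep_iso_sym) (use assms in \<open>auto simp: weights_def\<close>)
  show ?thesis by (rule rep_iso_trans[OF 1 rep_iso_trans[OF 2 3]])
qed

lemma weights_reindex:
  assumes "weights V I e"
  obtains J :: "nat set" and e' where "weights V J e'" "weight_poly J e' = weight_poly I e"
proof -
  have "finite I" using assms by (simp add: weights_def)
  then obtain \<pi> where \<pi>: "bij_betw \<pi> {0..<card I} I"
    using ex_bij_betw_nat_finite by blast
  have "rep_iso G (wmodel I e) (wmodel {0..<card I} (\<lambda>j. e (\<pi> j)))"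
    by (rule model_iso_reindex[OF \<pi>]) simp
  then have "weights V {0..<card I} (\<lambda>j. e (\<pi> j))"
    using assms rep_iso_trans bij_betwE[OF \<pi>] unfolding weights_def by blast
  then show thesis using that weight_poly_reindex[OF \<pi>] by blast
qed

text \<open>A definition cannot quantify over index types, hence the index sets of natural numbers;
  \<open>weights_reindex\<close> transports any other finite index set there.\<close>

definition rep_poly :: "('k, 'v, 'g) rep \<Rightarrow> int poly" where
  "rep_poly V = (THE p. \<exists>(I :: nat set) e. weights V I e \<and> p = weight_poly I e)"

lemma rep_poly_eq: "weights V I e \<Longrightarrow> rep_poly V = weight_poly I e"
proof -
  assume d: "weights V I e"
  obtain J :: "nat set" and e' where J: "weights V J e'" "weight_poly J e' = weight_poly I e"
    using weights_reindex[OF d] by blast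
  show ?thesis
    unfolding rep_poly_def using J weights_unique[OF _ d] by (intro the_equality) fastforce+
qed

lemma coeff_weight_poly_ge: "weights V I e \<Longrightarrow> k \<ge> n \<Longrightarrow> coeff (weight_poly I e) k = 0"
  by (auto simp: weights_def coeff_weight_poly)

lemma weights_trivial: "weights trivial_rep {0::nat} (\<lambda>_. 0)"
  unfolding weights_def
proof (intro conjI)
  show "rep_iso G (trivial_rep :: ('k, 'k, 'g) rep) (wmodel {0::nat} (\<lambda>_. 0))"
  proof (rule rep_isoI[of "\<lambda>c i. if i = 0 then c else 0"])
    show "bij_betw (\<lambda>c i. if i = (0::nat) then c else 0) (carrier (trivial_rep :: ('k, 'k, 'g) rep))
      (carrier (wmodel {0::nat} (\<lambda>_. 0)))"
      by (rule bij_betw_byWitness[of _ "\<lambda>f. f 0"]) (auto simp: trivial_rep_def supp_on_def)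
  qed (auto simp: trivial_rep_def chr_0)
qed (use n_pos in \<open>auto simp: rep_closed_def trivial_rep_def\<close>)

lemma weights_direct_sum:
  fixes I :: "'i set" and J :: "'j set"
  assumes "weights V I e" "weights W J e'"
  shows "weights (direct_sum_rep V W) (I <+> J) (case_sum e e')"
proof -
  have iso: "rep_iso G V (wmodel I e)" "rep_iso G W (wmodel J e')"
    and cl: "rep_closed G V" "rep_closed G W" using assms by (auto simp: weights_def)
  obtain f h where "rep_map G V (wmodel I e) f" "rep_map G W (wmodel J e') h"
    using iso unfolding rep_iso_iff by blast
  note f = rep_mapD[OF this(1), unfolded model_simps] and h = rep_mapD[OF this(2), unfolded model_simps]
  let ?F = "\<lambda>(v, w). case_sum (f v) (h w)"
  have supp: "case_sum a b \<in> supp_on (I <+> J)" if "a \<in> supp_on I" "b \<in> supp_on J"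
    for a :: "'i \<Rightarrow> 'k" and b :: "'j \<Rightarrow> 'k"
    using that by (auto simp: supp_on_def split: sum.split)
  have "rep_iso G (direct_sum_rep V W) (wmodel (I <+> J) (case_sum e e'))"
  proof (rule rep_isoI[of ?F])
    show "bij_betw ?F (carrier (direct_sum_rep V W)) (carrier (wmodel (I <+> J) (case_sum e e')))"
    proof (rule bij_betw_byWitness[of _ "\<lambda>k. (inv_into (carrier V) f (k \<circ> Inl), inv_into (carrier W) h (k \<circ> Inr))"])
      have r: "k \<circ> Inl \<in> supp_on I" "k \<circ> Inr \<in> supp_on J" if "k \<in> supp_on (I <+> J)"
        for k :: "'i + 'j \<Rightarrow> 'k"
        using that by (auto simp: supp_on_def)
      have cs: "case_sum (k \<circ> Inl) (k \<circ> Inr) = k" for k :: "'i + 'j \<Rightarrow> 'k"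
        by (auto simp: fun_eq_iff split: sum.split)
      show "\<forall>a\<in>carrier (direct_sum_rep V W). (inv_into (carrier V) f (?F a \<circ> Inl), inv_into (carrier W) h (?F a \<circ> Inr)) = a"
        using f(1) h(1) by (auto simp: direct_sum_rep_def comp_def bij_betw_def)
      show "\<forall>k\<in>carrier (wmodel (I <+> J) (case_sum e e')).
          ?F (inv_into (carrier V) f (k \<circ> Inl), inv_into (carrier W) h (k \<circ> Inr)) = k"
        using f(1) h(1) r cs by (auto simp: bij_betw_inv_into_right)
      show "?F ` carrier (direct_sum_rep V W) \<subseteq> carrier (wmodel (I <+> J) (case_sum e e'))"
        using f(2) h(2) supp by (auto simp: direct_sum_rep_def)
      show "(\<lambda>k. (inv_into (carrier V) f (k \<circ> Inl), inv_into (carrier W) h (k \<circ> Inr)))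
          ` carrier (wmodel (I <+> J) (case_sum e e')) \<subseteq> carrier (direct_sum_rep V W)"
        using f(1) h(1) r
        by (auto simp: direct_sum_rep_def bij_betw_def intro!: inv_into_into)
    qed
  qed (use f h in \<open>auto simp: direct_sum_rep_def fun_eq_iff split: sum.split\<close>)
  moreover have "rep_closed G (direct_sum_rep V W)"
    using cl by (auto simp: rep_closed_def direct_sum_rep_def)
  ultimately show ?thesis
    using assms by (auto simp: weights_def)
qed

end

subsection \<open>Tensor products of diagonal modules\<close>

definition point_fun :: "'i \<Rightarrow> 'k::zero \<Rightarrow> 'i \<Rightarrow> 'k" where
  "point_fun i a = (\<lambda>i'. if i' = i then a else 0)"

lemma point_fun_supp: "i \<in> I \<Longrightarrow> point_fun i a \<in> supp_on I"
  by (auto simp: point_fun_def supp_on_def)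

lemma mult_point_fun: "(\<lambda>i'. (c::'k::mult_zero) * point_fun i a i') = point_fun i (c * a)"
  by (auto simp: point_fun_def)

text \<open>Additivity modulo \<open>T\<close>, iterated over the support of \<open>a\<close>. It is
  used in each tensor factor to split a vector into its components.\<close>

lemma additive_expand:
  fixes F :: "('i \<Rightarrow> 'k::ab_group_add) \<Rightarrow> 'z::ab_group_add"
  assumes T: "add_subgroup T"
    and F: "\<And>a b. a \<in> supp_on I \<Longrightarrow> b \<in> supp_on I \<Longrightarrow> F (\<lambda>i. a i + b i) - F a - F b \<in> T"
    and fin: "finite X" and sub: "X \<subseteq> I" and a: "a \<in> supp_on X"
  shows "F a - (\<Sum>i\<in>X. F (point_fun i (a i))) \<in> T"
  using fin sub a
proof (induction X arbitrary: a rule: finite_induct)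
  case empty
  then have a0: "a = (\<lambda>i. 0)" by (auto simp: supp_on_def)
  have z: "(\<lambda>i. 0) \<in> supp_on I" by (simp add: supp_on_def)
  \<comment> \<open>Additivity applied to 0 + 0 = 0 leaves the negative of this element in
    \<open>T\<close>.\<close>
  have "F (\<lambda>i. 0) \<in> T" using F[OF z z] add_subgroup_minus_iff[OF T, of "F (\<lambda>i. 0)"] by simp
  then show ?case by (simp add: a0)
next
  case (insert x X)
  let ?b = "\<lambda>i. if i = x then 0 else a i"
  have b: "?b \<in> supp_on X" using insert.prems by (auto simp: supp_on_def)
  then have b': "?b \<in> supp_on I" using insert.prems by (auto simp: supp_on_def)
  have x: "point_fun x (a x) \<in> supp_on I" using insert.prems by (intro point_fun_supp) auto
  have "(\<lambda>i. ?b i + point_fun x (a x) i) = a" by (auto simp: point_fun_def)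
  then have 1: "F a - F ?b - F (point_fun x (a x)) \<in> T" using F[OF b' x] by simp
  have "F ?b - (\<Sum>i\<in>X. F (point_fun i (?b i))) \<in> T"
    using insert.prems by (intro insert.IH b) auto
  also have "(\<Sum>i\<in>X. F (point_fun i (?b i))) = (\<Sum>i\<in>X. F (point_fun i (a i)))"
    using insert.hyps by (intro sum.cong) auto
  finally have "(F a - F ?b - F (point_fun x (a x))) + (F ?b - (\<Sum>i\<in>X. F (point_fun i (a i)))) \<in> T"
    using 1 add_subgroup_add[OF T] by blast
  then show ?case using insert.hyps by (simp add: algebra_simps)
qed

text \<open>\<open>f\<close>, \<open>u\<close> and \<open>h\<close>, \<open>w\<close> are mutually inverse coordinate maps on \<open>M\<close> and \<open>N\<close>, and \<open>P\<close> consists of the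
  index pairs whose tensor of basis vectors survives. The others vanish because some element
  of \<open>R\<close> acts on the two factors by different scalars.\<close>

locale weight_tensor = tensor_closed R M N
  for R :: "('r, 'a) ring_scheme" and M :: "('r, 'm, 'b) module_scheme"
    and N :: "('r, 'n, 'c) module_scheme" +
  fixes f :: "'m \<Rightarrow> 'i \<Rightarrow> 'k::field" and u and I :: "'i set"
    and h :: "'n \<Rightarrow> 'j \<Rightarrow> 'k" and w and J :: "'j set"
    and P :: "('i \<times> 'j) set" and sc :: "'k \<Rightarrow> 'r"
  assumes fin: "finite I" "finite J" and P: "P \<subseteq> I \<times> J"
    and f_in: "x \<in> carrier M \<Longrightarrow> f x \<in> supp_on I"
    and u_in: "a \<in> supp_on I \<Longrightarrow> u a \<in> carrier M"
    and f_u: "a \<in> supp_on I \<Longrightarrow> f (u a) = a"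
    and u_f: "x \<in> carrier M \<Longrightarrow> u (f x) = x"
    and f_add: "x \<in> carrier M \<Longrightarrow> x' \<in> carrier M \<Longrightarrow> f (x \<oplus>\<^bsub>M\<^esub> x') = (\<lambda>i. f x i + f x' i)"
    and h_in: "y \<in> carrier N \<Longrightarrow> h y \<in> supp_on J"
    and w_in: "b \<in> supp_on J \<Longrightarrow> w b \<in> carrier N"
    and h_w: "b \<in> supp_on J \<Longrightarrow> h (w b) = b"
    and w_h: "y \<in> carrier N \<Longrightarrow> w (h y) = y"
    and h_add: "y \<in> carrier N \<Longrightarrow> y' \<in> carrier N \<Longrightarrow> h (y \<oplus>\<^bsub>N\<^esub> y') = (\<lambda>j. h y j + h y' j)"
    and sc_in: "sc c \<in> carrier R"
    and f_sc: "x \<in> carrier M \<Longrightarrow> f (sc c \<odot>\<^bsub>M\<^esub> x) = (\<lambda>i. c * f x i)"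
    and h_sc: "y \<in> carrier N \<Longrightarrow> h (sc c \<odot>\<^bsub>N\<^esub> y) = (\<lambda>j. c * h y j)"
    and bal: "r \<in> carrier R \<Longrightarrow> x \<in> carrier M \<Longrightarrow> y \<in> carrier N \<Longrightarrow> (i, j) \<in> P \<Longrightarrow>
      f (r \<odot>\<^bsub>M\<^esub> x) i * h y j = f x i * h (r \<odot>\<^bsub>N\<^esub> y) j"
    and vanish: "i \<in> I \<Longrightarrow> j \<in> J \<Longrightarrow> (i, j) \<notin> P \<Longrightarrow> \<exists>r\<in>carrier R. \<exists>\<alpha> \<beta>. \<alpha> \<noteq> \<beta> \<and>
      (\<forall>a. r \<odot>\<^bsub>M\<^esub> u (point_fun i a) = u (point_fun i (\<alpha> * a))) \<and>
      (\<forall>b. r \<odot>\<^bsub>N\<^esub> w (point_fun j b) = w (point_fun j (\<beta> * b)))"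
begin

definition \<phi> :: "'m \<times> 'n \<Rightarrow> 'i \<times> 'j \<Rightarrow> 'k" where
  "\<phi> p = (\<lambda>q. if q \<in> P then f (fst p) (fst q) * h (snd p) (snd q) else 0)"

text \<open>The tensor with coordinates \<open>H\<close>, written with all scalars in the left
  factor. Other multiples of a tensor of basis vectors are brought to this form by
  \<open>pure_move\<close>.\<close>

definition \<sigma> :: "('i \<times> 'j \<Rightarrow> 'k) \<Rightarrow> ('m \<times> 'n \<Rightarrow>\<^sub>0 int)" where
  "\<sigma> H = (\<Sum>q\<in>P. frag_of (u (point_fun (fst q) (H q)), w (point_fun (snd q) 1)))"

lemma finP: "finite P"
  using P fin finite_subset by blast

lemma u_add:
  assumes "a \<in> supp_on I" "b \<in> supp_on I"
  shows "u (\<lambda>i. a i + b i) = u a \<oplus>\<^bsub>M\<^esub> u b"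
proof -
  have "f (u a \<oplus>\<^bsub>M\<^esub> u b) = (\<lambda>i. a i + b i)" using assms by (simp add: f_add f_u u_in)
  moreover have "u (f (u a \<oplus>\<^bsub>M\<^esub> u b)) = u a \<oplus>\<^bsub>M\<^esub> u b" using assms by (simp add: u_f u_in M_add)
  ultimately show ?thesis by simp
qed

lemma w_add:
  assumes "a \<in> supp_on J" "b \<in> supp_on J"
  shows "w (\<lambda>i. a i + b i) = w a \<oplus>\<^bsub>N\<^esub> w b"
proof -
  have "h (w a \<oplus>\<^bsub>N\<^esub> w b) = (\<lambda>i. a i + b i)" using assms by (simp add: h_add h_w w_in)
  moreover have "w (h (w a \<oplus>\<^bsub>N\<^esub> w b)) = w a \<oplus>\<^bsub>N\<^esub> w b" using assms by (simp add: w_h w_in N_add)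
  ultimately show ?thesis by simp
qed

lemma sc_u:
  assumes "i \<in> I" shows "sc c \<odot>\<^bsub>M\<^esub> u (point_fun i a) = u (point_fun i (c * a))"
proof -
  have x: "u (point_fun i a) \<in> carrier M" using assms by (intro u_in point_fun_supp)
  have "f (sc c \<odot>\<^bsub>M\<^esub> u (point_fun i a)) = point_fun i (c * a)"
    using assms by (simp add: f_sc[OF x] f_u point_fun_supp mult_point_fun)
  moreover have "u (f (sc c \<odot>\<^bsub>M\<^esub> u (point_fun i a))) = sc c \<odot>\<^bsub>M\<^esub> u (point_fun i a)"
    by (intro u_f M_smult x sc_in)
  ultimately show ?thesis by simp
qed

lemma sc_w:
  assumes "j \<in> J" shows "sc c \<odot>\<^bsub>N\<^esub> w (point_fun j a) = w (point_fun j (c * a))"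
proof -
  have x: "w (point_fun j a) \<in> carrier N" using assms by (intro w_in point_fun_supp)
  have "h (sc c \<odot>\<^bsub>N\<^esub> w (point_fun j a)) = point_fun j (c * a)"
    using assms by (simp add: h_sc[OF x] h_w point_fun_supp mult_point_fun)
  moreover have "w (h (sc c \<odot>\<^bsub>N\<^esub> w (point_fun j a))) = sc c \<odot>\<^bsub>N\<^esub> w (point_fun j a)"
    by (intro w_h N_smult x sc_in)
  ultimately show ?thesis by simp
qed

lemma pure_move:
  assumes "i \<in> I" "j \<in> J"
  shows "frag_of (u (point_fun i a), w (point_fun j b)) - frag_of (u (point_fun i (a * b)), w (point_fun j 1)) \<in> T"
proof -
  have x: "u (point_fun i a) \<in> carrier M" and y: "w (point_fun j 1) \<in> carrier N"
    using assms by (auto intro: u_in w_in point_fun_supp)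
  from add_subgroup_minus[OF add_subgroup_T rel_bal[OF sc_in x y, of b]] show ?thesis
    using assms by (simp add: sc_u sc_w mult.commute)
qed

text \<open>Write y for the right factor. Moving \<open>r\<close> across the tensor turns
  \<open>\<alpha>\<close> times c e_i on the left into c e_i with \<open>\<beta>\<close> y on the
  right, and moving the scalar \<open>\<beta>\<close> back turns this into \<open>\<beta>\<close>
  times c e_i on the left. So (\<open>\<alpha>\<close> - \<open>\<beta>\<close>) c e_i tensor y is a
  relation.\<close>

lemma pure_vanish:
  assumes "i \<in> I" "j \<in> J" "(i, j) \<notin> P"
  shows "frag_of (u (point_fun i a), w (point_fun j b)) \<in> T"
proof -
  obtain r \<alpha> \<beta> where r: "r \<in> carrier R" "\<alpha> \<noteq> \<beta>"
    "\<And>a. r \<odot>\<^bsub>M\<^esub> u (point_fun i a) = u (point_fun i (\<alpha> * a))" "\<And>b. r \<odot>\<^bsub>N\<^esub> w (point_fun j b) = w (point_fun j (\<beta> * b))"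
    using vanish[OF assms] by blast
  define y where "y = w (point_fun j b)"
  have x: "u (point_fun i c) \<in> carrier M" for c using assms by (auto intro: u_in point_fun_supp)
  have y: "y \<in> carrier N" using assms unfolding y_def by (auto intro: w_in point_fun_supp)
  \<comment> \<open>Chosen so that \<open>\<alpha> * c\<close> is \<open>\<beta> * c\<close> plus
    \<open>a\<close>.\<close>
  define c where "c = a / (\<alpha> - \<beta>)"
  have "frag_of (u (point_fun i (\<alpha> * c)), y) - frag_of (u (point_fun i c), w (point_fun j (\<beta> * b))) \<in> T"
    using rel_bal[OF r(1) x[of c] y] by (simp add: r(3) y_def r(4))
  moreover have "frag_of (u (point_fun i (\<beta> * c)), y) - frag_of (u (point_fun i c), w (point_fun j (\<beta> * b))) \<in> T"
    using rel_bal[OF sc_in x[of c] y, of \<beta>] assms by (simp add: sc_u y_def sc_w)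
  ultimately have 1: "frag_of (u (point_fun i (\<alpha> * c)), y) - frag_of (u (point_fun i (\<beta> * c)), y) \<in> T"
    using add_subgroup_diff[OF add_subgroup_T] by fastforce
  have e: "(\<lambda>i'. point_fun i (\<beta> * c) i' + point_fun i a i') = point_fun i (\<alpha> * c)"
    using r(2) by (auto simp: point_fun_def c_def field_simps)
  have "u (point_fun i (\<alpha> * c)) = u (point_fun i (\<beta> * c)) \<oplus>\<^bsub>M\<^esub> u (point_fun i a)"
    using assms u_add[of "point_fun i (\<beta> * c)" "point_fun i a"] unfolding e by (simp add: point_fun_supp)
  then have "frag_of (u (point_fun i (\<alpha> * c)), y) - frag_of (u (point_fun i (\<beta> * c)), y) - frag_of (u (point_fun i a), y) \<in> T"
    using rel_add1[OF x[of "\<beta> * c"] x[of a] y] by simp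
  from add_subgroup_diff[OF add_subgroup_T 1 this] show ?thesis by (simp add: y_def)
qed

text \<open>Expanding both factors gives a sum of tensors of basis vectors over all of
  \<open>I \<times> J\<close>. The terms outside \<open>P\<close> are relations by
  \<open>pure_vanish\<close>, and those in \<open>P\<close> agree with the terms of
  \<open>\<sigma>\<close> up to \<open>pure_move\<close>.\<close>

lemma \<sigma>_\<phi>_rel:
  assumes x: "x \<in> carrier M" and y: "y \<in> carrier N"
  shows "\<sigma> (\<phi> (x, y)) - frag_of (x, y) \<in> T"
proof -
  have a: "f x \<in> supp_on I" and b: "h y \<in> supp_on J" using x y by (auto intro: f_in h_in)
  let ?u = "\<lambda>i. u (point_fun i (f x i))" and ?w = "\<lambda>j. w (point_fun j (h y j))"
  have ui: "?u i \<in> carrier M" if "i \<in> I" for i using that by (intro u_in point_fun_supp)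
  have 1: "frag_of (u (f x), y) - (\<Sum>i\<in>I. frag_of (?u i, y)) \<in> T"
    by (rule additive_expand[OF add_subgroup_T _ fin(1) order_refl a])
      (simp add: u_add rel_add1 u_in y)
  have 2: "frag_of (?u i, w (h y)) - (\<Sum>j\<in>J. frag_of (?u i, ?w j)) \<in> T" if "i \<in> I" for i
    by (rule additive_expand[OF add_subgroup_T _ fin(2) order_refl b])
      (simp add: w_add rel_add2 w_in ui that)
  have "(\<Sum>i\<in>I. frag_of (?u i, w (h y)) - (\<Sum>j\<in>J. frag_of (?u i, ?w j))) \<in> T"
    by (intro add_subgroup_sum[OF add_subgroup_T] 2)
  then have 3: "(\<Sum>i\<in>I. frag_of (?u i, y)) - (\<Sum>q\<in>I \<times> J. frag_of (?u (fst q), ?w (snd q))) \<in> T"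
    by (simp add: sum_subtractf w_h y sum.cartesian_product case_prod_unfold)
  have "(\<Sum>q\<in>I \<times> J. frag_of (?u (fst q), ?w (snd q))) - \<sigma> (\<phi> (x, y))
      = (\<Sum>q\<in>I \<times> J - P. frag_of (?u (fst q), ?w (snd q)))
        + (\<Sum>q\<in>P. frag_of (?u (fst q), ?w (snd q)) - frag_of (u (point_fun (fst q) (\<phi> (x, y) q)), w (point_fun (snd q) 1)))"
    unfolding \<sigma>_def sum_subtractf using P fin by (simp add: sum.subset_diff[of P "I \<times> J"])
  also have "\<dots> \<in> T"
  proof (intro add_subgroup_add[OF add_subgroup_T] add_subgroup_sum[OF add_subgroup_T])
    fix q assume "q \<in> I \<times> J - P"
    then show "frag_of (?u (fst q), ?w (snd q)) \<in> T" by (auto intro: pure_vanish)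
  next
    fix q assume "q \<in> P"
    then show "frag_of (?u (fst q), ?w (snd q)) - frag_of (u (point_fun (fst q) (\<phi> (x, y) q)), w (point_fun (snd q) 1)) \<in> T"
      using P pure_move[of "fst q" "snd q" "f x (fst q)" "h y (snd q)"] by (auto simp: \<phi>_def)
  qed
  finally have "(frag_of (u (f x), y) - (\<Sum>i\<in>I. frag_of (?u i, y)))
      + ((\<Sum>i\<in>I. frag_of (?u i, y)) - (\<Sum>q\<in>I \<times> J. frag_of (?u (fst q), ?w (snd q))))
      + ((\<Sum>q\<in>I \<times> J. frag_of (?u (fst q), ?w (snd q))) - \<sigma> (\<phi> (x, y))) \<in> T"
    using 1 3 by (intro add_subgroup_add[OF add_subgroup_T])
  then have "frag_of (x, y) - \<sigma> (\<phi> (x, y)) \<in> T" by (simp add: u_f x)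
  then show ?thesis by (rule add_subgroup_sym[OF add_subgroup_T])
qed

sublocale tensor_coords R M N \<phi> P \<sigma>
proof unfold_locales
  fix x x' y i assume "x \<in> carrier M" "x' \<in> carrier M" "y \<in> carrier N"
  then show "\<phi> (x \<oplus>\<^bsub>M\<^esub> x', y) i = \<phi> (x, y) i + \<phi> (x', y) i"
    by (simp add: \<phi>_def f_add algebra_simps)
next
  fix x y y' i assume "x \<in> carrier M" "y \<in> carrier N" "y' \<in> carrier N"
  then show "\<phi> (x, y \<oplus>\<^bsub>N\<^esub> y') i = \<phi> (x, y) i + \<phi> (x, y') i"
    by (simp add: \<phi>_def h_add algebra_simps)
next
  fix r x y i assume "r \<in> carrier R" "x \<in> carrier M" "y \<in> carrier N"
  then show "\<phi> (r \<odot>\<^bsub>M\<^esub> x, y) i = \<phi> (x, r \<odot>\<^bsub>N\<^esub> y) i"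
    using bal[of r x y "fst i" "snd i"] by (simp add: \<phi>_def)
next
  fix p show "\<phi> p \<in> supp_on P" by (simp add: \<phi>_def supp_on_def)
next
  fix H :: "'i \<times> 'j \<Rightarrow> 'k"
  have "keys (\<sigma> H) \<subseteq> (\<Union>q\<in>P. keys (frag_of (u (point_fun (fst q) (H q)), w (point_fun (snd q) 1))))"
    unfolding \<sigma>_def by (rule keys_sum)
  also have "\<dots> \<subseteq> carrier M \<times> carrier N"
    using P by (fastforce intro!: u_in w_in point_fun_supp)
  finally show "keys (\<sigma> H) \<subseteq> carrier M \<times> carrier N" .
next
  fix H H' :: "'i \<times> 'j \<Rightarrow> 'k"
  have "\<sigma> (\<lambda>i. H i + H' i) - \<sigma> H - \<sigma> H' = (\<Sum>q\<in>P. frag_of (u (point_fun (fst q) (H q + H' q)), w (point_fun (snd q) 1))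
      - frag_of (u (point_fun (fst q) (H q)), w (point_fun (snd q) 1)) - frag_of (u (point_fun (fst q) (H' q)), w (point_fun (snd q) 1)))"
    by (simp add: \<sigma>_def sum_subtractf)
  also have "\<dots> \<in> T"
  proof (rule add_subgroup_sum[OF add_subgroup_T])
    fix q assume "q \<in> P"
    then have q: "fst q \<in> I" "snd q \<in> J" using P by auto
    have "point_fun (fst q) (H q + H' q) = (\<lambda>i. point_fun (fst q) (H q) i + point_fun (fst q) (H' q) i)"
      by (auto simp: point_fun_def)
    then show "frag_of (u (point_fun (fst q) (H q + H' q)), w (point_fun (snd q) 1))
      - frag_of (u (point_fun (fst q) (H q)), w (point_fun (snd q) 1)) - frag_of (u (point_fun (fst q) (H' q)), w (point_fun (snd q) 1)) \<in> T"
      using q by (simp add: u_add point_fun_supp rel_add1 u_in w_in)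
  qed
  finally show "\<sigma> (\<lambda>i. H i + H' i) - \<sigma> H - \<sigma> H' \<in> T" .
next
  fix p assume "p \<in> carrier M \<times> carrier N"
  then show "\<sigma> (\<phi> p) - frag_of p \<in> T" using \<sigma>_\<phi>_rel by (cases p) auto
next
  fix H :: "'i \<times> 'j \<Rightarrow> 'k" and q assume H: "H \<in> supp_on P"
  then have Hq: "H q = 0" if "q \<notin> P" using that unfolding supp_on_def by blast
  have "int_lin (\<lambda>p. \<phi> p q) (\<sigma> H) = (\<Sum>q'\<in>P. \<phi> (u (point_fun (fst q') (H q')), w (point_fun (snd q') 1)) q)"
    by (simp add: \<sigma>_def int_lin_sum)
  also have "\<dots> = (\<Sum>q'\<in>P. if q' = q then H q else 0)"
  proof (rule sum.cong[OF refl])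
    fix q' assume "q' \<in> P"
    then have q': "fst q' \<in> I" "snd q' \<in> J" using P by auto
    show "\<phi> (u (point_fun (fst q') (H q')), w (point_fun (snd q') 1)) q = (if q' = q then H q else 0)"
      unfolding \<phi>_def fst_conv snd_conv f_u[OF point_fun_supp[OF q'(1)]] h_w[OF point_fun_supp[OF q'(2)]]
      using Hq prod_eqI[of q' q] by (auto simp: point_fun_def)
  qed
  also have "\<dots> = H q" using finP Hq by simp
  finally show "int_lin (\<lambda>p. \<phi> p q) (\<sigma> H) = H q" .
qed

end

context cyclic_rooted
begin

text \<open>The vectors \<open>pr k v\<close> are eigenvectors for the whole group and sum to v.
  Hence the projections of a finite spanning set span V, and a basis chosen among them diagonalises
  the action.\<close>

lemma weights_exists:
  fixes V :: "('k, 'v, 'g) rep"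
  assumes rep: "is_rep G V" and fd: "fin_dim V"
  obtains I :: "'v set" and e where "weights V I e"
proof -
  interpret V: kspace V by (rule is_repD(1)[OF rep])
  let ?A = "rep_act V"
  note A_in = is_repD(2)[OF rep] and A_add = is_repD(3)[OF rep] and A_smult = is_repD(4)[OF rep]
    and A_mult = is_repD(5)[OF rep]
  have A_zero: "?A y \<zero>\<^bsub>V\<^esub> = \<zero>\<^bsub>V\<^esub>" if "y \<in> carrier G" for y
    using A_smult[OF that, of "\<zero>\<^bsub>V\<^esub>" 0] A_in[OF that] by simp
  have A_finsum: "?A y (\<Oplus>\<^bsub>V\<^esub>i\<in>X. F i) = (\<Oplus>\<^bsub>V\<^esub>i\<in>X. ?A y (F i))"
    if y: "y \<in> carrier G" and F: "F \<in> X \<rightarrow> carrier V" for y X and F :: "'x \<Rightarrow> 'v"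
    using F
  proof (induction X rule: infinite_finite_induct)
    case (insert i X)
    then have F: "F i \<in> carrier V" "F \<in> X \<rightarrow> carrier V" by auto
    then have "(\<lambda>i. ?A y (F i)) \<in> X \<rightarrow> carrier V" using A_in[OF y] by auto
    then show ?case using insert F y by (simp add: A_add A_in V.finsum_closed)
  qed (simp_all add: A_zero y)
  \<comment> \<open>Coefficients of the idempotent of K[G] that belongs to the character
    \<open>chr k\<close>. Characteristic 0 makes n invertible.\<close>
  define c where "c k x = inverse (chr k x) * inverse (of_nat n)" for k x
  have c_shift: "chr k y * c k (y \<otimes> x) = c k x" if "x \<in> carrier G" "y \<in> carrier G" for k x y
    using that by (simp add: c_def chr_mult)
  define pr where "pr k v = (\<Oplus>\<^bsub>V\<^esub>x\<in>carrier G. c k x \<odot>\<^bsub>V\<^esub> ?A x v)" for k v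
  have pr_in: "pr k v \<in> carrier V" if "v \<in> carrier V" for k v
    unfolding pr_def using that A_in by (intro V.finsum_closed) auto
  have A_pr: "?A y (pr k v) = chr k y \<odot>\<^bsub>V\<^esub> pr k v" if v: "v \<in> carrier V" and y: "y \<in> carrier G" for k v y
  proof -
    have "?A y (pr k v) = (\<Oplus>\<^bsub>V\<^esub>x\<in>carrier G. ?A y (c k x \<odot>\<^bsub>V\<^esub> ?A x v))"
      unfolding pr_def using v A_in by (intro A_finsum[OF y]) auto
    also have "\<dots> = (\<Oplus>\<^bsub>V\<^esub>x\<in>carrier G. chr k y \<odot>\<^bsub>V\<^esub> (c k (y \<otimes> x) \<odot>\<^bsub>V\<^esub> ?A (y \<otimes> x) v))"
      using v y by (intro V.finsum_cong')
        (auto simp: A_smult A_in A_mult V.smult_smult c_shift)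
    also have "\<dots> = chr k y \<odot>\<^bsub>V\<^esub> (\<Oplus>\<^bsub>V\<^esub>x\<in>carrier G. c k (y \<otimes> x) \<odot>\<^bsub>V\<^esub> ?A (y \<otimes> x) v)"
      using v y by (intro V.smult_finsum[symmetric] finite_G) (auto simp: A_in)
    also have "(\<Oplus>\<^bsub>V\<^esub>x\<in>carrier G. c k (y \<otimes> x) \<odot>\<^bsub>V\<^esub> ?A (y \<otimes> x) v)
        = (\<Oplus>\<^bsub>V\<^esub>x\<in>(\<lambda>x. y \<otimes> x) ` carrier G. c k x \<odot>\<^bsub>V\<^esub> ?A x v)"
      using v y by (intro V.finsum_reindex[symmetric]) (auto simp: A_in inj_on_cmult)
    also have "(\<lambda>x. y \<otimes> x) ` carrier G = carrier G" using y by (rule surj_const_mult)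
    finally show ?thesis by (simp add: pr_def)
  qed
  have sum_pr: "(\<Oplus>\<^bsub>V\<^esub>k\<in>{..<n}. pr k v) = v" if v: "v \<in> carrier V" for v
  proof -
    have "(\<Oplus>\<^bsub>V\<^esub>k\<in>{..<n}. pr k v) = (\<Oplus>\<^bsub>V\<^esub>x\<in>carrier G. \<Oplus>\<^bsub>V\<^esub>k\<in>{..<n}. c k x \<odot>\<^bsub>V\<^esub> ?A x v)"
      unfolding pr_def using v A_in finite_G by (intro V.finsum_swap) auto
    \<comment> \<open>Orthogonality over the exponents, compared at the identity of G, kills the
      coefficients of all other group elements.\<close>
    also have "\<dots> = (\<Oplus>\<^bsub>V\<^esub>x\<in>carrier G. if \<one> = x then ?A x v else \<zero>\<^bsub>V\<^esub>)"
    proof (intro V.finsum_cong' refl)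
      fix x assume x: "x \<in> carrier G"
      have "(\<Sum>k<n. c k x) = (\<Sum>k<n. chr k \<one> * inverse (chr k x)) * inverse (of_nat n)"
        by (simp add: c_def sum_distrib_right chr_one)
      also have "\<dots> = (if \<one> = x then 1 else 0)"
        unfolding orth2[OF one_closed x] using n_pos by simp
      finally show "(\<Oplus>\<^bsub>V\<^esub>k\<in>{..<n}. c k x \<odot>\<^bsub>V\<^esub> ?A x v) = (if \<one> = x then ?A x v else \<zero>\<^bsub>V\<^esub>)"
        using V.finsum_smult_sum[of "?A x v" "\<lambda>k. c k x" "{..<n}"] A_in[OF x v] by simp
    qed (use v A_in in auto)
    also have "\<dots> = ?A \<one> v"
      using v A_in by (intro V.finsum_singleton finite_G) auto
    also have "\<dots> = v" by (rule rep_act_one[OF rep is_group v])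
    finally show ?thesis .
  qed
  obtain B where B: "finite B" "B \<subseteq> carrier V" "\<And>v. v \<in> carrier V \<Longrightarrow> \<exists>c. v = V.lincomb c B"
    using fd unfolding fin_dim_def V.lincomb_def by blast
  \<comment> \<open>A spanning set made of eigenvectors only, so that any basis extracted from it is
    an eigenbasis.\<close>
  define S0 where "S0 = (\<lambda>(k, b). pr k b) ` ({..<n} \<times> B)"
  have S0: "finite S0" "S0 \<subseteq> carrier V" using B by (auto simp: S0_def pr_in subset_iff)
  have "B \<subseteq> V.lspan S0"
  proof
    fix b assume b: "b \<in> B"
    have "(\<Oplus>\<^bsub>V\<^esub>k\<in>{..<n}. pr k b) \<in> V.lspan S0"
    proof (rule V.lspan_finsum[OF S0(2)])
      fix k assume "k \<in> {..<n}"
      then have "pr k b \<in> S0" using b by (force simp: S0_def)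
      then show "pr k b \<in> V.lspan S0" by (rule V.lspan_self[OF S0])
    qed
    then show "b \<in> V.lspan S0" using sum_pr[of b] b B(2) by auto
  qed
  then have "V.lspan B \<subseteq> V.lspan S0" by (rule V.lspan_trans[OF S0])
  moreover have "carrier V \<subseteq> V.lspan B" using B(3) by (force simp: V.lspan_def)
  ultimately have full: "carrier V \<subseteq> V.lspan S0" by blast
  obtain S where S: "S \<subseteq> S0" "finite S" "V.lspan S = carrier V"
    "\<And>c b. V.lincomb c S = \<zero>\<^bsub>V\<^esub> \<Longrightarrow> b \<in> S \<Longrightarrow> c b = 0"
    by (rule V.basis_exists[OF S0 full], rule that)
  have SV: "S \<subseteq> carrier V" using S S0 by blast
  have "\<exists>k<n. \<forall>y\<in>carrier G. ?A y s = chr k y \<odot>\<^bsub>V\<^esub> s" if "s \<in> S" for s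
  proof -
    have "s \<in> S0" using that S(1) by blast
    then obtain k b where "k < n" "b \<in> B" "s = pr k b" by (auto simp: S0_def)
    then show ?thesis using A_pr[of b _ k] B(2) by blast
  qed
  then obtain e where e: "\<And>s. s \<in> S \<Longrightarrow> e s < n"
    "\<And>s y. s \<in> S \<Longrightarrow> y \<in> carrier G \<Longrightarrow> ?A y s = chr (e s) y \<odot>\<^bsub>V\<^esub> s" by metis
  have "rep_iso G (wmodel S e) V"
  proof (rule rep_isoI[of "\<lambda>c. V.lincomb c S"], unfold model_simps)
    show "bij_betw (\<lambda>c. V.lincomb c S) (supp_on S) (carrier V)"
    proof (rule bij_betw_imageI)
      show "inj_on (\<lambda>c. V.lincomb c S) (supp_on S)"
      proof (rule inj_onI)
        fix a b :: "'v \<Rightarrow> 'k" assume ab: "a \<in> supp_on S" "b \<in> supp_on S" "V.lincomb a S = V.lincomb b S"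
        have "V.lincomb (\<lambda>s. a s + (-1) * b s) S = V.lincomb a S \<oplus>\<^bsub>V\<^esub> V.lincomb (\<lambda>s. (-1) * b s) S"
          by (rule V.lincomb_add[OF SV])
        also have "\<dots> = V.lincomb b S \<oplus>\<^bsub>V\<^esub> V.lincomb (\<lambda>s. (-1) * b s) S" by (simp only: ab(3))
        also have "\<dots> = V.lincomb (\<lambda>s. b s + (-1) * b s) S"
          by (rule V.lincomb_add[OF SV, symmetric])
        also have "\<dots> = \<zero>\<^bsub>V\<^esub>" by (rule V.lincomb_0[OF SV]) simp
        finally have "a s + (-1) * b s = 0" if "s \<in> S" for s using S(4) that by blast
        then have "a s = b s" for s using ab(1,2) by (cases "s \<in> S") (auto simp: supp_on_def)
        then show "a = b" by blast
      qed
      show "(\<lambda>c. V.lincomb c S) ` supp_on S = carrier V"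
      proof (intro equalityI subsetI)
        fix v assume "v \<in> carrier V"
        then obtain c where "v = V.lincomb c S" using S(3) by (auto simp: V.lspan_def)
        also have "\<dots> = V.lincomb (\<lambda>s. if s \<in> S then c s else 0) S" by (rule V.lincomb_cong[OF SV]) simp
        finally show "v \<in> (\<lambda>c. V.lincomb c S) ` supp_on S" by (auto simp: supp_on_def)
      qed (use SV in auto)
    qed
  next
    fix a b show "V.lincomb (\<lambda>i. a i + b i) S = V.lincomb a S \<oplus>\<^bsub>V\<^esub> V.lincomb b S" by (rule V.lincomb_add[OF SV])
  next
    fix c a show "V.lincomb (\<lambda>i. c * a i) S = c \<odot>\<^bsub>V\<^esub> V.lincomb a S" by (rule V.lincomb_smult[OF S(2) SV])
  next
    fix y and a :: "'v \<Rightarrow> 'k" assume y: "y \<in> carrier G"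
    have "?A y (V.lincomb a S) = (\<Oplus>\<^bsub>V\<^esub>s\<in>S. ?A y (a s \<odot>\<^bsub>V\<^esub> s))"
      unfolding V.lincomb_def using SV by (intro A_finsum[OF y]) auto
    also have "\<dots> = V.lincomb (\<lambda>i. chr (e i) y * a i) S"
      unfolding V.lincomb_def using SV y
      by (intro V.finsum_cong') (auto simp: A_smult e V.smult_smult mult.commute subset_iff)
    finally show "V.lincomb (\<lambda>i. chr (e i) y * a i) S = ?A y (V.lincomb a S)" ..
  qed
  then have "rep_iso G V (wmodel S e)" by (rule rep_iso_sym[OF _ rep_closed_model])
  then have "weights V S e" using rep_closed_rep[OF rep] S(2) e(1) by (simp add: weights_def)
  then show thesis by (rule that)
qed

text \<open>Over the field itself every tensor of basis vectors survives: \<open>P\<close> is all of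
  \<open>I \<times> J\<close> and the vanishing condition is empty. The action multiplies the
  coordinate (i, j) by a product of two characters, which is the character of the exponent sum
  reduced modulo n.\<close>

lemma weights_tensor_rep:
  fixes V :: "('k, 'v, 'g) rep" and W :: "('k, 'w, 'g) rep"
  assumes "weights V I e" "weights W J e'"
  shows "weights (tensor_rep V W) (I \<times> J) (\<lambda>(i, j). (e i + e' j) mod n)"
proof -
  have iso: "rep_iso G V (wmodel I e)" "rep_iso G W (wmodel J e')"
    and cl: "rep_closed G V" "rep_closed G W" and fin: "finite I" "finite J"
    using assms by (auto simp: weights_def)
  obtain f h where "rep_map G V (wmodel I e) f" "rep_map G W (wmodel J e') h"
    using iso unfolding rep_iso_iff by blast
  note f = rep_mapD[OF this(1), unfolded model_simps] and h = rep_mapD[OF this(2), unfolded model_simps]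
  interpret D: weight_tensor type_ring V W f "inv_into (carrier V) f" I h "inv_into (carrier W) h" J "I \<times> J" "\<lambda>c. c"
  proof unfold_locales
  qed (use f h cl fin in \<open>auto simp: rep_closed_def bij_betw_def inv_into_into f_inv_into_f fun_eq_iff\<close>)
  let ?T = "tensor_module type_ring V W"
  have simps: "carrier (tensor_rep V W) = carrier ?T" "add (tensor_rep V W) = add ?T"
    "smult (tensor_rep V W) = (\<lambda>r. tensor_map type_ring V W (\<lambda>(x, y). (r \<odot>\<^bsub>V\<^esub> x, y)))"
    "rep_act (tensor_rep V W) = (\<lambda>g. tensor_map type_ring V W (\<lambda>(v, w). (rep_act V g v, rep_act W g w)))"
    by (simp_all add: tensor_rep_def module.defs rep.defs tensor_module_def Let_def)
  have V_in: "c \<odot>\<^bsub>V\<^esub> x \<in> carrier V" "g \<in> carrier G \<Longrightarrow> rep_act V g x \<in> carrier V"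
    if "x \<in> carrier V" for c x g using that cl(1) by (auto simp: rep_closed_def)
  have W_in: "g \<in> carrier G \<Longrightarrow> rep_act W g x \<in> carrier W"
    if "x \<in> carrier W" for x g using that cl(2) by (auto simp: rep_closed_def)
  note sm = D.\<Lambda>_tensor_map[where f = "\<lambda>(x, y). (c \<odot>\<^bsub>V\<^esub> x, y)" and d = "\<lambda>_. c" for c]
  have sm: "D.\<Lambda> (tensor_map type_ring V W (\<lambda>(x, y). (c \<odot>\<^bsub>V\<^esub> x, y)) X) = (\<lambda>i. c * D.\<Lambda> X i)"
    "tensor_map type_ring V W (\<lambda>(x, y). (c \<odot>\<^bsub>V\<^esub> x, y)) X \<in> carrier ?T" if "X \<in> carrier ?T" for X c
    by (rule sm[OF that]; use f V_in in \<open>auto simp: D.\<phi>_def\<close>)+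
  have ac: "D.\<Lambda> (tensor_map type_ring V W (\<lambda>(x, y). (rep_act V g x, rep_act W g y)) X)
      = (\<lambda>q. chr ((e (fst q) + e' (snd q)) mod n) g * D.\<Lambda> X q)"
    "tensor_map type_ring V W (\<lambda>(x, y). (rep_act V g x, rep_act W g y)) X \<in> carrier ?T"
    if "X \<in> carrier ?T" "g \<in> carrier G" for X g
    by (rule D.\<Lambda>_tensor_map[OF that(1), where d = "\<lambda>q. chr ((e (fst q) + e' (snd q)) mod n) g"]; use that(2) f h V_in W_in in \<open>auto simp: D.\<phi>_def chr_add\<close>)+
  have "rep_closed G (tensor_rep V W)"
    unfolding rep_closed_def simps by (intro conjI ballI allI D.add_closed sm ac)
  moreover have "rep_iso G (tensor_rep V W) (wmodel (I \<times> J) (\<lambda>(i, j). (e i + e' j) mod n))"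
    by (rule rep_isoI[of D.\<Lambda>])
      (simp_all add: simps D.\<Lambda>_bij D.\<Lambda>_add sm[unfolded case_prod_unfold] ac[unfolded case_prod_unfold] case_prod_unfold)
  ultimately show ?thesis
    using fin n_pos by (auto simp: weights_def)
qed

end

subsection \<open>Induction from a subgroup\<close>

text \<open>The K-linear extension of \<open>\<phi>\<close> from group elements to the group
  algebra. For a character of G it is an algebra homomorphism, see
  \<open>char_lin_mult\<close>.\<close>

definition char_lin :: "('g \<Rightarrow> 'k::comm_ring_1) \<Rightarrow> ('g \<Rightarrow>\<^sub>0 'k) \<Rightarrow> 'k" where
  "char_lin \<phi> a = (\<Sum>x\<in>keys a. lookup a x * \<phi> x)"

lemma char_lin_superset:
  assumes "finite S" "keys a \<subseteq> S"
  shows "char_lin \<phi> a = (\<Sum>x\<in>S. lookup a x * \<phi> x)"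
  unfolding char_lin_def using assms
  by (intro sum.mono_neutral_left) (auto simp: in_keys_iff)

lemma char_lin_add: "char_lin \<phi> (a + b) = char_lin \<phi> a + char_lin \<phi> b"
proof -
  let ?S = "keys a \<union> keys b"
  have "char_lin \<phi> (a + b) = (\<Sum>x\<in>?S. lookup (a + b) x * \<phi> x)"
    by (intro char_lin_superset keys_add) simp
  also have "\<dots> = (\<Sum>x\<in>?S. lookup a x * \<phi> x) + (\<Sum>x\<in>?S. lookup b x * \<phi> x)"
    by (simp add: lookup_add algebra_simps sum.distrib)
  also have "\<dots> = char_lin \<phi> a + char_lin \<phi> b"
    by (simp add: char_lin_superset[of ?S a] char_lin_superset[of ?S b])
  finally show ?thesis .
qed

lemma char_lin_single: "char_lin \<phi> (single x c) = c * \<phi> x"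
  by (simp add: char_lin_def)

lemma char_lin_sum: "char_lin \<phi> (\<Sum>i\<in>A. f i) = (\<Sum>i\<in>A. char_lin \<phi> (f i))"
  by (induction A rule: infinite_finite_induct) (simp_all add: char_lin_add, simp_all add: char_lin_def)

lemma char_lin_cong:
  "(\<And>x. x \<in> keys a \<Longrightarrow> \<phi> x = \<psi> x) \<Longrightarrow> char_lin \<phi> a = char_lin \<psi> a"
  by (simp add: char_lin_def)

lemma lookup_sum': "lookup (\<Sum>i\<in>A. f i) x = (\<Sum>i\<in>A. lookup (f i) x)"
  by (induction A rule: infinite_finite_induct) (simp_all add: lookup_add)

lemma group_algebra_simps:
  "carrier (group_algebra G) = {a. keys a \<subseteq> carrier G}"
  "add (group_algebra G) = (+)"
  "mult (group_algebra G) = (\<lambda>a b. \<Sum>g\<in>keys a. \<Sum>h\<in>keys b.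
        single (g \<otimes>\<^bsub>G\<^esub> h) (lookup a g * lookup b h))"
  by (simp_all add: group_algebra_def)

lemma group_algebra_module_simps:
  "carrier (group_algebra_module G) = {a. keys a \<subseteq> carrier G}"
  "add (group_algebra_module G) = (+)"
  "smult (group_algebra_module G) = mult (group_algebra G)"
  by (simp_all add: group_algebra_module_def ring.defs module.defs group_algebra_def)

lemma rep_module_simps:
  "carrier (rep_module W) = carrier W" "add (rep_module W) = add W"
  "smult (rep_module W) = (\<lambda>a w. \<Oplus>\<^bsub>W\<^esub>h\<in>keys a.
        lookup a h \<odot>\<^bsub>W\<^esub> rep_act W h w)"
  by (simp_all add: rep_module_def)

lemma keys_single_subset: "x \<in> S \<Longrightarrow> keys (single x c) \<subseteq> S"
  by simp

lemma keys_sum_subset: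
  "(\<And>i. i \<in> A \<Longrightarrow> keys (f i) \<subseteq> S) \<Longrightarrow> keys (\<Sum>i\<in>A. f i) \<subseteq> S"
  using keys_sum[of f A] by blast

lemma (in group) keys_group_algebra_mult:
  assumes "keys a \<subseteq> carrier G" "keys b \<subseteq> carrier G"
  shows "keys (a \<otimes>\<^bsub>group_algebra G\<^esub> b) \<subseteq> carrier G"
  unfolding group_algebra_simps using assms
  by (intro keys_sum_subset keys_single_subset m_closed) auto

text \<open>H is the subgroup of order m and index d generated by \<open>g [^] d\<close>. That every
  subgroup of G has this form is shown in \<open>subgroup_cyclic_sub\<close>.\<close>

locale cyclic_sub = cyclic_rooted G g n \<zeta>
  for G :: "('g, 'b) monoid_scheme" (structure) and g :: 'g and n :: nat and \<zeta> :: "'k::field_char_0" +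
  fixes m d :: nat and H :: "'g set"
  assumes nmd: "n = m * d" and H: "H = (\<lambda>b. g [^] (d * b)) ` {..<m}"
begin

lemma md_pos: "m > 0" "d > 0"
  using n_pos nmd by auto

lemma mem_H: "g [^] (d * b) \<in> H"
proof -
  have "g [^] (d * b) = g [^] (d * (b mod m))"
    by (simp add: pow_eq_iff nmd mult.commute[of m] mod_mult_mult1)
  then show ?thesis unfolding H using md_pos by auto
qed

lemma subgroup_H: "subgroup H G"
proof (rule subgroupI)
  show "H \<subseteq> carrier G" by (auto simp: H)
  show "H \<noteq> {}" using mem_H by blast
next
  fix x assume "x \<in> H"
  then obtain b where b: "b < m" "x = g [^] (d * b)" by (auto simp: H)
  have "g [^] (d * (m - b)) \<otimes> x = g [^] (d * (m - b) + d * b)"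
    by (simp add: b nat_pow_mult)
  also have "d * (m - b) + d * b = n"
    using b(1) by (simp only: distrib_left[symmetric] nmd) (simp add: mult.commute)
  also have "g [^] n = \<one>" using pow_eq_iff[of n 0] by simp
  finally have "inv x = g [^] (d * (m - b))" by (intro inv_equality) (simp_all add: b)
  then show "inv x \<in> H" using mem_H by simp
next
  fix x y assume "x \<in> H" "y \<in> H"
  then obtain b b' where "x = g [^] (d * b)" "y = g [^] (d * b')" by (auto simp: H)
  then have "x \<otimes> y = g [^] (d * (b + b'))" by (simp add: nat_pow_mult distrib_left)
  then show "x \<otimes> y \<in> H" using mem_H by simp
qed

abbreviation GH where "GH \<equiv> G\<lparr>carrier := H\<rparr>"

lemma pow_GH: "x [^]\<^bsub>GH\<^esub> (a::nat) = x [^] a"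
  using nat_pow_consistent by metis

text \<open>Taking \<open>\<zeta> ^ d\<close> as the root for H is what makes \<open>chr k\<close>
  restrict to the character of H with exponent \<open>k mod m\<close>, as \<open>chr_sub\<close>
  states.\<close>

sublocale HS: cyclic_rooted GH "g [^] d" m "\<zeta> ^ d"
proof (rule cyclic_rooted.intro)
  show "group GH" by (rule subgroup.subgroup_is_group[OF subgroup_H is_group])
  show "cyclic_rooted_axioms GH (g [^] d) m (\<zeta> ^ d)"
  proof (rule cyclic_rooted_axioms.intro)
    show "g [^] d \<in> carrier GH" using mem_H[of 1] by simp
    show "0 < m" by (rule md_pos)
    show "carrier GH = (\<lambda>a. (g [^] d) [^]\<^bsub>GH\<^esub> a) ` {..<m}"
      by (simp add: pow_GH nat_pow_pow) (rule H)
    show "(g [^] d) [^]\<^bsub>GH\<^esub> a = (g [^] d) [^]\<^bsub>GH\<^esub> b \<longleftrightarrow> a mod m = b mod m" for a b :: nat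
      using md_pos by (simp add: pow_GH nat_pow_pow pow_eq_iff nmd mult.commute[of m] mod_mult_mult1)
    show "(\<zeta> ^ d) ^ k = 1 \<longleftrightarrow> m dvd k" for k
      using md_pos by (simp add: power_mult[symmetric] zeta nmd mult.commute[of m])
  qed
qed

lemma chr_sub: "x \<in> H \<Longrightarrow> chr k x = HS.chr (k mod m) x"
proof -
  assume "x \<in> H"
  then obtain b where b: "x = g [^] (d * b)" by (auto simp: H)
  have x: "x = (g [^] d) [^]\<^bsub>GH\<^esub> b" by (simp add: b pow_GH nat_pow_pow)
  have "HS.chr (k mod m) x = \<zeta> ^ (d * (k mod m * b))"
    unfolding x HS.chr_pow by (simp add: power_mult)
  also have "\<dots> = \<zeta> ^ (d * (k * b))"
    unfolding zeta_eq_iff nmd mult.commute[of m d] mod_mult_mult1 by (simp add: mod_mult_left_eq)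
  also have "\<dots> = chr k x" unfolding b chr_pow by (simp add: ac_simps)
  finally show ?thesis ..
qed

lemma char_lin_mult:
  assumes "keys a \<subseteq> carrier G" "keys b \<subseteq> carrier G"
  shows "char_lin (chr k) (a \<otimes>\<^bsub>group_algebra G\<^esub> b) = char_lin (chr k) a * char_lin (chr k) b"
proof -
  have "char_lin (chr k) (a \<otimes>\<^bsub>group_algebra G\<^esub> b) = (\<Sum>x\<in>keys a. \<Sum>y\<in>keys b.
      lookup a x * lookup b y * chr k (x \<otimes> y))"
    unfolding group_algebra_simps by (simp add: char_lin_sum char_lin_single)
  also have "\<dots> = (\<Sum>x\<in>keys a. \<Sum>y\<in>keys b.
      (lookup a x * chr k x) * (lookup b y * chr k y))"
    using assms by (intro sum.cong refl) (auto simp: chr_mult subset_iff)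
  also have "\<dots> = char_lin (chr k) a * char_lin (chr k) b"
    by (simp add: char_lin_def sum_product)
  finally show ?thesis .
qed

text \<open>The Fourier transform on \<open>K[G]\<close> and its inverse.\<close>

definition kcoord :: "('g \<Rightarrow>\<^sub>0 'k) \<Rightarrow> nat \<Rightarrow> 'k" where
  "kcoord a = (\<lambda>k. if k < n then char_lin (chr k) a else 0)"

definition kvec :: "(nat \<Rightarrow> 'k) \<Rightarrow> ('g \<Rightarrow>\<^sub>0 'k)" where
  "kvec b = (\<Sum>k<n. \<Sum>x\<in>carrier G. single x (b k * inverse (chr k x) * inverse (of_nat n)))"

lemma kcoord_kvec:
  assumes "b \<in> supp_on {..<n}" shows "kcoord (kvec b) = b"
proof
  fix k
  show "kcoord (kvec b) k = b k"
  proof (cases "k < n")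
    case True
    have "char_lin (chr k) (kvec b) = (\<Sum>k'<n. \<Sum>x\<in>carrier G. b k' * inverse (chr k' x) * inverse (of_nat n) * chr k x)"
      by (simp add: kvec_def char_lin_sum char_lin_single)
    also have "\<dots> = (\<Sum>k'<n. b k' * inverse (of_nat n) * (\<Sum>x\<in>carrier G. chr k x * inverse (chr k' x)))"
      by (simp add: sum_distrib_left ac_simps)
    also have "\<dots> = (\<Sum>k'<n. if k' = k then b k else 0)"
      using True n_pos by (intro sum.cong refl) (simp add: orth1)
    also have "\<dots> = b k" using True by simp
    finally show ?thesis using True by (simp add: kcoord_def)
  next
    case False
    then show ?thesis using assms by (simp add: kcoord_def supp_on_def)
  qed
qed

lemma kvec_kcoord:
  assumes a: "keys a \<subseteq> carrier G" shows "kvec (kcoord a) = a"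
proof (rule poly_mapping_eqI)
  fix y
  have "lookup (kvec (kcoord a)) y = (\<Sum>k<n. \<Sum>x\<in>carrier G.
      if x = y then kcoord a k * inverse (chr k y) * inverse (of_nat n) else 0)"
    unfolding kvec_def lookup_sum' by (intro sum.cong refl) (simp add: lookup_single when_def)
  also have "\<dots> = (\<Sum>k<n. if y \<in> carrier G then kcoord a k * inverse (chr k y) * inverse (of_nat n) else 0)"
    using finite_G by (intro sum.cong refl) (simp add: eq_commute)
  also have "\<dots> = lookup a y"
  proof (cases "y \<in> carrier G")
    case True
    have "(\<Sum>k<n. kcoord a k * inverse (chr k y) * inverse (of_nat n))
        = (\<Sum>k<n. \<Sum>x\<in>carrier G. lookup a x * inverse (of_nat n) * (chr k x * inverse (chr k y)))"
      by (intro sum.cong refl)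
        (simp add: kcoord_def char_lin_superset[OF finite_G a] sum_distrib_left ac_simps)
    also have "\<dots> = (\<Sum>x\<in>carrier G. lookup a x * inverse (of_nat n) * (\<Sum>k<n. chr k x * inverse (chr k y)))"
      by (subst sum.swap) (simp add: sum_distrib_left)
    also have "\<dots> = (\<Sum>x\<in>carrier G. if x = y then lookup a y else 0)"
      using True n_pos by (intro sum.cong refl) (simp add: orth2)
    also have "\<dots> = lookup a y" using True finite_G by simp
    finally show ?thesis using True by simp
  next
    case False
    then show ?thesis using a by (auto simp: in_keys_iff subset_iff)
  qed
  finally show "lookup (kvec (kcoord a)) y = lookup a y" .
qed

lemma keys_kvec: "keys (kvec b) \<subseteq> carrier G"
  unfolding kvec_def by (intro keys_sum_subset keys_single_subset)

lemma kcoord_supp: "kcoord a \<in> supp_on {..<n}"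
  by (simp add: kcoord_def supp_on_def)

lemma kcoord_add: "kcoord (a + b) = (\<lambda>k. kcoord a k + kcoord b k)"
  by (auto simp: kcoord_def char_lin_add)

lemma kcoord_mult:
  assumes "keys a \<subseteq> carrier G" "keys b \<subseteq> carrier G"
  shows "kcoord (a \<otimes>\<^bsub>group_algebra G\<^esub> b) = (\<lambda>k. char_lin (chr k) a * kcoord b k)"
  using char_lin_mult[OF assms] by (auto simp: kcoord_def)

text \<open>Frobenius reciprocity on the level of indices: a line of exponent \<open>e i\<close> for
  H contributes one line for each character \<open>chr k\<close> of G that restricts to its
  character.\<close>

definition ind_set :: "'i set \<Rightarrow> ('i \<Rightarrow> nat) \<Rightarrow> ('i \<times> nat) set" where
  "ind_set I e = {(i, k). i \<in> I \<and> k < n \<and> k mod m = e i}"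

text \<open>An element of K[H] acts on the i-th basis vector of W through the character of exponent
  \<open>e i\<close>, and on the k-th Fourier component of K[G] through the restriction of
  \<open>chr k\<close>. The tensor of the two survives exactly when these characters of H agree. G
  acts on it through \<open>chr k\<close> because it acts on the factor K[G] only.\<close>

lemma weights_induced:
  fixes W :: "('k, 'v, 'g) rep"
  assumes rep: "is_rep GH W" and dg: "HS.weights W I e"
  shows "weights (induced_rep G H W) (ind_set I e) snd"
proof -
  interpret W: kspace W by (rule is_repD(1)[OF rep])
  have HG: "H \<subseteq> carrier G" using subgroup.subset[OF subgroup_H] .
  have W_in: "rep_act W x v \<in> carrier W" if "x \<in> H" "v \<in> carrier W" for x v
    using is_repD(2)[OF rep] that by simp
  have iso: "rep_iso GH W (HS.wmodel I e)" and fin: "finite I" and em: "\<And>i. i \<in> I \<Longrightarrow> e i < m"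
    using dg by (auto simp: HS.weights_def)
  obtain f where "rep_map GH W (HS.wmodel I e) f" using iso unfolding rep_iso_iff by blast
  note f = rep_mapD[OF this, unfolded model_simps]
  let ?u = "inv_into (carrier W) f"
  have u_in: "?u a \<in> carrier W" and f_u: "f (?u a) = a" if "a \<in> supp_on I" for a
    using f(1) that by (auto simp: bij_betw_def inv_into_into f_inv_into_f)
  have u_f: "?u (f x) = x" if "x \<in> carrier W" for x
    using f(1) that by (auto simp: bij_betw_def)
  have f_zero: "f \<zero>\<^bsub>W\<^esub> = (\<lambda>i. 0)"
    using f(4)[of "\<zero>\<^bsub>W\<^esub>" 0] by simp
  let ?M = "rep_module W" and ?N = "group_algebra_module G :: ('g \<Rightarrow>\<^sub>0 'k, 'g \<Rightarrow>\<^sub>0 'k) module"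
    and ?R = "group_algebra GH :: ('g \<Rightarrow>\<^sub>0 'k) ring"
  have smult_in: "r \<odot>\<^bsub>?M\<^esub> x \<in> carrier W" if "keys r \<subseteq> H" "x \<in> carrier W" for r x
    unfolding rep_module_simps using that W_in by (intro W.finsum_closed) auto
  have f_finsum: "f (\<Oplus>\<^bsub>W\<^esub>y\<in>X. F y) = (\<lambda>i. \<Sum>y\<in>X. f (F y) i)"
    if "finite X" "F \<in> X \<rightarrow> carrier W" for X :: "'g set" and F
    using that by (induction X rule: finite_induct) (auto simp: f_zero f(3))
  have f_smult: "f (r \<odot>\<^bsub>?M\<^esub> x) = (\<lambda>i. char_lin (HS.chr (e i)) r * f x i)"
    if r: "keys r \<subseteq> H" and x: "x \<in> carrier W" for r x
  proof -
    have "f (r \<odot>\<^bsub>?M\<^esub> x) = (\<lambda>i. \<Sum>y\<in>keys r. f (lookup r y \<odot>\<^bsub>W\<^esub> rep_act W y x) i)"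
      unfolding rep_module_simps using r x W_in by (intro f_finsum) auto
    also have "\<dots> = (\<lambda>i. char_lin (HS.chr (e i)) r * f x i)"
      using r x W_in unfolding char_lin_def sum_distrib_right
      by (intro ext sum.cong refl) (auto simp: f(4,5) subset_iff)
    finally show ?thesis .
  qed
  have one: "\<one> \<in> H" using subgroup.one_closed[OF subgroup_H] .
  have sc_keys: "keys (single \<one> c) \<subseteq> H" for c :: 'k
    using one by (rule keys_single_subset)
  have char_lin_sub: "char_lin (chr k) r = char_lin (HS.chr (k mod m)) r" if "keys r \<subseteq> H" for r k
    using that chr_sub by (intro char_lin_cong) auto
  interpret D: weight_tensor ?R ?M ?N f ?u I kcoord kvec "{..<n}" "ind_set I e" "single \<one>"
  proof unfold_locales
    fix y y' assume "y \<in> carrier ?N" "y' \<in> carrier ?N"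
    then show "y \<oplus>\<^bsub>?N\<^esub> y' \<in> carrier ?N" using keys_add[of y y'] by (auto simp: group_algebra_module_simps)
  next
    fix r x assume "r \<in> carrier ?R" "x \<in> carrier ?M"
    then show "r \<odot>\<^bsub>?M\<^esub> x \<in> carrier ?M"
      using smult_in by (simp add: group_algebra_simps rep_module_simps(1))
  next
    fix r y assume "r \<in> carrier ?R" "y \<in> carrier ?N"
    then show "r \<odot>\<^bsub>?N\<^esub> y \<in> carrier ?N"
      using keys_group_algebra_mult[of r y] HG
      by (simp add: group_algebra_simps(1) group_algebra_module_simps)
  next
    fix c and x assume "x \<in> carrier ?M"
    then show "f (single \<one> c \<odot>\<^bsub>?M\<^esub> x) = (\<lambda>i. c * f x i)"
      using f_smult[OF sc_keys] HS.chr_one by (simp add: rep_module_simps(1) char_lin_single)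
  next
    fix c and y assume "y \<in> carrier ?N"
    then show "kcoord (single \<one> c \<odot>\<^bsub>?N\<^esub> y) = (\<lambda>j. c * kcoord y j)"
      using kcoord_mult[of "single \<one> c" y]
      by (simp add: group_algebra_module_simps char_lin_single chr_one keys_single_subset)
  next
    fix r x y i k assume r: "r \<in> carrier ?R" and x: "x \<in> carrier ?M" and y: "y \<in> carrier ?N"
      and "(i, k) \<in> ind_set I e"
    then have "k mod m = e i" "keys r \<subseteq> H"
      by (auto simp: ind_set_def group_algebra_simps)
    then show "f (r \<odot>\<^bsub>?M\<^esub> x) i * kcoord y k = f x i * kcoord (r \<odot>\<^bsub>?N\<^esub> y) k"
      using x y HG char_lin_sub[of r k]
      by (simp add: f_smult rep_module_simps(1) kcoord_mult group_algebra_module_simps)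
  next
    fix i k assume i: "i \<in> I" and k: "k \<in> {..<n}" and "(i, k) \<notin> ind_set I e"
    then have ne: "k mod m \<noteq> e i" by (auto simp: ind_set_def)
    \<comment> \<open>The generator of H: two different characters of H already differ there, so it
      acts on the two factors by different scalars.\<close>
    let ?h = "g [^] d"
    let ?r = "single ?h 1 :: 'g \<Rightarrow>\<^sub>0 'k"
    have h: "?h \<in> H" using mem_H[of 1] by simp
    then have r: "keys ?r \<subseteq> H" "keys ?r \<subseteq> carrier G"
      using HG by (auto intro!: keys_single_subset)
    have hc: "HS.chr l ?h = (\<zeta> ^ d) ^ l" for l using HS.chr_pow[of l 1] by (simp add: pow_GH)
    have "HS.chr (e i) ?h \<noteq> chr k ?h"
      using ne em[OF i] unfolding chr_sub[OF h] hc HS.zeta_eq_iff by simp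
    moreover have "?r \<odot>\<^bsub>?M\<^esub> ?u (point_fun i a) = ?u (point_fun i (HS.chr (e i) ?h * a))" for a
    proof -
      have x: "?u (point_fun i a) \<in> carrier W" using i by (intro u_in point_fun_supp)
      have "f (?r \<odot>\<^bsub>?M\<^esub> ?u (point_fun i a)) = point_fun i (HS.chr (e i) ?h * a)"
        using i by (simp only: f_smult[OF r(1) x] f_u[OF point_fun_supp]) (auto simp: char_lin_single point_fun_def)
      then show ?thesis using u_f[OF smult_in[OF r(1) x]] by simp
    qed
    moreover have "?r \<odot>\<^bsub>?N\<^esub> kvec (point_fun k b) = kvec (point_fun k (chr k ?h * b))" for b
    proof -
      have "kcoord (?r \<otimes>\<^bsub>group_algebra G\<^esub> kvec (point_fun k b)) = point_fun k (chr k ?h * b)"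
        using k by (simp only: kcoord_mult[OF r(2) keys_kvec] kcoord_kvec[OF point_fun_supp])
          (auto simp: char_lin_single point_fun_def)
      then show ?thesis
        using kvec_kcoord[OF keys_group_algebra_mult[OF r(2) keys_kvec], of "point_fun k b"]
        by (simp add: group_algebra_module_simps)
    qed
    ultimately show "\<exists>r\<in>carrier ?R. \<exists>\<alpha> \<beta>. \<alpha> \<noteq> \<beta> \<and>
      (\<forall>a. r \<odot>\<^bsub>?M\<^esub> ?u (point_fun i a) = ?u (point_fun i (\<alpha> * a))) \<and>
      (\<forall>b. r \<odot>\<^bsub>?N\<^esub> kvec (point_fun k b) = kvec (point_fun k (\<beta> * b)))"
      using r(1) by (intro bexI[of _ ?r] exI[of _ "HS.chr (e i) ?h"] exI[of _ "chr k ?h"])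
        (simp_all add: group_algebra_simps(1))
  next
    show "ind_set I e \<subseteq> I \<times> {..<n}" by (auto simp: ind_set_def)
  next
    fix c :: 'k show "single \<one> c \<in> carrier ?R"
      using sc_keys by (simp add: group_algebra_simps(1))
  qed (use f(2,3) u_in f_u u_f fin in \<open>simp_all add: rep_module_simps(1,2) group_algebra_module_simps
      kcoord_kvec kvec_kcoord keys_kvec kcoord_supp kcoord_add\<close>)
  let ?T = "tensor_module ?R ?M ?N"
  have simps: "carrier (induced_rep G H W) = carrier ?T" "add (induced_rep G H W) = add ?T"
    "smult (induced_rep G H W) =
      (\<lambda>c. tensor_map ?R ?M ?N (\<lambda>(x, y). (single \<one> c \<odot>\<^bsub>?M\<^esub> x, y)))"
    "rep_act (induced_rep G H W) = (\<lambda>x. tensor_map ?R ?M ?N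
      (\<lambda>(w, a). (w, a \<otimes>\<^bsub>group_algebra G\<^esub> single x 1)))"
    by (simp_all add: induced_rep_def tensor_module_def Let_def fun_eq_iff)
  have sm: "D.\<Lambda> (tensor_map ?R ?M ?N (\<lambda>(x, y). (single \<one> c \<odot>\<^bsub>?M\<^esub> x, y)) X) = (\<lambda>i. c * D.\<Lambda> X i)"
    "tensor_map ?R ?M ?N (\<lambda>(x, y). (single \<one> c \<odot>\<^bsub>?M\<^esub> x, y)) X \<in> carrier ?T"
    if "X \<in> carrier ?T" for X c
    by (rule D.\<Lambda>_tensor_map[OF that, where d = "\<lambda>_. c"];
        auto simp: D.\<phi>_def D.f_sc D.M_smult D.sc_in mult.assoc)+
  have kx: "keys (single x (1::'k)) \<subseteq> carrier G" if "x \<in> carrier G" for x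
    using that by (rule keys_single_subset)
  have act_N: "a \<otimes>\<^bsub>group_algebra G\<^esub> single x 1 \<in> carrier ?N"
    "kcoord (a \<otimes>\<^bsub>group_algebra G\<^esub> single x 1) k = chr k x * kcoord a k"
    if "a \<in> carrier ?N" "x \<in> carrier G" for a x k
    using that keys_group_algebra_mult[OF _ kx, of a x] char_lin_mult[OF _ kx, of a x k]
    by (simp_all add: kcoord_def char_lin_single group_algebra_module_simps)
  have ac: "D.\<Lambda> (tensor_map ?R ?M ?N (\<lambda>(w, a). (w, a \<otimes>\<^bsub>group_algebra G\<^esub> single x 1)) X)
      = (\<lambda>q. chr (snd q) x * D.\<Lambda> X q)"
    "tensor_map ?R ?M ?N (\<lambda>(w, a). (w, a \<otimes>\<^bsub>group_algebra G\<^esub> single x 1)) X \<in> carrier ?T"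
    if X: "X \<in> carrier ?T" and x: "x \<in> carrier G" for X x
    by (rule D.\<Lambda>_tensor_map[OF X, where d = "\<lambda>q. chr (snd q) x"];
        use act_N[OF _ x] in \<open>auto simp: D.\<phi>_def\<close>)+
  have "rep_closed G (induced_rep G H W)"
    unfolding rep_closed_def simps by (intro conjI ballI allI D.add_closed sm ac)
  moreover have "rep_iso G (induced_rep G H W) (wmodel (ind_set I e) snd)"
    by (rule rep_isoI[of D.\<Lambda>]; unfold simps model_simps)
      (simp_all only: D.\<Lambda>_bij D.\<Lambda>_add sm ac)
  moreover have "finite (ind_set I e)" by (rule D.finP)
  moreover have "\<forall>q\<in>ind_set I e. snd q < n" by (auto simp: ind_set_def)
  ultimately show ?thesis
    unfolding weights_def by blast
qed

text \<open>Division by m: the exponents k below n with remainder \<open>e i\<close> are the numbers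
  \<open>e i + m * t\<close> with t below d.\<close>

lemma weight_poly_induced:
  assumes "finite I" "\<And>i. i \<in> I \<Longrightarrow> e i < m"
  shows "weight_poly (ind_set I e) snd = weight_poly I e * (\<Sum>t<d. monom 1 (m * t))"
proof -
  have "bij_betw (\<lambda>(i, t). (i, e i + m * t)) (I \<times> {..<d}) (ind_set I e)"
  proof (rule bij_betw_byWitness[of _ "\<lambda>(i, k). (i, k div m)"])
    show "(\<lambda>(i, t). (i, e i + m * t)) ` (I \<times> {..<d}) \<subseteq> ind_set I e"
    proof clarify
      fix i t assume it: "i \<in> I" "t < d"
      then have "e i + m * t < m + m * t" using assms(2) by simp
      also have "\<dots> = m * Suc t" by simp
      also have "\<dots> \<le> m * d" using it by (intro mult_le_mono2) simp
      also have "\<dots> = n" by (rule nmd[symmetric])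
      finally show "(i, e i + m * t) \<in> ind_set I e"
        using it assms(2) by (simp add: ind_set_def)
    qed
    show "(\<lambda>(i, k). (i, k div m)) ` ind_set I e \<subseteq> I \<times> {..<d}"
    proof -
      have "k div m < d" if "k < n" for k
        using that unfolding nmd by (intro less_mult_imp_div_less) (simp only: mult.commute)
      then show ?thesis by (auto simp: ind_set_def)
    qed
    show "\<forall>a'\<in>ind_set I e. (\<lambda>(i, t). (i, e i + m * t)) ((\<lambda>(i, k). (i, k div m)) a') = a'"
      by (auto simp: ind_set_def) (metis mod_mult_div_eq)
  qed (use assms(2) md_pos in auto)
  then have "weight_poly (ind_set I e) snd = (\<Sum>q\<in>I \<times> {..<d}. monom 1 (e (fst q) + m * snd q))"
    unfolding weight_poly_def by (subst sum.reindex_bij_betw[symmetric]) (auto simp: case_prod_unfold)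
  also have "\<dots> = (\<Sum>i\<in>I. \<Sum>t<d. monom 1 (e i) * monom 1 (m * t))"
    by (simp add: sum.cartesian_product case_prod_unfold mult_monom)
  also have "\<dots> = weight_poly I e * (\<Sum>t<d. monom 1 (m * t))"
    by (simp add: weight_poly_def sum_product)
  finally show ?thesis .
qed

end

subsection \<open>The representation ring in coordinates\<close>

lemma free_rep_ring_simps:
  "carrier (free_rep_ring G) = {x. keys x \<subseteq> iso_classes G}"
  "add (free_rep_ring G) = (+)" "zero (free_rep_ring G) = 0"
  "mult (free_rep_ring G) = (\<lambda>a b. frag_extend (\<lambda>c. frag_extend (\<lambda>d.
        frag_of (iso_class G (tensor_rep (class_rep c) (class_rep d)))) b) a)"
  "one (free_rep_ring G) = frag_of (iso_class G trivial_rep)"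
  by (auto simp: free_rep_ring_def)

lemma add_monoid_free_rep_ring: "add_monoid (free_rep_ring G) = free_Abelian_group (iso_classes G)"
  by (simp add: free_rep_ring_simps free_Abelian_group_def)

lemma keys_frag_extend_subset:
  "(\<And>x. x \<in> keys c \<Longrightarrow> keys (f x) \<subseteq> S) \<Longrightarrow>
    keys (frag_extend f c) \<subseteq> S"
  using keys_frag_extend[of f c] by blast

lemma weight_poly_Times:
  "weight_poly (I \<times> J) (\<lambda>(i, j). e i + e' j) = weight_poly I e * weight_poly J e'"
  by (simp add: weight_poly_def sum_product sum.cartesian_product case_prod_unfold mult_monom)

lemma unity_poly_dvd_monom_mod: "unity_poly n dvd (monom 1 a - monom 1 (a mod n) :: int poly)"
proof -
  have "monom 1 a - monom 1 (a mod n) = monom 1 (a mod n) * (unity_poly (n * (a div n)) :: int poly)"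
    by (simp add: unity_poly_def algebra_simps mult_monom)
  also have "unity_poly n dvd \<dots>" unfolding unity_poly_mult_geometric by simp
  finally show ?thesis .
qed

lemma unity_poly_dvd_weight_poly_mod: "unity_poly n dvd (weight_poly I e - weight_poly I (\<lambda>i. e i mod n))"
  unfolding weight_poly_def sum_subtractf[symmetric] by (intro dvd_sum unity_poly_dvd_monom_mod)

text \<open>Polynomials of degree below n are unique representatives modulo X^n - 1. Weight
  polynomials are of this kind, so congruences between them become equalities.\<close>

lemma unity_poly_dvd_small:
  fixes p :: "int poly"
  assumes "unity_poly n dvd p" "\<And>k. k \<ge> n \<Longrightarrow> coeff p k = 0" "n > 0"
  shows "p = 0"
proof (rule ccontr)
  assume p: "p \<noteq> 0"
  then have "degree p \<ge> n" using dvd_imp_degree_le[OF assms(1)] degree_unity_poly[OF assms(3), where 'a=int] by simp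
  then have "lead_coeff p = 0" using assms(2) by blast
  with p show False by simp
qed

context cyclic_rooted
begin

text \<open>What is known about tensor products and induced representations, whose types lie outside
  the universe. It is enough for \<open>rep_poly\<close> to determine their isomorphism
  class.\<close>

definition good :: "('k, 'v, 'g) rep \<Rightarrow> bool" where
  "good X \<longleftrightarrow> (\<exists>(I :: nat set) e. weights X I e)"

lemma goodI: "weights X I e \<Longrightarrow> good X"
  unfolding good_def using weights_reindex by metis

lemma goodE:
  assumes "good X"
  obtains I :: "nat set" and e where "weights X I e" "rep_poly X = weight_poly I e"
  using assms rep_poly_eq unfolding good_def by blast

lemma good_fd: "V \<in> fd_reps G \<Longrightarrow> good (V :: ('k, 'g) urep)"
  using weights_exists[of V] goodI unfolding fd_reps_def by blast

lemma good_iso: "good X \<Longrightarrow> good Y \<Longrightarrow> rep_poly X = rep_poly Y \<Longrightarrow> rep_iso G X Y"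
  by (metis goodE weights_iso)

lemma rep_poly_iso: "rep_iso G X Y \<Longrightarrow> good X \<Longrightarrow> good Y \<Longrightarrow> rep_poly X = rep_poly Y"
  by (metis goodE weights_cong weights_def rep_poly_eq)

lemma coeff_rep_poly: "good X \<Longrightarrow> k \<ge> n \<Longrightarrow> coeff (rep_poly X) k = 0"
  by (metis goodE coeff_weight_poly_ge)

lemma wmodel_in_fd: "finite I \<Longrightarrow> (wmodel I e :: ('k, 'g) urep) \<in> fd_reps G"
  by (simp add: fd_reps_def wmodel_fd)

lemma iso_class_eq: "good X \<Longrightarrow> good Y \<Longrightarrow> rep_poly X = rep_poly Y \<Longrightarrow> iso_class G X = iso_class G Y"
  unfolding iso_class_def using good_iso[of X Y] good_iso[of Y X] rep_iso_trans by (metis (lifting))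

text \<open>The diagonal model with the exponents of X is a copy of X in the universe, whatever the
  type of X.\<close>

lemma iso_class_in:
  assumes "good X" shows "iso_class G X \<in> iso_classes G"
proof -
  obtain I :: "nat set" and e where X: "weights X I e" "rep_poly X = weight_poly I e" by (rule goodE[OF assms])
  then have I: "finite I" "\<And>i. i \<in> I \<Longrightarrow> e i < n" by (auto simp: weights_def)
  then have d: "weights (wmodel I e :: ('k, 'g) urep) I e" by (rule weights_wmodel)
  have "iso_class G X = iso_class G (wmodel I e :: ('k, 'g) urep)"
    by (rule iso_class_eq[OF assms goodI[OF d]]) (simp add: X(2) rep_poly_eq[OF d])
  then show ?thesis unfolding iso_classes_def using wmodel_in_fd[OF I(1)] by blast
qed

lemma class_rep:
  assumes "c \<in> iso_classes G"
  shows "class_rep c \<in> fd_reps G" "iso_class G (class_rep c :: ('k, 'g) urep) = c"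
proof -
  obtain V where V: "V \<in> fd_reps G" "c = iso_class G V" using assms by (auto simp: iso_classes_def)
  then have "V \<in> c" by (simp add: iso_class_def rep_iso_refl)
  then have "class_rep c \<in> c" unfolding class_rep_def by (rule someI)
  then have r: "class_rep c \<in> fd_reps G" "rep_iso G (class_rep c) V" using V by (auto simp: iso_class_def)
  then show "class_rep c \<in> fd_reps G" by simp
  show "iso_class G (class_rep c) = c"
    unfolding V(2) using r V by (intro iso_class_eq rep_poly_iso good_fd) (simp_all add: V(2))
qed

definition class_poly :: "('k, 'g) urep set \<Rightarrow> int poly" where
  "class_poly c = rep_poly (class_rep c)"

lemma class_poly_iso_class:
  assumes "good X" shows "class_poly (iso_class G X) = rep_poly X"
proof -
  have c: "iso_class G X \<in> iso_classes G" by (rule iso_class_in[OF assms])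
  obtain I :: "nat set" and e where X: "weights X I e" by (rule goodE[OF assms])
  have "class_rep (iso_class G X) \<in> iso_class G X"
    using class_rep[OF c] rep_iso_refl unfolding iso_class_def by blast
  then have "rep_iso G (class_rep (iso_class G X)) X" by (simp add: iso_class_def)
  then show ?thesis unfolding class_poly_def by (intro rep_poly_iso assms good_fd class_rep(1)[OF c])
qed

lemma coeff_class_poly: "c \<in> iso_classes G \<Longrightarrow> k \<ge> n \<Longrightarrow> coeff (class_poly c) k = 0"
  unfolding class_poly_def by (intro coeff_rep_poly good_fd class_rep)

lemma good_direct_sum: "good V \<Longrightarrow> good W \<Longrightarrow> good (direct_sum_rep V W)"
  by (metis goodE goodI weights_direct_sum)

lemma rep_poly_direct_sum:
  assumes "good V" "good W" shows "rep_poly (direct_sum_rep V W) = rep_poly V + rep_poly W"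
proof -
  obtain I :: "nat set" and e where I: "weights V I e" "rep_poly V = weight_poly I e" by (rule goodE[OF assms(1)])
  obtain J :: "nat set" and e' where J: "weights W J e'" "rep_poly W = weight_poly J e'" by (rule goodE[OF assms(2)])
  show ?thesis
    unfolding rep_poly_eq[OF weights_direct_sum[OF I(1) J(1)]] I(2) J(2)
    using I(1) J(1) by (intro weight_poly_Plus) (auto simp: weights_def)
qed

lemma good_tensor: "good V \<Longrightarrow> good W \<Longrightarrow> good (tensor_rep V W)"
  by (metis goodE goodI weights_tensor_rep)

lemma rep_poly_tensor:
  assumes "good V" "good W" shows "unity_poly n dvd (rep_poly V * rep_poly W - rep_poly (tensor_rep V W))"
proof -
  obtain I :: "nat set" and e where I: "weights V I e" "rep_poly V = weight_poly I e" by (rule goodE[OF assms(1)])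
  obtain J :: "nat set" and e' where J: "weights W J e'" "rep_poly W = weight_poly J e'" by (rule goodE[OF assms(2)])
  show ?thesis
    unfolding rep_poly_eq[OF weights_tensor_rep[OF I(1) J(1)]] I(2) J(2) weight_poly_Times[symmetric]
    using unity_poly_dvd_weight_poly_mod[of n "I \<times> J" "\<lambda>(i, j). e i + e' j"] by (simp add: case_prod_unfold)
qed

lemma good_trivial: "good (trivial_rep :: ('k, 'k, 'g) rep)" and rep_poly_trivial: "rep_poly (trivial_rep :: ('k, 'k, 'g) rep) = 1"
  using goodI[OF weights_trivial] rep_poly_eq[OF weights_trivial] by (simp_all add: weight_poly_def)

abbreviation FR where "FR \<equiv> free_rep_ring G :: (('k, 'g) urep set \<Rightarrow>\<^sub>0 int) ring"

abbreviation Rel :: "(('k, 'g) urep set \<Rightarrow>\<^sub>0 int) set" where "Rel \<equiv> rep_relations G"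

text \<open>Additive on the nose, but multiplicative only modulo X^n - 1, since the exponents of a
  tensor product are reduced.\<close>

definition elem_poly :: "(('k, 'g) urep set \<Rightarrow>\<^sub>0 int) \<Rightarrow> int poly" where
  "elem_poly = int_lin class_poly"

lemma elem_poly_simps: "elem_poly 0 = 0" "elem_poly (x + y) = elem_poly x + elem_poly y" "elem_poly (x - y) = elem_poly x - elem_poly y" "elem_poly (frag_of c) = class_poly c"
  by (simp_all add: elem_poly_def int_lin_add int_lin_diff)

lemma coeff_elem_poly: "x \<in> carrier FR \<Longrightarrow> k \<ge> n \<Longrightarrow> coeff (elem_poly x) k = 0"
  unfolding elem_poly_def int_lin_def by (auto simp: coeff_sum free_rep_ring_simps of_int_poly coeff_class_poly subset_iff)

lemma rel_gens:
  "{frag_of (iso_class G V) + frag_of (iso_class G W) - frag_of (iso_class G (direct_sum_rep V W))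
     | V W. V \<in> fd_reps G \<and> W \<in> fd_reps G} \<subseteq> carrier (free_Abelian_group (iso_classes G :: ('k, 'g) urep set set))"
proof clarify
  fix V W :: "('k, 'g) urep" assume "V \<in> fd_reps G" "W \<in> fd_reps G"
  then have "good V" "good W" by (auto intro: good_fd)
  then have "keys (frag_of (iso_class G V) + frag_of (iso_class G W)) \<subseteq> iso_classes G"
    "keys (frag_of (iso_class G (direct_sum_rep V W))) \<subseteq> iso_classes G"
    using keys_add[of "frag_of (iso_class G V)" "frag_of (iso_class G W)"]
    by (auto simp: iso_class_in good_direct_sum)
  then show "frag_of (iso_class G V) + frag_of (iso_class G W) - frag_of (iso_class G (direct_sum_rep V W))
     \<in> carrier (free_Abelian_group (iso_classes G))"
    unfolding carrier_free_Abelian_group_iff by (rule keys_diff_subset)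
qed

lemma add_subgroup_Rel: "add_subgroup Rel"
  unfolding rep_relations_def add_monoid_free_rep_ring by (rule generate_free_Abelian(1)[OF rel_gens])

lemma Rel_carrier: "x \<in> Rel \<Longrightarrow> x \<in> carrier FR"
  using subsetD[OF generate_free_Abelian(2)[OF rel_gens], of x]
  unfolding rep_relations_def add_monoid_free_rep_ring carrier_free_Abelian_group_iff
  by (simp add: free_rep_ring_simps)

lemma elem_poly_Rel: "x \<in> Rel \<Longrightarrow> elem_poly x = 0"
  unfolding rep_relations_def add_monoid_free_rep_ring elem_poly_def
  by (erule int_lin_generate_0[OF rel_gens, rotated])
    (auto simp: int_lin_add int_lin_diff class_poly_iso_class good_fd good_direct_sum rep_poly_direct_sum)

lemma rel_direct_sum:
  "V \<in> fd_reps G \<Longrightarrow> W \<in> fd_reps G \<Longrightarrow>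
    frag_of (iso_class G V) + frag_of (iso_class G W) - frag_of (iso_class G (direct_sum_rep V W)) \<in> Rel"
  unfolding rep_relations_def by (rule generate.incl) blast

definition line_rep :: "nat \<Rightarrow> ('k, 'g) urep" where
  "line_rep k = wmodel {0} (\<lambda>_. k)"

text \<open>The combination of lines with prescribed multiplicities, inverse to
  \<open>elem_poly\<close> up to relations. Coefficients from n on are dropped, so it is a section
  only on reduced polynomials.\<close>

definition poly_elem :: "int poly \<Rightarrow> (('k, 'g) urep set \<Rightarrow>\<^sub>0 int)" where
  "poly_elem p = (\<Sum>k<n. frag_cmul (coeff p k) (frag_of (iso_class G (line_rep k))))"

lemma line_rep: assumes "k < n" shows "line_rep k \<in> fd_reps G" "good (line_rep k)" "rep_poly (line_rep k) = monom 1 k"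
proof -
  have d: "weights (line_rep k) {0::nat} (\<lambda>_. k)" unfolding line_rep_def by (rule weights_wmodel) (simp_all add: assms)
  show "line_rep k \<in> fd_reps G" unfolding line_rep_def by (rule wmodel_in_fd) simp
  show "good (line_rep k)" "rep_poly (line_rep k) = monom 1 k" using goodI[OF d] rep_poly_eq[OF d] by (simp_all add: weight_poly_def)
qed

lemma poly_elem_add: "poly_elem (p + q) = poly_elem p + poly_elem q"
  by (simp add: poly_elem_def frag_cmul_distrib sum.distrib)

lemma poly_elem_0: "poly_elem 0 = 0"
  by (simp add: poly_elem_def)

lemma poly_elem_diff: "poly_elem (p - q) = poly_elem p - poly_elem q"
  using poly_elem_add[of "p - q" q] by simp

lemma poly_elem_monom: assumes "k < n" shows "poly_elem (monom 1 k) = frag_of (iso_class G (line_rep k))"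
proof -
  have "poly_elem (monom 1 k) = (\<Sum>l<n. if l = k then frag_of (iso_class G (line_rep k)) else 0)"
    unfolding poly_elem_def by (intro sum.cong refl) auto
  then show ?thesis using assms by simp
qed

lemma poly_elem_in: "poly_elem p \<in> carrier FR"
  unfolding free_rep_ring_simps poly_elem_def
  using line_rep iso_class_in keys_cmul by (fastforce intro!: keys_sum_subset)

lemma elem_poly_poly_elem: assumes "\<And>k. k \<ge> n \<Longrightarrow> coeff p k = 0" shows "elem_poly (poly_elem p) = p"
proof (rule poly_eqI)
  fix k
  have "elem_poly (poly_elem p) = (\<Sum>l<n. of_int (coeff p l) * monom 1 l)"
    unfolding elem_poly_def poly_elem_def by (simp add: int_lin_sum int_lin_cmul class_poly_iso_class line_rep)
  also have "\<dots> = (\<Sum>l<n. monom (coeff p l) l)" by (simp add: of_int_poly smult_monom)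
  also have "coeff \<dots> k = (if k < n then coeff p k else 0)"
    by (simp add: coeff_sum)
  also have "\<dots> = coeff p k" using assms by simp
  finally show "coeff (elem_poly (poly_elem p)) k = coeff p k" .
qed

text \<open>A diagonal model is split into its lines by removing one index at a time, each removal
  costing one direct sum relation.\<close>

lemma wmodel_rel:
  assumes "finite I" "\<And>i. i \<in> I \<Longrightarrow> e i < n"
  shows "frag_of (iso_class G (wmodel (I :: nat set) e)) - poly_elem (weight_poly I e) \<in> Rel"
  using assms
proof (induction I rule: finite_induct)
  case empty
  \<comment> \<open>The class of the zero representation is itself a relation, because its direct
    sum with itself is again zero.\<close>
  let ?E = "wmodel ({} :: nat set) e"
  have d: "weights ?E {} e" by (rule weights_wmodel) simp_all
  have g: "good ?E" and p: "rep_poly ?E = 0" using goodI[OF d] rep_poly_eq[OF d] by (simp_all add: weight_poly_def)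
  have fd: "?E \<in> fd_reps G" by (rule wmodel_in_fd) simp
  have "iso_class G (direct_sum_rep ?E ?E) = iso_class G ?E"
    by (rule iso_class_eq[OF good_direct_sum[OF g g] g]) (simp add: rep_poly_direct_sum g p)
  with rel_direct_sum[OF fd fd] show ?case by (simp add: weight_poly_def poly_elem_0)
next
  case (insert i I)
  let ?E = "wmodel I e" and ?E' = "wmodel (insert i I) e"
  have i: "e i < n" using insert by simp
  have d: "weights ?E I e" "weights ?E' (insert i I) e" using insert by (auto intro!: weights_wmodel)
  have g: "good ?E" "good ?E'" and p: "rep_poly ?E = weight_poly I e" "rep_poly ?E' = monom 1 (e i) + weight_poly I e"
    using goodI[OF d(1)] goodI[OF d(2)] rep_poly_eq[OF d(1)] rep_poly_eq[OF d(2)] insert.hyps by (simp_all add: weight_poly_def)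
  have fd: "?E \<in> fd_reps G" using insert.hyps by (intro wmodel_in_fd)
  have "iso_class G (direct_sum_rep (line_rep (e i)) ?E) = iso_class G ?E'"
    using g line_rep[OF i] by (intro iso_class_eq good_direct_sum) (simp_all add: rep_poly_direct_sum p)
  with rel_direct_sum[OF line_rep(1)[OF i] fd]
  have "frag_of (iso_class G (line_rep (e i))) + frag_of (iso_class G ?E) - frag_of (iso_class G ?E') \<in> Rel"
    by simp
  from add_subgroup_minus[OF add_subgroup_Rel this]
  have "frag_of (iso_class G ?E') - frag_of (iso_class G ?E) - frag_of (iso_class G (line_rep (e i))) \<in> Rel"
    by (simp add: algebra_simps)
  moreover have "frag_of (iso_class G ?E) - poly_elem (weight_poly I e) \<in> Rel" using insert by simp
  ultimately have "(frag_of (iso_class G ?E') - frag_of (iso_class G ?E) - frag_of (iso_class G (line_rep (e i))))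
      + (frag_of (iso_class G ?E) - poly_elem (weight_poly I e)) \<in> Rel"
    by (rule add_subgroup_add[OF add_subgroup_Rel])
  moreover have "poly_elem (weight_poly (insert i I) e) = frag_of (iso_class G (line_rep (e i))) + poly_elem (weight_poly I e)"
    using insert.hyps by (simp add: weight_poly_def poly_elem_add poly_elem_monom[OF i])
  ultimately show ?case by (simp add: algebra_simps)
qed

text \<open>Modulo the relations every class is a sum of lines: \<open>class_rep\<close> is replaced
  by its diagonal model, and \<open>wmodel_rel\<close> decomposes that. It follows that the
  relations are the whole kernel of \<open>elem_poly\<close>.\<close>

lemma poly_elem_elem_poly_rel: assumes "x \<in> carrier FR" shows "x - poly_elem (elem_poly x) \<in> Rel"
proof -
  have "keys x \<subseteq> iso_classes G" using assms by (simp add: free_rep_ring_simps)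
  then show ?thesis
  proof (induction x rule: frag_induction)
    case zero
    then show ?case by (simp add: elem_poly_simps poly_elem_0 add_subgroup_0[OF add_subgroup_Rel])
  next
    case (one c)
    have g: "good (class_rep c)" by (intro good_fd class_rep one)
    obtain I :: "nat set" and e where I: "weights (class_rep c) I e" "rep_poly (class_rep c) = weight_poly I e" by (rule goodE[OF g])
    then have I': "finite I" "\<And>i. i \<in> I \<Longrightarrow> e i < n" by (auto simp: weights_def)
    have d: "weights (wmodel I e) I e" using I' by (rule weights_wmodel)
    have "c = iso_class G (class_rep c)" using class_rep(2)[OF one] by simp
    also have "\<dots> = iso_class G (wmodel I e)"
      using rep_poly_eq[OF d] I by (intro iso_class_eq g goodI[OF d]) simp
    finally have "frag_of c - poly_elem (weight_poly I e) \<in> Rel" using wmodel_rel[OF I'] by simp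
    then show ?case using I by (simp add: elem_poly_simps class_poly_def)
  next
    case (diff a b)
    have "(a - poly_elem (elem_poly a)) - (b - poly_elem (elem_poly b)) \<in> Rel" by (rule add_subgroup_diff[OF add_subgroup_Rel diff])
    then show ?case by (simp add: elem_poly_simps poly_elem_diff algebra_simps)
  qed
qed

lemma Rel_iff: "x \<in> carrier FR \<Longrightarrow> x \<in> Rel \<longleftrightarrow> elem_poly x = 0"
  using poly_elem_elem_poly_rel[of x] elem_poly_Rel by (auto simp: poly_elem_0)

lemma FR_closed:
  "x \<in> carrier FR \<Longrightarrow> y \<in> carrier FR \<Longrightarrow> x + y \<in> carrier FR"
  "x \<in> carrier FR \<Longrightarrow> y \<in> carrier FR \<Longrightarrow> x - y \<in> carrier FR"
  "0 \<in> carrier FR"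
  using keys_add[of x y] keys_diff_subset[of x _ y] by (auto simp: free_rep_ring_simps)

lemma one_in: "\<one>\<^bsub>FR\<^esub> \<in> carrier FR" and elem_poly_one: "elem_poly \<one>\<^bsub>FR\<^esub> = 1"
  by (simp_all add: free_rep_ring_simps elem_poly_simps iso_class_in good_trivial class_poly_iso_class rep_poly_trivial)

lemma mult_in:
  assumes "x \<in> carrier FR" "y \<in> carrier FR" shows "x \<otimes>\<^bsub>FR\<^esub> y \<in> carrier FR"
proof -
  have "keys (frag_of (iso_class G (tensor_rep (class_rep c) (class_rep d)))) \<subseteq> iso_classes G"
    if "c \<in> iso_classes G" "d \<in> iso_classes G" for c d :: "('k, 'g) urep set"
    using that by (simp add: iso_class_in good_tensor good_fd class_rep)
  then show ?thesis
    using assms unfolding free_rep_ring_simps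
    by (intro CollectI keys_frag_extend_subset) (simp add: subset_iff)
qed

lemma elem_poly_mult:
  assumes "x \<in> carrier FR" "y \<in> carrier FR"
  shows "unity_poly n dvd (elem_poly x * elem_poly y - elem_poly (x \<otimes>\<^bsub>FR\<^esub> y))"
proof -
  let ?f = "\<lambda>c d. class_poly c * class_poly d - class_poly (iso_class G (tensor_rep (class_rep c) (class_rep d)))"
  have "elem_poly x * elem_poly y = int_lin (\<lambda>c. int_lin (\<lambda>d. class_poly c * class_poly d) y) x"
    by (simp add: elem_poly_def int_lin_mult int_lin_mult[of "int_lin class_poly y", simplified mult.commute, symmetric] mult.commute)
  moreover have "elem_poly (x \<otimes>\<^bsub>FR\<^esub> y) =
      int_lin (\<lambda>c. int_lin (\<lambda>d. class_poly (iso_class G (tensor_rep (class_rep c) (class_rep d)))) y) x"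
    by (simp add: free_rep_ring_simps elem_poly_def int_lin_frag_extend)
  ultimately have "elem_poly x * elem_poly y - elem_poly (x \<otimes>\<^bsub>FR\<^esub> y) = int_lin (\<lambda>c. int_lin (?f c) y) x"
    by (simp add: int_lin_def sum_subtractf algebra_simps)
  also have "unity_poly n dvd \<dots>"
    unfolding int_lin_def
  proof (intro dvd_sum dvd_mult)
    fix c d assume "c \<in> keys x" "d \<in> keys y"
    then have "c \<in> iso_classes G" "d \<in> iso_classes G" using assms by (auto simp: free_rep_ring_simps)
    then have g: "good (class_rep c)" "good (class_rep d)" by (auto intro: good_fd class_rep)
    show "unity_poly n dvd ?f c d"
      unfolding class_poly_iso_class[OF good_tensor[OF g]] unfolding class_poly_def by (rule rep_poly_tensor[OF g])
  qed
  finally show ?thesis .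
qed

section \<open>The quotient by the relations, described by reduced polynomials\<close>

abbreviation RR where "RR \<equiv> free_rep_ring G Quot Rel"

lemma carrier_RR: "carrier RR = add_coset Rel ` carrier FR"
  by (auto simp: FactRing_def A_RCOSETS_def RCOSETS_def r_coset_add_coset free_rep_ring_simps(2))

lemma a_r_coset_FR: "Rel +>\<^bsub>FR\<^esub> x = add_coset Rel x"
  by (simp add: a_r_coset_def r_coset_add_coset free_rep_ring_simps(2))

lemma add_coset_Rel_eq_iff:
  "x \<in> carrier FR \<Longrightarrow> y \<in> carrier FR \<Longrightarrow> add_coset Rel x = add_coset Rel y \<longleftrightarrow> elem_poly x = elem_poly y"
  using add_coset_eq_iff[OF add_subgroup_Rel, of x y] Rel_iff[OF FR_closed(2), of x y] by (simp add: elem_poly_simps)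

lemma mem_add_coset_Rel: "x \<in> carrier FR \<Longrightarrow> y \<in> add_coset Rel x \<Longrightarrow> y \<in> carrier FR \<and> elem_poly y = elem_poly x"
proof -
  assume "x \<in> carrier FR" "y \<in> add_coset Rel x"
  then have "y - x \<in> Rel" by (simp add: add_coset_def)
  then show ?thesis
    using FR_closed(1)[OF Rel_carrier[of "y - x"] \<open>x \<in> carrier FR\<close>] elem_poly_Rel[of "y - x"] by (simp add: elem_poly_simps)
qed

lemma add_RR: "add_coset Rel x \<oplus>\<^bsub>RR\<^esub> add_coset Rel y = add_coset Rel (x + y)"
  by (simp add: FactRing_def set_add_def set_mult_add_coset add_subgroup_Rel free_rep_ring_simps(2))

lemma zero_RR: "\<zero>\<^bsub>RR\<^esub> = add_coset Rel 0"
  by (simp add: FactRing_def add_coset_0)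

lemma one_RR: "\<one>\<^bsub>RR\<^esub> = add_coset Rel \<one>\<^bsub>FR\<^esub>"
  by (simp add: FactRing_def a_r_coset_FR)

text \<open>Independence of representatives is seen on polynomials: products of congruent elements
  have polynomials congruent modulo X^n - 1, and both are reduced, hence equal. This stands in for a
  proof that \<open>Rel\<close> is an ideal.\<close>

lemma mult_RR:
  assumes "x \<in> carrier FR" "y \<in> carrier FR"
  shows "add_coset Rel x \<otimes>\<^bsub>RR\<^esub> add_coset Rel y = add_coset Rel (x \<otimes>\<^bsub>FR\<^esub> y)"
proof -
  have "add_coset Rel (a \<otimes>\<^bsub>FR\<^esub> b) = add_coset Rel (x \<otimes>\<^bsub>FR\<^esub> y)" if "a \<in> add_coset Rel x" "b \<in> add_coset Rel y" for a b
  proof -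
    have a: "a \<in> carrier FR" "elem_poly a = elem_poly x" and b: "b \<in> carrier FR" "elem_poly b = elem_poly y"
      using mem_add_coset_Rel assms that by blast+
    have "unity_poly n dvd (elem_poly x * elem_poly y - elem_poly (x \<otimes>\<^bsub>FR\<^esub> y)) - (elem_poly x * elem_poly y - elem_poly (a \<otimes>\<^bsub>FR\<^esub> b))"
      using elem_poly_mult[OF assms] elem_poly_mult[OF a(1) b(1)] unfolding a(2) b(2) by (rule dvd_diff)
    then have "unity_poly n dvd (elem_poly (a \<otimes>\<^bsub>FR\<^esub> b) - elem_poly (x \<otimes>\<^bsub>FR\<^esub> y))" by simp
    then have "elem_poly (a \<otimes>\<^bsub>FR\<^esub> b) - elem_poly (x \<otimes>\<^bsub>FR\<^esub> y) = 0"
      by (rule unity_poly_dvd_small) (simp_all add: coeff_elem_poly mult_in assms a b n_pos)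
    then show ?thesis using add_coset_Rel_eq_iff mult_in assms a b by simp
  qed
  then have "(\<Union>a\<in>add_coset Rel x. \<Union>b\<in>add_coset Rel y. add_coset Rel (a \<otimes>\<^bsub>FR\<^esub> b))
      = (\<Union>a\<in>add_coset Rel x. \<Union>b\<in>add_coset Rel y. add_coset Rel (x \<otimes>\<^bsub>FR\<^esub> y))"
    by (intro SUP_cong refl)
  also have "\<dots> = add_coset Rel (x \<otimes>\<^bsub>FR\<^esub> y)"
  proof -
    have "add_coset Rel x \<noteq> {}" "add_coset Rel y \<noteq> {}" using mem_add_coset_self[OF add_subgroup_Rel] by blast+
    then show ?thesis by (simp only: UN_constant if_False)
  qed
  finally show ?thesis
    unfolding FactRing_def rcoset_mult_def a_r_coset_FR by (simp only: ring_record_simps monoid.simps)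
qed

lemma abelian_group_RR: "abelian_group RR"
proof (rule abelian_groupI)
  fix X assume "X \<in> carrier RR"
  then obtain x where x: "x \<in> carrier FR" "X = add_coset Rel x" by (auto simp: carrier_RR)
  have "0 - x \<in> carrier FR" by (intro FR_closed x)
  then show "\<exists>Y\<in>carrier RR. Y \<oplus>\<^bsub>RR\<^esub> X = \<zero>\<^bsub>RR\<^esub>"
    using x by (intro bexI[of _ "add_coset Rel (0 - x)"]) (auto simp: carrier_RR add_RR zero_RR)
qed (auto simp: carrier_RR add_RR zero_RR FR_closed algebra_simps)

definition coset_poly :: "(('k, 'g) urep set \<Rightarrow>\<^sub>0 int) set \<Rightarrow> int poly" where
  "coset_poly X = elem_poly (SOME x. x \<in> X)"

lemma coset_poly_add_coset: "x \<in> carrier FR \<Longrightarrow> coset_poly (add_coset Rel x) = elem_poly x"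
  unfolding coset_poly_def using someI[of "\<lambda>y. y \<in> add_coset Rel x", OF mem_add_coset_self[OF add_subgroup_Rel]]
  by (intro mem_add_coset_Rel[THEN conjunct2])

lemma coset_poly_inj: "X \<in> carrier RR \<Longrightarrow> Y \<in> carrier RR \<Longrightarrow> coset_poly X = coset_poly Y \<Longrightarrow> X = Y"
proof -
  assume "X \<in> carrier RR" "Y \<in> carrier RR" and eq: "coset_poly X = coset_poly Y"
  then obtain x y where x: "x \<in> carrier FR" "X = add_coset Rel x" and y: "y \<in> carrier FR" "Y = add_coset Rel y"
    unfolding carrier_RR by blast
  have "elem_poly x = elem_poly y" using eq unfolding x(2) y(2) coset_poly_add_coset[OF x(1)] coset_poly_add_coset[OF y(1)] .
  then show ?thesis unfolding x(2) y(2) add_coset_Rel_eq_iff[OF x(1) y(1)] .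
qed

lemma coset_poly_add: "X \<in> carrier RR \<Longrightarrow> Y \<in> carrier RR \<Longrightarrow> coset_poly (X \<oplus>\<^bsub>RR\<^esub> Y) = coset_poly X + coset_poly Y"
  by (auto simp: carrier_RR add_RR coset_poly_add_coset FR_closed elem_poly_simps)

lemma coset_poly_zero: "coset_poly \<zero>\<^bsub>RR\<^esub> = 0"
  by (simp add: zero_RR coset_poly_add_coset FR_closed elem_poly_simps)

lemma coset_poly_one: "coset_poly \<one>\<^bsub>RR\<^esub> = 1" and one_RR_in: "\<one>\<^bsub>RR\<^esub> \<in> carrier RR"
  by (auto simp: one_RR coset_poly_add_coset one_in elem_poly_one carrier_RR)

lemma coset_poly_mult:
  assumes "X \<in> carrier RR" "Y \<in> carrier RR"
  shows "unity_poly n dvd (coset_poly X * coset_poly Y - coset_poly (X \<otimes>\<^bsub>RR\<^esub> Y))" "X \<otimes>\<^bsub>RR\<^esub> Y \<in> carrier RR"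
  using assms by (auto simp: carrier_RR mult_RR coset_poly_add_coset mult_in elem_poly_mult)

lemma coeff_coset_poly: "X \<in> carrier RR \<Longrightarrow> k \<ge> n \<Longrightarrow> coeff (coset_poly X) k = 0"
  by (auto simp: carrier_RR coset_poly_add_coset coeff_elem_poly)

lemma coset_poly_surj:
  assumes "\<And>k. k \<ge> n \<Longrightarrow> coeff p k = 0"
  obtains X where "X \<in> carrier RR" "coset_poly X = p"
proof (rule that)
  show "add_coset Rel (poly_elem p) \<in> carrier RR" by (simp add: carrier_RR poly_elem_in)
  show "coset_poly (add_coset Rel (poly_elem p)) = p" using elem_poly_poly_elem[OF assms] by (simp add: coset_poly_add_coset poly_elem_in)
qed

lemma coset_poly_finsum:
  assumes "\<And>i. i \<in> A \<Longrightarrow> X i \<in> carrier RR"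
  shows "coset_poly (\<Oplus>\<^bsub>RR\<^esub>i\<in>A. X i) = (\<Sum>i\<in>A. coset_poly (X i))"
proof -
  interpret RR: abelian_group RR by (rule abelian_group_RR)
  show ?thesis using assms
    by (induction A rule: infinite_finite_induct) (simp_all add: coset_poly_zero coset_poly_add Pi_def RR.finsum_closed)
qed

end

subsection \<open>The ideal of induced representations\<close>

text \<open>The first isomorphism theorem with R only an additive group carrying a multiplication
  and a unit that h respects. The ring laws of the representation ring, such as associativity of
  tensor products, thus need no separate verification; the quotient receives them from S.\<close>

lemma quot_kernel_iso:
  assumes R: "abelian_group R" and S: "ring S"
    and h_in: "\<And>x. x \<in> carrier R \<Longrightarrow> h x \<in> carrier S"
    and h_add: "\<And>x y. x \<in> carrier R \<Longrightarrow> y \<in> carrier R \<Longrightarrow> h (x \<oplus>\<^bsub>R\<^esub> y) = h x \<oplus>\<^bsub>S\<^esub> h y"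
    and m_in: "\<And>x y. x \<in> carrier R \<Longrightarrow> y \<in> carrier R \<Longrightarrow> x \<otimes>\<^bsub>R\<^esub> y \<in> carrier R"
    and h_mult: "\<And>x y. x \<in> carrier R \<Longrightarrow> y \<in> carrier R \<Longrightarrow> h (x \<otimes>\<^bsub>R\<^esub> y) = h x \<otimes>\<^bsub>S\<^esub> h y"
    and one_in: "\<one>\<^bsub>R\<^esub> \<in> carrier R" and h_one: "h \<one>\<^bsub>R\<^esub> = \<one>\<^bsub>S\<^esub>"
    and surj: "h ` carrier R = carrier S"
  shows "R Quot {x \<in> carrier R. h x = \<zero>\<^bsub>S\<^esub>} \<simeq> S"
proof -
  interpret R: abelian_group R by (rule R)
  interpret S: ring S by (rule S)
  interpret H: group_hom "add_monoid R" "add_monoid S" h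
    by (intro group_hom.intro group_hom_axioms.intro R.a_group S.a_group) (auto simp: hom_def h_in h_add)
  define I where "I = {x \<in> carrier R. h x = \<zero>\<^bsub>S\<^esub>}"
  have ker: "kernel (add_monoid R) (add_monoid S) h = I" by (simp add: kernel_def I_def)
  let ?f = "\<lambda>X. the_elem (h ` X)"
  \<comment> \<open>The additive part is the isomorphism theorem for groups; the factor ring has the
    same carrier and addition as the factor group.\<close>
  have iso: "?f \<in> iso (add_monoid R Mod I) (add_monoid S)"
    using H.FactGroup_iso_set surj unfolding ker by simp
  have car: "carrier (R Quot I) = carrier (add_monoid R Mod I)"
    by (simp add: FactRing_def A_RCOSETS_def FactGroup_def)
  have bij: "bij_betw ?f (carrier (R Quot I)) (carrier S)"
    using iso unfolding car by (simp add: iso_def)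
  have add: "?f (X \<oplus>\<^bsub>R Quot I\<^esub> Y) = ?f X \<oplus>\<^bsub>S\<^esub> ?f Y"
    if "X \<in> carrier (R Quot I)" "Y \<in> carrier (R Quot I)" for X Y
    using iso that unfolding car
    by (auto simp: iso_def hom_def FactRing_def FactGroup_def set_add_def)
  have coset: "I +>\<^bsub>R\<^esub> a \<subseteq> carrier R \<and> a \<in> I +>\<^bsub>R\<^esub> a \<and> (\<forall>x\<in>I +>\<^bsub>R\<^esub> a. h x = h a)" if a: "a \<in> carrier R" for a
  proof -
    have "\<zero>\<^bsub>R\<^esub> \<in> I" using H.hom_one by (simp add: I_def)
    then have "a \<in> I +>\<^bsub>R\<^esub> a" using a unfolding a_r_coset_def' by force
    moreover have "I +>\<^bsub>R\<^esub> a \<subseteq> carrier R" using a by (auto simp: a_r_coset_def' I_def)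
    moreover have "h x = h a" if "x \<in> I +>\<^bsub>R\<^esub> a" for x
      using that a h_in by (auto simp: a_r_coset_def' I_def h_add)
    ultimately show ?thesis by blast
  qed
  have f_coset: "?f (I +>\<^bsub>R\<^esub> a) = h a" if "a \<in> carrier R" for a
  proof -
    have "h ` (I +>\<^bsub>R\<^esub> a) = {h a}" using coset[OF that] by blast
    then show ?thesis by simp
  qed
  have carE: "\<exists>a\<in>carrier R. X = I +>\<^bsub>R\<^esub> a" if "X \<in> carrier (R Quot I)" for X
    using that by (auto simp: FactRing_def A_RCOSETS_def RCOSETS_def a_r_coset_def)
  have mult: "?f (X \<otimes>\<^bsub>R Quot I\<^esub> Y) = ?f X \<otimes>\<^bsub>S\<^esub> ?f Y"
    if X: "X \<in> carrier (R Quot I)" and Y: "Y \<in> carrier (R Quot I)" for X Y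
  proof -
    obtain a b where a: "a \<in> carrier R" "X = I +>\<^bsub>R\<^esub> a" and b: "b \<in> carrier R" "Y = I +>\<^bsub>R\<^esub> b"
      using carE[OF X] carE[OF Y] by blast
    have "h ` (\<Union>x\<in>X. \<Union>y\<in>Y. I +>\<^bsub>R\<^esub> (x \<otimes>\<^bsub>R\<^esub> y)) = {h a \<otimes>\<^bsub>S\<^esub> h b}"
    proof (intro equalityI subsetI)
      fix z assume "z \<in> h ` (\<Union>x\<in>X. \<Union>y\<in>Y. I +>\<^bsub>R\<^esub> (x \<otimes>\<^bsub>R\<^esub> y))"
      then obtain x y w where xyw: "x \<in> X" "y \<in> Y" "w \<in> I +>\<^bsub>R\<^esub> (x \<otimes>\<^bsub>R\<^esub> y)" "z = h w" by blast
      have x: "x \<in> carrier R" "h x = h a"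
        using coset[OF a(1)] xyw(1)[unfolded a(2)] by blast+
      have y: "y \<in> carrier R" "h y = h b"
        using coset[OF b(1)] xyw(2)[unfolded b(2)] by blast+
      have "h w = h (x \<otimes>\<^bsub>R\<^esub> y)" using coset[OF m_in[OF x(1) y(1)]] xyw(3) by blast
      then have "z = h x \<otimes>\<^bsub>S\<^esub> h y" unfolding xyw(4) h_mult[OF x(1) y(1)] .
      then show "z \<in> {h a \<otimes>\<^bsub>S\<^esub> h b}" using x y by simp
    next
      fix z assume "z \<in> {h a \<otimes>\<^bsub>S\<^esub> h b}"
      then have "z = h (a \<otimes>\<^bsub>R\<^esub> b)" using a b h_mult by simp
      moreover have "a \<in> X" "b \<in> Y" "a \<otimes>\<^bsub>R\<^esub> b \<in> I +>\<^bsub>R\<^esub> (a \<otimes>\<^bsub>R\<^esub> b)"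
        unfolding a(2) b(2) using coset[OF a(1)] coset[OF b(1)] coset[OF m_in[OF a(1) b(1)]] by blast+
      ultimately show "z \<in> h ` (\<Union>x\<in>X. \<Union>y\<in>Y. I +>\<^bsub>R\<^esub> (x \<otimes>\<^bsub>R\<^esub> y))" by blast
    qed
    then show ?thesis
      unfolding a(2) b(2) f_coset[OF a(1)] f_coset[OF b(1)] by (simp add: FactRing_def rcoset_mult_def)
  qed
  have "?f \<one>\<^bsub>R Quot I\<^esub> = \<one>\<^bsub>S\<^esub>" using f_coset[OF one_in] h_one by (simp add: FactRing_def)
  then have "?f \<in> ring_iso (R Quot I) S"
    unfolding ring_iso_def ring_hom_def using bij add mult bij_betwE[OF bij] by auto
  then show ?thesis unfolding is_ring_iso_def I_def by blast
qed

context cyclic_sub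
begin

text \<open>The quotient of X^n - 1 by X^m - 1, which is also the weight polynomial of the
  representation induced from the trivial representation of H.\<close>

definition geo :: "int poly" where
  "geo = (\<Sum>t<d. monom 1 (m * t))"

lemma unity_poly_geo: "unity_poly n = unity_poly m * geo"
  unfolding geo_def nmd by (rule unity_poly_mult_geometric)

definition ind_elem :: "(('k, 'g) urep set \<Rightarrow>\<^sub>0 int) \<Rightarrow> (('k, 'g) urep set \<Rightarrow>\<^sub>0 int)" where
  "ind_elem = frag_extend (\<lambda>c. frag_of (iso_class G (induced_rep G H (class_rep c))))"

lemma induced_class:
  fixes c :: "('k, 'g) urep set"
  assumes "c \<in> iso_classes GH"
  shows "good (induced_rep G H (class_rep c))" "rep_poly (induced_rep G H (class_rep c)) = geo * HS.class_poly c"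
proof -
  have fd: "class_rep c \<in> fd_reps GH" by (rule HS.class_rep(1)[OF assms])
  obtain I :: "nat set" and e where I: "HS.weights (class_rep c) I e" "HS.rep_poly (class_rep c) = weight_poly I e"
    by (rule HS.goodE[OF HS.good_fd[OF fd]])
  have d: "weights (induced_rep G H (class_rep c)) (ind_set I e) snd"
    using fd I(1) by (intro weights_induced) (simp_all add: fd_reps_def)
  show "good (induced_rep G H (class_rep c))" by (rule goodI[OF d])
  show "rep_poly (induced_rep G H (class_rep c)) = geo * HS.class_poly c"
    using I(1) unfolding rep_poly_eq[OF d] HS.class_poly_def I(2) geo_def
    by (subst weight_poly_induced) (auto simp: HS.weights_def mult.commute)
qed

lemma ind_elem_in: "x \<in> carrier HS.FR \<Longrightarrow> ind_elem x \<in> carrier FR"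
  unfolding free_rep_ring_simps ind_elem_def
  by (intro CollectI keys_frag_extend_subset) (auto simp: iso_class_in induced_class subset_iff)

lemma elem_poly_ind_elem: "x \<in> carrier HS.FR \<Longrightarrow> elem_poly (ind_elem x) = geo * HS.elem_poly x"
  unfolding elem_poly_def ind_elem_def int_lin_frag_extend HS.elem_poly_def int_lin_mult[symmetric] free_rep_ring_simps
  by (intro int_lin_cong) (auto simp: class_poly_iso_class induced_class subset_iff)

lemma induction_add_coset:
  assumes "x \<in> carrier HS.FR"
  shows "induction (K :: 'k itself) G H (add_coset HS.Rel x) = add_coset Rel (ind_elem x)"
proof -
  have "ind_elem t \<in> Rel" if "t \<in> HS.Rel" for t
    using Rel_iff[OF ind_elem_in[OF HS.Rel_carrier[OF that]]] elem_poly_ind_elem[OF HS.Rel_carrier[OF that]] HS.elem_poly_Rel[OF that]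
    by simp
  then show ?thesis
    unfolding induction_def ind_elem_def[symmetric]
    by (intro coset_lift_add_coset add_subgroup_Rel HS.add_subgroup_Rel)
      (simp_all add: free_rep_ring_simps(2) ind_elem_def frag_extend_add)
qed

text \<open>The factor \<open>geo\<close> has degree n - m, so its product with a polynomial of
  degree below m is already reduced modulo X^n - 1. This is why the image is described by an
  equality of polynomials and not by a congruence.\<close>

lemma induction_image_eq:
  "induction_image (K :: 'k itself) G H =
    {X \<in> carrier RR. \<exists>q. (\<forall>k\<ge>m. coeff q k = 0) \<and> coset_poly X = geo * q}"
proof (intro equalityI subsetI)
  fix X assume "X \<in> induction_image (K :: 'k itself) G H"
  then obtain x where x: "x \<in> carrier HS.FR" "X = add_coset Rel (ind_elem x)"
    unfolding induction_image_def rep_ring_def HS.carrier_RR using induction_add_coset by auto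
  then have "coset_poly X = geo * HS.elem_poly x" "X \<in> carrier RR"
    by (simp_all add: coset_poly_add_coset ind_elem_in elem_poly_ind_elem carrier_RR)
  then show "X \<in> {X \<in> carrier RR. \<exists>q. (\<forall>k\<ge>m. coeff q k = 0) \<and> coset_poly X = geo * q}"
    using HS.coeff_elem_poly[OF x(1)] by blast
next
  fix X assume "X \<in> {X \<in> carrier RR. \<exists>q. (\<forall>k\<ge>m. coeff q k = 0) \<and> coset_poly X = geo * q}"
  then obtain q where X: "X \<in> carrier RR" and q: "\<And>k. k \<ge> m \<Longrightarrow> coeff q k = 0" "coset_poly X = geo * q" by blast
  have "coset_poly (add_coset Rel (ind_elem (HS.poly_elem q))) = geo * q"
    by (simp add: coset_poly_add_coset ind_elem_in HS.poly_elem_in elem_poly_ind_elem HS.elem_poly_poly_elem[OF q(1)])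
  then have "X = add_coset Rel (ind_elem (HS.poly_elem q))"
    using q(2) by (intro coset_poly_inj X) (auto simp: carrier_RR ind_elem_in HS.poly_elem_in)
  then show "X \<in> induction_image (K :: 'k itself) G H"
    unfolding induction_image_def rep_ring_def HS.carrier_RR
    using induction_add_coset[OF HS.poly_elem_in] HS.poly_elem_in by (metis imageI)
qed

lemma card_H: "card H = m"
proof -
  have "inj_on (\<lambda>b. g [^] (d * b)) {..<m}"
  proof (rule inj_onI)
    fix a b assume "a \<in> {..<m}" "b \<in> {..<m}" "g [^] (d * a) = g [^] (d * b)"
    then show "a = b"
      using md_pos by (simp add: pow_eq_iff nmd mult.commute[of m] mod_mult_mult1)
  qed
  then show ?thesis unfolding H by (simp add: card_image)
qed

end

context cyclic_rooted
begin

section \<open>The subgroups of G, and the ideal generated by their factors\<close>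

lemma order_eq: "order G = n"
  unfolding order_def carrier_eq by (subst card_image) (auto intro!: inj_onI simp: pow_eq_iff)

text \<open>By Lagrange an element \<open>g [^] a\<close> of H has trivial m-th power, where m is
  the order of H. Hence n divides a m and the index divides a. This bounds H by a set of at most m
  elements.\<close>

lemma subgroup_cyclic_sub:
  assumes "subgroup H G"
  shows "cyclic_sub G g n \<zeta> (card H) (n div card H) H"
proof -
  let ?m = "card H" and ?d = "n div card H"
  have HG: "H \<subseteq> carrier G" using subgroup.subset[OF assms] .
  have m: "?m dvd n" using lagrange[OF assms] unfolding order_eq by (metis dvd_triv_right)
  then have nmd: "n = ?m * ?d" by simp
  then have pos: "?m > 0" "?d > 0" using n_pos by (metis gr0I mult_is_0)+
  interpret GH: group "G\<lparr>carrier := H\<rparr>" by (rule subgroup.subgroup_is_group[OF assms is_group])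
  have "H \<subseteq> (\<lambda>b. g [^] (?d * b)) ` {..<?m}"
  proof
    fix x assume x: "x \<in> H"
    have "x [^] ?m = \<one>"
      using GH.pow_order_eq_1[of x] x nat_pow_consistent[of x "?m" H] by (simp add: order_def)
    moreover obtain a where a: "a < n" "x = g [^] a"
      using x HG unfolding carrier_eq by blast
    ultimately have "g [^] (a * ?m) = g [^] (0::nat)" by (simp add: nat_pow_pow)
    then have "?m * ?d dvd ?m * a" unfolding pow_eq_iff nmd[symmetric] by (simp add: mod_eq_0_iff_dvd mult.commute)
    then have "?d dvd a" using pos by simp
    then obtain b where b: "a = ?d * b" by blast
    have "?d * b < ?d * ?m" using a(1) b nmd by (simp only: mult.commute)
    then have "b < ?m" by simp
    then show "x \<in> (\<lambda>b. g [^] (?d * b)) ` {..<?m}" using a b by blast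
  qed
  moreover have "card ((\<lambda>b. g [^] (?d * b)) ` {..<?m}) \<le> card H"
    using card_image_le[of "{..<?m}"] by simp
  ultimately have "H = (\<lambda>b. g [^] (?d * b)) ` {..<?m}"
    by (intro card_seteq) auto
  with nmd show ?thesis by unfold_locales
qed

lemma proper_subgroup:
  assumes "H \<in> proper_subgroups G"
  shows "cyclic_sub G g n \<zeta> (card H) (n div card H) H" "card H < n"
proof -
  have H: "subgroup H G" "H \<noteq> carrier G" using assms by (auto simp: proper_subgroups_def)
  show "cyclic_sub G g n \<zeta> (card H) (n div card H) H" by (rule subgroup_cyclic_sub[OF H(1)])
  have "H \<subset> carrier G" using H subgroup.subset by blast
  then have "card H < card (carrier G)" by (rule psubset_card_mono[OF finite_G])
  then show "card H < n" using order_eq by (simp add: order_def)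
qed

lemma prime_subgroup:
  assumes "prime p" "p dvd n"
  obtains H where "H \<in> proper_subgroups G" "card H = n div p" "n div card H = p"
proof -
  define H where "H = (\<lambda>b. g [^] (p * b)) ` {..<n div p}"
  interpret C: cyclic_sub G g n \<zeta> "n div p" p H
    by unfold_locales (use assms in \<open>simp_all add: H_def\<close>)
  have np: "n div p < n" using assms n_pos prime_gt_1_nat by simp
  have "H \<noteq> carrier G"
    using np C.card_H order_eq by (auto simp: order_def)
  then show thesis
    using that[of H] C.subgroup_H C.card_H assms n_pos C.md_pos by (auto simp: proper_subgroups_def)
qed

lemma finite_proper_subgroups: "finite (proper_subgroups G)"
  by (rule finite_subset[of _ "Pow (carrier G)"])
    (auto simp: proper_subgroups_def finite_G dest: subgroup.subset)

text \<open>\<open>cyclotomic_in_ideal\<close> is applied to the ideal \<open>J\<close> generated by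
  X^n - 1 and the factors of all proper subgroups; the generator demanded for a prime p comes from
  the subgroup of index p. For the trivial group the sum is empty and \<open>J\<close> consists of
  the multiples of X - 1.\<close>

lemma cyclotomic_combination:
  obtains q where "unity_poly n dvd (cyclotomic n - (\<Sum>H\<in>proper_subgroups G. cyclic_sub.geo (card H) (n div card H) * q H))"
proof -
  let ?g = "\<lambda>H. cyclic_sub.geo (card H) (n div card H)"
  define J where "J = {p. \<exists>q. unity_poly n dvd (p - (\<Sum>H\<in>proper_subgroups G. ?g H * q H))}"
  have "cyclotomic n \<in> J"
  proof (rule cyclotomic_in_ideal[OF n_pos])
    fix a b assume "a \<in> J" "b \<in> J"
    then obtain q r where "unity_poly n dvd (a - (\<Sum>H\<in>proper_subgroups G. ?g H * q H))"
      "unity_poly n dvd (b - (\<Sum>H\<in>proper_subgroups G. ?g H * r H))" by (auto simp: J_def)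
    from dvd_add[OF this] have "unity_poly n dvd (a + b - (\<Sum>H\<in>proper_subgroups G. ?g H * (q H + r H)))"
      by (simp add: algebra_simps sum.distrib)
    then show "a + b \<in> J" unfolding J_def by (intro CollectI exI[of _ "\<lambda>H. q H + r H"])
  next
    fix a b assume "b \<in> J"
    then obtain q where "unity_poly n dvd (b - (\<Sum>H\<in>proper_subgroups G. ?g H * q H))" by (auto simp: J_def)
    from dvd_mult[OF this, of a] have "unity_poly n dvd (a * b - (\<Sum>H\<in>proper_subgroups G. ?g H * (a * q H)))"
      by (simp add: algebra_simps sum_distrib_left)
    then show "a * b \<in> J" unfolding J_def by (intro CollectI exI[of _ "\<lambda>H. a * q H"])
  next
    have "unity_poly n dvd (unity_poly n - (\<Sum>H\<in>proper_subgroups G. ?g H * 0))" by simp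
    then show "unity_poly n \<in> J" unfolding J_def by (intro CollectI exI[of _ "\<lambda>H. 0"])
  next
    fix p assume p: "prime p" "p dvd n"
    obtain H0 where H0: "H0 \<in> proper_subgroups G" "card H0 = n div p" "n div card H0 = p"
      by (rule prime_subgroup[OF p])
    have "(\<Sum>H\<in>proper_subgroups G. ?g H * (if H = H0 then 1 else 0)) = ?g H0"
      using H0(1) finite_proper_subgroups by (simp add: if_distrib[of "\<lambda>x. _ * x"] cong: if_cong)
    also have "\<dots> = (\<Sum>i<p. monom 1 (n div p * i))"
      unfolding cyclic_sub.geo_def[OF proper_subgroup(1)[OF H0(1)]] unfolding H0(3) unfolding H0(2) ..
    finally have "unity_poly n dvd ((\<Sum>i<p. monom 1 (n div p * i))
        - (\<Sum>H\<in>proper_subgroups G. ?g H * (if H = H0 then 1 else 0)))" by simp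
    then show "(\<Sum>i<p. monom 1 (n div p * i)) \<in> J"
      unfolding J_def by (intro CollectI exI[of _ "\<lambda>H. if H = H0 then 1 else 0"])
  qed
  then show thesis using that by (auto simp: J_def)
qed

text \<open>Every factor of a proper subgroup is divisible by the n-th cyclotomic polynomial, which
  gives one inclusion. Conversely, a multiple of it is, modulo X^n - 1, a combination of these
  factors by \<open>cyclotomic_combination\<close>, and each coefficient can be reduced until its
  term is the polynomial of an induced class.\<close>

lemma sum_ideals_eq:
  "sum_ideals RR (proper_subgroups G) (induction_image (K :: 'k itself) G)
    = {X \<in> carrier RR. cyclotomic n dvd coset_poly X}"
proof (intro equalityI subsetI)
  interpret RR: abelian_group RR by (rule abelian_group_RR)
  fix X assume "X \<in> sum_ideals RR (proper_subgroups G) (induction_image K G)"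
  then obtain x where x: "X = (\<Oplus>\<^bsub>RR\<^esub>H\<in>proper_subgroups G. x H)"
    "\<And>H. H \<in> proper_subgroups G \<Longrightarrow> x H \<in> induction_image K G H" by (auto simp: sum_ideals_def)
  have xH: "x H \<in> carrier RR \<and> cyclotomic n dvd coset_poly (x H)" if H: "H \<in> proper_subgroups G" for H
  proof -
    interpret C: cyclic_sub G g n \<zeta> "card H" "n div card H" H by (rule proper_subgroup(1)[OF H])
    have "cyclotomic n dvd C.geo"
      unfolding C.geo_def by (rule cyclotomic_dvd_geometric[OF C.nmd n_pos proper_subgroup(2)[OF H]])
    then show ?thesis using x(2)[OF H] unfolding C.induction_image_eq by auto
  qed
  then have "cyclotomic n dvd coset_poly X"
    unfolding x(1) by (subst coset_poly_finsum) (auto intro: dvd_sum)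
  moreover have "X \<in> carrier RR" unfolding x(1) using xH by (intro RR.finsum_closed) auto
  ultimately show "X \<in> {X \<in> carrier RR. cyclotomic n dvd coset_poly X}" by simp
next
  interpret RR: abelian_group RR by (rule abelian_group_RR)
  let ?PS = "proper_subgroups G"
  let ?g = "\<lambda>H. cyclic_sub.geo (card H) (n div card H)"
  fix X assume "X \<in> {X \<in> carrier RR. cyclotomic n dvd coset_poly X}"
  then obtain s where X: "X \<in> carrier RR" and s: "coset_poly X = cyclotomic n * s" by blast
  obtain q where q: "unity_poly n dvd (cyclotomic n - (\<Sum>H\<in>?PS. ?g H * q H))" by (rule cyclotomic_combination)
  \<comment> \<open>Coefficients may be reduced modulo X^m - 1, with m the order of H: the discarded
    multiple becomes a multiple of X^n - 1 once it is multiplied by the factor of H.\<close>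
  have "\<exists>r t. q H * s = unity_poly (card H) * t + r \<and> (\<forall>k\<ge>card H. coeff r k = 0)" if H: "H \<in> ?PS" for H
  proof -
    interpret C: cyclic_sub G g n \<zeta> "card H" "n div card H" H by (rule proper_subgroup(1)[OF H])
    obtain t r where "q H * s = unity_poly (card H) * t + r" "r = 0 \<or> degree r < degree (unity_poly (card H) :: int poly)"
      by (rule monic_divE[OF lead_coeff_unity_poly[OF C.md_pos(1), where 'a=int]])
    then show ?thesis
      using degree_unity_poly[OF C.md_pos(1), where 'a=int] by (metis coeff_0 coeff_eq_0 order_less_le_trans)
  qed
  then obtain r t where rt: "\<And>H. H \<in> ?PS \<Longrightarrow> q H * s = unity_poly (card H) * t H + r H"
    "\<And>H k. H \<in> ?PS \<Longrightarrow> k \<ge> card H \<Longrightarrow> coeff (r H) k = 0" by metis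
  have step: "(\<exists>Y. Y \<in> induction_image K G H \<and> Y \<in> carrier RR \<and> coset_poly Y = ?g H * r H)
      \<and> unity_poly n dvd (?g H * q H * s - ?g H * r H)" if H: "H \<in> ?PS" for H
  proof -
    interpret C: cyclic_sub G g n \<zeta> "card H" "n div card H" H by (rule proper_subgroup(1)[OF H])
    \<comment> \<open>Only a polynomial of degree below n is the value of \<open>coset_poly\<close>
      at some class. Here the degree is at most n - m plus that of \<open>r H\<close>, which is
      below m, where m is the order of H.\<close>
    have "coeff (C.geo * r H) k = 0" if "k \<ge> n" for k
    proof (cases "r H = 0")
      case False
      then have "degree (r H) < card H"
        using rt(2)[OF H, of "degree (r H)"] by (metis leading_coeff_0_iff not_le)
      moreover have "degree C.geo \<le> n - card H"
        unfolding C.geo_def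
      proof (rule degree_sum_le)
        fix i assume "i \<in> {..<n div card H}"
        then have "card H * Suc i \<le> card H * (n div card H)" by (intro mult_le_mono2) simp
        also have "\<dots> = n" by (rule C.nmd[symmetric])
        finally show "degree (monom (1::int) (card H * i)) \<le> n - card H"
          by (simp add: degree_monom_eq)
      qed simp
      ultimately have "degree (C.geo * r H) < n"
        using degree_mult_le[of C.geo "r H"] proper_subgroup(2)[OF H] by linarith
      then show ?thesis using that by (intro coeff_eq_0) simp
    qed simp
    then obtain Y where Y: "Y \<in> carrier RR" "coset_poly Y = C.geo * r H" by (rule coset_poly_surj)
    then have "Y \<in> induction_image K G H"
      unfolding C.induction_image_eq using rt(2)[OF H] by blast
    moreover have "C.geo * q H * s - C.geo * r H = unity_poly n * t H"
    proof -
      have "C.geo * q H * s - C.geo * r H = C.geo * (q H * s - r H)" by (simp only: algebra_simps)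
      also have "q H * s - r H = unity_poly (card H) * t H" using rt(1)[OF H] by simp
      also have "C.geo * (unity_poly (card H) * t H) = unity_poly n * t H" unfolding C.unity_poly_geo by (simp only: ac_simps)
      finally show ?thesis .
    qed
    ultimately show ?thesis using Y by auto
  qed
  then obtain Y where Y: "\<And>H. H \<in> ?PS \<Longrightarrow> Y H \<in> induction_image K G H"
    "\<And>H. H \<in> ?PS \<Longrightarrow> Y H \<in> carrier RR" "\<And>H. H \<in> ?PS \<Longrightarrow> coset_poly (Y H) = ?g H * r H" by metis
  let ?Z = "\<Oplus>\<^bsub>RR\<^esub>H\<in>?PS. Y H"
  have Z: "?Z \<in> carrier RR" using Y(2) by (intro RR.finsum_closed) auto
  have PZ: "coset_poly ?Z = (\<Sum>H\<in>?PS. ?g H * r H)" using Y by (subst coset_poly_finsum) auto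
  have "unity_poly n dvd ((cyclotomic n - (\<Sum>H\<in>?PS. ?g H * q H)) * s + (\<Sum>H\<in>?PS. ?g H * q H * s - ?g H * r H))"
    using q step by (intro dvd_add dvd_mult2 dvd_sum) auto
  also have "(cyclotomic n - (\<Sum>H\<in>?PS. ?g H * q H)) * s + (\<Sum>H\<in>?PS. ?g H * q H * s - ?g H * r H) = coset_poly X - coset_poly ?Z"
    unfolding s PZ by (simp add: algebra_simps sum_distrib_left sum_subtractf)
  finally have "coset_poly X - coset_poly ?Z = 0"
    by (rule unity_poly_dvd_small) (simp_all add: coeff_coset_poly X Z n_pos)
  then have "X = ?Z" by (intro coset_poly_inj X Z) simp
  then show "X \<in> sum_ideals RR ?PS (induction_image K G)"
    unfolding sum_ideals_def using Y(1) by blast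
qed

text \<open>\<open>coset_poly\<close> respects products only modulo X^n - 1, but the n-th cyclotomic
  polynomial divides X^n - 1, so after projection it is a homomorphism. Its kernel has been
  identified in \<open>sum_ideals_eq\<close>.\<close>

lemma rep_ring_quotient_iso:
  "rep_ring (K :: 'k itself) G Quot sum_ideals (rep_ring K G) (proper_subgroups G) (induction_image K G)
    \<simeq> (type_ring :: int poly ring) Quot (PIdl\<^bsub>type_ring\<^esub> (cyclotomic n))"
proof -
  let ?Z = "type_ring :: int poly ring"
  let ?I = "PIdl\<^bsub>?Z\<^esub> (cyclotomic n)"
  interpret Z: cring ?Z by (rule cring_type_ring)
  interpret I: ideal ?I ?Z by (rule Z.cgenideal_ideal) simp
  let ?\<pi> = "\<lambda>p. ?I +>\<^bsub>?Z\<^esub> p"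
  have I_iff: "p \<in> ?I \<longleftrightarrow> cyclotomic n dvd p" for p
    by (auto simp: cgenideal_def dvd_def mult.commute)
  have minus: "\<ominus>\<^bsub>?Z\<^esub> q = - q" for q by (rule Z.minus_equality) simp_all
  have \<pi>_eq: "?\<pi> p = ?\<pi> q \<longleftrightarrow> cyclotomic n dvd (p - q)" for p q
    using Z.quotient_eq_iff_same_a_r_cos[OF I.is_ideal, of p q]
    by (simp add: I_iff a_minus_def minus)
  have \<pi>_hom: "?\<pi> \<in> ring_hom ?Z (?Z Quot ?I)" by (rule I.rcos_ring_hom)
  have \<pi>_add: "?\<pi> (p + q) = ?\<pi> p \<oplus>\<^bsub>?Z Quot ?I\<^esub> ?\<pi> q" and \<pi>_mult: "?\<pi> (p * q) = ?\<pi> p \<otimes>\<^bsub>?Z Quot ?I\<^esub> ?\<pi> q"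
    for p q using ring_hom_add[OF \<pi>_hom, of p q] ring_hom_mult[OF \<pi>_hom, of p q] by simp_all
  have \<pi>_one: "?\<pi> 1 = \<one>\<^bsub>?Z Quot ?I\<^esub>" using ring_hom_one[OF \<pi>_hom] by simp
  have \<pi>_zero: "?\<pi> 0 = \<zero>\<^bsub>?Z Quot ?I\<^esub>"
    using ring_hom_zero[OF \<pi>_hom Z.ring_axioms I.quotient_is_ring] by simp
  have \<pi>_in: "?\<pi> p \<in> carrier (?Z Quot ?I)" for p using ring_hom_closed[OF \<pi>_hom, of p] by simp
  have "RR Quot {X \<in> carrier RR. ?\<pi> (coset_poly X) = \<zero>\<^bsub>?Z Quot ?I\<^esub>} \<simeq> ?Z Quot ?I"
  proof (rule quot_kernel_iso[OF abelian_group_RR I.quotient_is_ring])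
    fix X Y assume XY: "X \<in> carrier RR" "Y \<in> carrier RR"
    show "?\<pi> (coset_poly (X \<oplus>\<^bsub>RR\<^esub> Y)) = ?\<pi> (coset_poly X) \<oplus>\<^bsub>?Z Quot ?I\<^esub> ?\<pi> (coset_poly Y)"
      by (simp add: coset_poly_add XY \<pi>_add)
    show "X \<otimes>\<^bsub>RR\<^esub> Y \<in> carrier RR" by (rule coset_poly_mult(2)[OF XY])
    have "cyclotomic n dvd (coset_poly X * coset_poly Y - coset_poly (X \<otimes>\<^bsub>RR\<^esub> Y))"
      using cyclotomic_dvd_unity_poly[OF n_pos] coset_poly_mult(1)[OF XY] by (rule dvd_trans)
    then show "?\<pi> (coset_poly (X \<otimes>\<^bsub>RR\<^esub> Y)) = ?\<pi> (coset_poly X) \<otimes>\<^bsub>?Z Quot ?I\<^esub> ?\<pi> (coset_poly Y)"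
      unfolding \<pi>_mult[symmetric] using \<pi>_eq by metis
  next
    show "(\<lambda>X. ?\<pi> (coset_poly X)) ` carrier RR = carrier (?Z Quot ?I)"
    proof (intro equalityI subsetI)
      fix A assume "A \<in> carrier (?Z Quot ?I)"
      then obtain p where p: "A = ?\<pi> p" by (auto simp: FactRing_def A_RCOSETS_def RCOSETS_def a_r_coset_def)
      \<comment> \<open>Subtracting a multiple of X^n - 1 does not change the class of p and brings
        the degree into the range of \<open>coset_poly\<close>.\<close>
      obtain q r where qr: "p = unity_poly n * q + r" "r = 0 \<or> degree r < degree (unity_poly n :: int poly)"
        by (rule monic_divE[OF lead_coeff_unity_poly[OF n_pos, where 'a=int]])
      then have "coeff r k = 0" if "k \<ge> n" for k
        using that degree_unity_poly[OF n_pos, where 'a=int] by (auto intro: coeff_eq_0)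
      then obtain X where X: "X \<in> carrier RR" "coset_poly X = r" by (rule coset_poly_surj)
      have "cyclotomic n dvd (p - r)" unfolding qr(1) using cyclotomic_dvd_unity_poly[OF n_pos] by simp
      then have "A = ?\<pi> (coset_poly X)" unfolding p X(2) using \<pi>_eq by blast
      then show "A \<in> (\<lambda>X. ?\<pi> (coset_poly X)) ` carrier RR" using X(1) by blast
    qed (auto simp: \<pi>_in)
  qed (simp_all add: \<pi>_in one_RR_in coset_poly_one \<pi>_one)
  moreover have "{X \<in> carrier RR. ?\<pi> (coset_poly X) = \<zero>\<^bsub>?Z Quot ?I\<^esub>}
      = sum_ideals RR (proper_subgroups G) (induction_image K G)"
    unfolding sum_ideals_eq \<pi>_zero[symmetric] \<pi>_eq by simp
  ultimately show ?thesis unfolding rep_ring_def by simp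
qed

end

theorem theorem1p1:
  fixes K :: "'k::{alg_closed_field, field_char_0} itself"
    and G :: "('g, 'b) monoid_scheme"
    and n :: nat
  assumes "group G" and "cyclic_group G" and "finite (carrier G)" and "order G = n"
  shows "rep_ring K G Quot sum_ideals (rep_ring K G) (proper_subgroups G) (induction_image K G)
    \<simeq> (type_ring :: int poly ring) Quot (PIdl\<^bsub>type_ring\<^esub> (cyclotomic n))"
proof -
  interpret group G by fact
  obtain g where g: "g \<in> carrier G" and car: "carrier G = range (\<lambda>k::int. g [^]\<^bsub>G\<^esub> k)"
    using assms(2) unfolding cyclic_group by blast
  have n_pos: "n > 0" using assms(3,4) order_gt_0_iff_finite by blast
  have "generate G {g} = carrier G" unfolding car generate_pow[OF g] by blast
  then have ord: "ord g = n" using generate_pow_card[OF g] assms(4) by (simp add: order_def)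
  obtain z :: 'k where z: "\<And>m. z ^ m = 1 \<longleftrightarrow> n dvd m" using primitive_root_exists[OF n_pos] by blast
  have pow_eq: "g [^]\<^bsub>G\<^esub> a = g [^]\<^bsub>G\<^esub> b \<longleftrightarrow> a mod n = b mod n" for a b :: nat
  proof -
    have "g [^]\<^bsub>G\<^esub> a = g [^]\<^bsub>G\<^esub> b \<longleftrightarrow> int n dvd int b - int a"
      using int_pow_eq[OF g, of "int a" "int b"] by (simp add: int_pow_int ord)
    also have "\<dots> \<longleftrightarrow> int b mod int n = int a mod int n" by (rule mod_eq_dvd_iff[symmetric])
    also have "\<dots> \<longleftrightarrow> a mod n = b mod n" by (auto simp flip: zmod_int)
    finally show ?thesis .
  qed
  have inj: "inj_on (\<lambda>a::nat. g [^]\<^bsub>G\<^esub> a) {..<n}" by (rule inj_onI) (simp add: pow_eq)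
  have "(\<lambda>a::nat. g [^]\<^bsub>G\<^esub> a) ` {..<n} = carrier G"
    by (rule card_subset_eq[OF assms(3)]) (use g assms(4) inj in \<open>auto simp: card_image order_def\<close>)
  then interpret cyclic_rooted G g n z
    by unfold_locales (use g n_pos pow_eq z in auto)
  show ?thesis by (rule rep_ring_quotient_iso)
qed

end
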